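(* Under the standing assumptions in the context, on an enlarged probability space there exists a sequence of random times $(\tau_n)_{n\in\mathbb N}$ with $\tau_1=\tau$ such that, setting $S_n=\sum_{i=1}^n\tau_i$, under $\mathbb P$ the sequence $$\Big(\tau_{n+1},\ (X_{S_n+s}-X_{S_n})_{0\le s\le\tau_{n+1}}\Big)_{n\in\mathbb N}$$ is i.i.d., independent of $(\tau,(X_s)_{0\le s\le\tau})$, and each of its terms is distributed as $(\tau,(X_s)_{0\le s\le\tau})$ under $\mathbb P^{\angle}$.
   Context: Model: fix $q\in(0,1)$, $p_\circ,p_\bullet\in[0,1]$, $v_\circ=2p_\circ-1$, $v_\bullet=2p_\bullet-1$. Under $\mathbb P^\rho$: $\omega$ is a Poisson point process of intensity $\rho\sum_xP_x$ on the set $W$ of two-sided paths $w:\mathbb Z\to\mathbb Z$ with $|w(n+1)-w(n)|\le1$, where $P_x$ is the law of a two-sided lazy simple random walk (steps $-1,0,1$ with probabilities $\frac{1-q}2,q,\frac{1-q}2$) with $w(0)=x$; independently $(U_y)_{y\in\mathbb Z^2}$ are i.i.d. uniform $[0,1]$. $\mathcal T=\{(w(n),n): w\in\omega, n\in\mathbb Z\}$. For $y\in\mathbb Z^2$, $Y^y_0=y$, $Y^y_{i+1}=Y^y_i+(1,1)$ if ($Y^y_i\in\mathcal T$, $U_{Y^y_i}\le p_\bullet$) or ($Y^y_i\notin\mathcal T$, $U_{Y^y_i}\le p_\circ$), else $Y^y_{i+1}=Y^y_i+(-1,1)$; $X^y$ is its spatial coordinate; $Y=Y^{(0,0)}$,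 $X=X^{(0,0)}$. Standing assumptions: $v_\bullet>0$, $v_\circ>-1$, $\rho\in(0,\infty)$, and for some $v_\star\in(0,v_\bullet)$ there are $c_0>0,\gamma>1$ with $\mathbb P^\rho(\exists n\in\mathbb N: X_n<nv_\star-L)\le c_0^{-1}e^{-c_0\log^\gamma L}$ for all $L\in\mathbb N$. Write $\mathbb P=\mathbb P^\rho$, $\bar v=v_\star/3$. Cones: $\angle(x,n)=(x,n)+\{(x',n')\in\mathbb Z_+^2: x'\ge\bar vn'\}$ and $\angle^{\mathrm{rev}}(x,n)=(x,n)+\{(x',n')\in\mathbb Z_-^2: x'<\bar vn'\}$. $W^{\times}_y$ is the set of $w$ whose trace $\{(w(n),n)\}$ intersects both $\angle(y)$ and $\angle^{\mathrm{rev}}(y)$. $A^y=\{Y^y_i\in\angle(y)\ \forall i\ge0\}$. $R_k=\inf\{n\ge0: X_n\ge(1-\bar v)k+\bar vn\}$, $k\in\mathbb N$. $\mathbb P^{\angle}(\cdot)=\mathbb P(\,\cdot\mid \omega(W^\times_{(0,0)})=0,\ A^{(0,0)})$. $\mathcal I=\inf\{k\in\mathbb N: \omega(W^\times_{Y_{R_k}})=0\text{ and }A^{Y_{R_k}}\text{ occurs}\}$, $\tau=R_{\mathcal I}$. *)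

theory Defs
  imports "HOL-Probability.Probability"
begin

definition Wsp :: "(int \<Rightarrow> int) measure" where
  "Wsp = PiM UNIV (\<lambda>_::int. count_space (UNIV::int set))"

definition lazy_step :: "real \<Rightarrow> int pmf" where
  "lazy_step q = embed_pmf (\<lambda>k. if k = 0 then q else if \<bar>k\<bar> = 1 then (1 - q) / 2 else 0)"

text \<open>Two-sided path with w(0) = x and increments w(n+1) - w(n) = xi n.\<close>
definition incr_to_path :: "int \<Rightarrow> (int \<Rightarrow> int) \<Rightarrow> (int \<Rightarrow> int)" where
  "incr_to_path x xi = (\<lambda>n. if 0 \<le> n then x + (\<Sum>k\<in>{0..<n}. xi k) else x - (\<Sum>k\<in>{n..<0}. xi k))"

definition lazy_rw :: "real \<Rightarrow> int \<Rightarrow> (int \<Rightarrow> int) measure" where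
  "lazy_rw q x = distr (PiM UNIV (\<lambda>_::int. measure_pmf (lazy_step q))) Wsp (incr_to_path x)"

definition intensity :: "real \<Rightarrow> real \<Rightarrow> (int \<Rightarrow> int) measure" where
  "intensity \<rho> q = measure_of (space Wsp) (sets Wsp)
     (\<lambda>A. ennreal \<rho> * (\<integral>\<^sup>+ x. emeasure (lazy_rw q x) A \<partial>count_space (UNIV::int set)))"

text \<open>A point configuration is given by multiplicities m :: path => nat; omega(A) is the number
  of points (with multiplicity) in A.\<close>
definition pcount :: "((int \<Rightarrow> int) \<Rightarrow> nat) \<Rightarrow> (int \<Rightarrow> int) set \<Rightarrow> ennreal" where
  "pcount m A = (\<integral>\<^sup>+ w. ennreal (of_nat (m w)) \<partial>count_space A)"

definition poisson_law :: "'a measure \<Rightarrow> ('a \<Rightarrow> ennreal) \<Rightarrow> ennreal \<Rightarrow> bool" where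
  "poisson_law M N lam \<longleftrightarrow>
     (if lam = \<infinity> then (AE s in M. N s = \<infinity>)
      else (\<forall>k::nat. measure M {s \<in> space M. N s = of_nat k}
              = exp (- enn2real lam) * enn2real lam ^ k / fact k))"

definition is_PPP :: "'a measure \<Rightarrow> ('a \<Rightarrow> (int \<Rightarrow> int) \<Rightarrow> nat) \<Rightarrow> (int \<Rightarrow> int) measure \<Rightarrow> bool" where
  "is_PPP M m \<mu> \<longleftrightarrow>
     (\<forall>A\<in>sets \<mu>. (\<lambda>s. pcount (m s) A) \<in> borel_measurable M
                  \<and> poisson_law M (\<lambda>s. pcount (m s) A) (emeasure \<mu> A)) \<and>
     (\<forall>(F::nat \<Rightarrow> (int \<Rightarrow> int) set) n. (\<forall>i<n. F i \<in> sets \<mu>) \<longrightarrow> disjoint_family_on F {..<n} \<longrightarrow>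
        prob_space.indep_vars M (\<lambda>_. borel) (\<lambda>i s. pcount (m s) (F i)) {..<n})"

definition gen_sa :: "'a measure \<Rightarrow> 'i set \<Rightarrow> ('i \<Rightarrow> 'b measure) \<Rightarrow> ('i \<Rightarrow> 'a \<Rightarrow> 'b) \<Rightarrow> 'a set set" where
  "gen_sa M I N f = sigma_sets (space M) (\<Union>i\<in>I. {f i -` A \<inter> space M | A. A \<in> sets (N i)})"

definition trace :: "((int \<Rightarrow> int) \<Rightarrow> nat) \<Rightarrow> (int \<times> int) set" where
  "trace m = {(w n, n) | w n. m w > 0}"

text \<open>Y^y_i (space-time position), given p_circ = pc, p_bullet = pb, configuration m and
  uniforms u.\<close>
primrec Ywalk :: "real \<Rightarrow> real \<Rightarrow> ((int \<Rightarrow> int) \<Rightarrow> nat) \<Rightarrow> (int \<times> int \<Rightarrow> real)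
                    \<Rightarrow> int \<times> int \<Rightarrow> nat \<Rightarrow> int \<times> int" where
  "Ywalk pc pb m u y 0 = y"
| "Ywalk pc pb m u y (Suc i) =
     (let z = Ywalk pc pb m u y i in
      if (z \<in> trace m \<and> u z \<le> pb) \<or> (z \<notin> trace m \<and> u z \<le> pc)
      then (fst z + 1, snd z + 1) else (fst z - 1, snd z + 1))"

definition Xwalk :: "real \<Rightarrow> real \<Rightarrow> ((int \<Rightarrow> int) \<Rightarrow> nat) \<Rightarrow> (int \<times> int \<Rightarrow> real) \<Rightarrow> nat \<Rightarrow> int" where
  "Xwalk pc pb m u n = fst (Ywalk pc pb m u (0, 0) n)"

definition cone :: "real \<Rightarrow> int \<times> int \<Rightarrow> (int \<times> int) set" where
  "cone vb y = {(fst y + a, snd y + b) | a b. 0 \<le> a \<and> 0 \<le> b \<and> real_of_int a \<ge> vb * real_of_int b}"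

definition cone_rev :: "real \<Rightarrow> int \<times> int \<Rightarrow> (int \<times> int) set" where
  "cone_rev vb y = {(fst y + a, snd y + b) | a b. a \<le> 0 \<and> b \<le> 0 \<and> real_of_int a < vb * real_of_int b}"

definition Wcross :: "real \<Rightarrow> int \<times> int \<Rightarrow> (int \<Rightarrow> int) set" where
  "Wcross vb y = {w. (\<exists>n. (w n, n) \<in> cone vb y) \<and> (\<exists>n. (w n, n) \<in> cone_rev vb y)}"

definition Aevent :: "real \<Rightarrow> real \<Rightarrow> real \<Rightarrow> ((int \<Rightarrow> int) \<Rightarrow> nat) \<Rightarrow> (int \<times> int \<Rightarrow> real) \<Rightarrow> int \<times> int \<Rightarrow> bool" where
  "Aevent pc pb vb m u y \<longleftrightarrow> (\<forall>i. Ywalk pc pb m u y i \<in> cone vb y)"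

definition good :: "real \<Rightarrow> real \<Rightarrow> real \<Rightarrow> ((int \<Rightarrow> int) \<Rightarrow> nat) \<Rightarrow> (int \<times> int \<Rightarrow> real) \<Rightarrow> int \<times> int \<Rightarrow> bool" where
  "good pc pb vb m u y \<longleftrightarrow> pcount m (Wcross vb y) = 0 \<and> Aevent pc pb vb m u y"

definition Rtime :: "real \<Rightarrow> real \<Rightarrow> real \<Rightarrow> ((int \<Rightarrow> int) \<Rightarrow> nat) \<Rightarrow> (int \<times> int \<Rightarrow> real) \<Rightarrow> nat \<Rightarrow> nat" where
  "Rtime pc pb vb m u k =
     (LEAST n. real_of_int (Xwalk pc pb m u n) \<ge> (1 - vb) * real k + vb * real n)"

definition Iindex :: "real \<Rightarrow> real \<Rightarrow> real \<Rightarrow> ((int \<Rightarrow> int) \<Rightarrow> nat) \<Rightarrow> (int \<times> int \<Rightarrow> real) \<Rightarrow> nat" where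
  "Iindex pc pb vb m u =
     (LEAST k. 1 \<le> k \<and> good pc pb vb m u (Ywalk pc pb m u (0, 0) (Rtime pc pb vb m u k)))"

definition tau :: "real \<Rightarrow> real \<Rightarrow> real \<Rightarrow> ((int \<Rightarrow> int) \<Rightarrow> nat) \<Rightarrow> (int \<times> int \<Rightarrow> real) \<Rightarrow> nat" where
  "tau pc pb vb m u = Rtime pc pb vb m u (Iindex pc pb vb m u)"

definition Ssum :: "(nat \<Rightarrow> 'a \<Rightarrow> nat) \<Rightarrow> nat \<Rightarrow> 'a \<Rightarrow> nat" where
  "Ssum \<tau>s n s = (\<Sum>i\<in>{1..n}. \<tau>s i s)"

text \<open>The n-th piece (tau_{n+1}, (X_{S_n + j} - X_{S_n})_{0 <= j <= tau_{n+1}}), the path segment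
  written as a list of length tau_{n+1} + 1. For n = 0 this is (tau_1, (X_j)_{j <= tau_1}).\<close>
definition piece :: "(nat \<Rightarrow> int) \<Rightarrow> (nat \<Rightarrow> 'a \<Rightarrow> nat) \<Rightarrow> nat \<Rightarrow> 'a \<Rightarrow> nat \<times> int list" where
  "piece X \<tau>s n s =
     (\<tau>s (Suc n) s, map (\<lambda>j. X (Ssum \<tau>s n s + j) - X (Ssum \<tau>s n s)) [0..<Suc (\<tau>s (Suc n) s)])"

end

theory Submission
  imports Defs
begin

text \<open>
  The regeneration times are iterated: \<open>\<tau>\<^sub>n\<^sub>+\<^sub>1\<close> is the first regeneration time of the environment seen from
  \<open>Y\<close> at time \<open>S\<^sub>n\<close>. All events depend on the Poisson process only through its void events
  \<open>K \<inter> A = {}\<close>, where \<open>K\<close> is the set of occupied paths. These events are stable under intersection and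
  their probabilities are multiplicative over disjoint sets of paths, which gives invariance
  under shifts and independence of the restrictions to disjoint sets of paths and sites.

  Renewal. If the record site \<open>y\<close> at index \<open>k\<close> is good, then no path meets both the cone and the reverse
  cone of \<open>y\<close>. All earlier sites of the trajectory and the reverse cones of the earlier records lie in the
  reverse cone of \<open>y\<close>. Hence ``the first regeneration happens at \<open>y\<close> after a given segment'' is the
  intersection of an event about the paths that miss the cone of \<open>y\<close> with the goodness of \<open>y\<close>, and
  the latter only involves the paths that meet this cone.

  Finiteness. Let \<open>y\<close> be the \<open>k\<close>-th record site. If no path meets both the reverse cone of \<open>y\<close> and the cone
  of \<open>y + (l, l)\<close>, then, given the past of \<open>y\<close>, the walk makes \<open>l\<close> up-steps and reaches a good site with a
  probability that is bounded below. The offending paths are tight in Cesaro mean over \<open>k\<close>: those that the walk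
  has not met form a fresh Poisson process, and those that it has met are charged to the site
  of the first meeting, after which they must gain a height that grows linearly with the number of
  records in between. Since the failure of the first \<open>K\<close> attempts is up to a small error an event of the past,
  permanent failure has probability zero.
\<close>

section \<open>Environments\<close>

type_synonym path = "int \<Rightarrow> int"
type_synonym site = "int \<times> int"

text \<open>Goodness of a site looks at its whole future, so \<open>tau\<close> is no stopping time.
  Worse, the failure of the earlier records looks at cones that contain the cone of the regeneration
  site \<open>y\<close>. Such a failure becomes an event of the past only jointly with goodness of
  \<open>y\<close>. The proof therefore compares the environment with a reference environment in
  which everything seen by the cone of \<open>y\<close> is erased in such a way that
  \<open>y\<close> is good. The value of the initial segment is fixed first, which makes
  \<open>y\<close> deterministic: independence of restrictions to fixed sets then suffices, and no
  conditional expectation or strong Markov property appears.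

  For finiteness the obstacle is size bias: given the trajectory, the paths already met by the walk
  are not Poisson any more, and no bound at one given record is available. Each such path is fresh
  at its first meeting, though, and a path that spoils many later records must outrun the walk for
  long. This bounds the average over records, hence yields infinitely many usable ones. That is
  enough for probability zero, but it gives no rate for \<open>tau\<close>.\<close>

type_synonym env = "path set \<times> (site \<Rightarrow> real)"

text \<open>Multiplicities are dropped, as the walk and goodness only ask whether a path is
  occupied. Void events and upper bounds on marks form a generator stable under intersection, on
  which the law is explicit.\<close>

definition cyl :: "path set \<Rightarrow> site set \<Rightarrow> (site \<Rightarrow> real) \<Rightarrow> env set" where
  "cyl A J t = {e. fst e \<inter> A = {} \<and> (\<forall>z\<in>J. snd e z \<le> t z)}"

definition cyls :: "env set set" where
  "cyls = {cyl A J t | A J t. A \<in> sets Wsp \<and> finite J}"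

definition ENV :: "env measure" where
  "ENV = sigma UNIV cyls"

definition through :: "site \<Rightarrow> path set" where
  "through z = {w. w (snd z) = fst z}"

text \<open>The erased mark is 0 because it lies below both thresholds of the walk: an erased site
  always sends it up.\<close>

definition restr :: "path set \<Rightarrow> site set \<Rightarrow> env \<Rightarrow> env" where
  "restr B S e = (fst e \<inter> B, \<lambda>z. if z \<in> S then snd e z else 0)"

definition path_shift :: "site \<Rightarrow> path \<Rightarrow> path" where
  "path_shift y w = (\<lambda>n. w (n + snd y) - fst y)"

definition env_shift :: "site \<Rightarrow> env \<Rightarrow> env" where
  "env_shift y e = (path_shift y ` fst e, \<lambda>z. snd e (z + y))"

definition agree :: "path set \<Rightarrow> site set \<Rightarrow> env \<Rightarrow> env \<Rightarrow> bool" where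
  "agree B S e e' \<longleftrightarrow> fst e \<inter> B = fst e' \<inter> B \<and> (\<forall>z\<in>S. snd e z = snd e' z)"

text \<open>Measurability is included so that \<open>determined_restr\<close> exhibits
  \<open>E\<close> as a preimage under \<open>restr\<close>, the form in which independence is
  available.\<close>

definition determined_by :: "path set \<Rightarrow> site set \<Rightarrow> env set \<Rightarrow> bool" where
  "determined_by B S E \<longleftrightarrow> E \<in> sets ENV \<and> (\<forall>e e'. agree B S e e' \<longrightarrow> e \<in> E \<longrightarrow> e' \<in> E)"

text \<open>The case split is essential: \<open>enn2real \<infinity> = 0\<close> would turn an
  infinite intensity into void probability 1.\<close>

definition void_prob :: "ennreal \<Rightarrow> real" where
  "void_prob x = (if x = \<infinity> then 0 else exp (- enn2real x))"

lemma space_Wsp [simp]: "space Wsp = UNIV"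
  by (simp add: Wsp_def space_PiM PiE_UNIV_domain)

lemma measurable_eval_Wsp [measurable]: "(\<lambda>w. w n) \<in> measurable Wsp (count_space UNIV)"
  unfolding Wsp_def by measurable

lemma through_sets [measurable]: "through z \<in> sets Wsp"
proof -
  have "{w \<in> space Wsp. w (snd z) = fst z} \<in> sets Wsp" by measurable
  then show ?thesis by (simp add: through_def)
qed

lemma space_ENV [simp]: "space ENV = UNIV"
  by (simp add: ENV_def)

lemma sets_ENV: "sets ENV = sigma_sets UNIV cyls"
  by (simp add: ENV_def)

lemma cyl_in_sets: "A \<in> sets Wsp \<Longrightarrow> finite J \<Longrightarrow> cyl A J t \<in> sets ENV"
  unfolding sets_ENV by (rule sigma_sets.Basic) (auto simp: cyls_def)

lemma cyl_Int:
  "cyl A J t \<inter> cyl A' J' t' = cyl (A \<union> A') (J \<union> J')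
     (\<lambda>z. if z \<in> J then if z \<in> J' then min (t z) (t' z) else t z else t' z)"
  unfolding cyl_def by (auto split: if_splits)

lemma Int_stable_cyls: "Int_stable cyls"
  unfolding Int_stable_def cyls_def by (auto simp: cyl_Int) blast

lemma cyl_empty: "cyl {} {} t = UNIV"
  by (simp add: cyl_def)

lemma pred_avoid [measurable]:
  assumes "A \<in> sets Wsp" shows "Measurable.pred ENV (\<lambda>e. fst e \<inter> A = {})"
proof -
  have "cyl A {} (\<lambda>_. 0) \<in> sets ENV" by (rule cyl_in_sets) (use assms in auto)
  then show ?thesis by (simp add: pred_def cyl_def)
qed

lemma pred_mark [measurable]: "Measurable.pred ENV (\<lambda>e. snd e z \<le> t)"
proof -
  have "cyl {} {z} (\<lambda>_. t) \<in> sets ENV" by (rule cyl_in_sets) auto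
  then show ?thesis by (simp add: pred_def cyl_def)
qed

lemma sets_ENV_Collect: "Measurable.pred ENV Q \<Longrightarrow> {e. Q e} \<in> sets ENV"
  by (simp add: pred_def)

lemma measurable_into_ENV:
  assumes "\<And>A J t. A \<in> sets Wsp \<Longrightarrow> finite J \<Longrightarrow> f -` cyl A J t \<inter> space M \<in> sets M"
  shows "f \<in> measurable M ENV"
  unfolding ENV_def by (rule measurable_measure_of) (use assms in \<open>auto simp: cyls_def\<close>)

text \<open>On an erased site the bound reads \<open>0 \<le> t z\<close>, which either always holds
  or never.\<close>

lemma restr_vimage_cyl:
  "restr B S -` cyl A J t =
     (if \<forall>z\<in>J - S. 0 \<le> t z then cyl (A \<inter> B) (J \<inter> S) t else {})"
  unfolding cyl_def restr_def by (auto split: if_splits)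

lemma restr_measurable [measurable]:
  assumes "B \<in> sets Wsp" shows "restr B S \<in> measurable ENV ENV"
  by (rule measurable_into_ENV) (use assms in \<open>auto simp: restr_vimage_cyl intro!: cyl_in_sets\<close>)

lemma agree_restr: "agree B S e (restr B S e)"
  by (auto simp: agree_def restr_def)

lemma agree_sym: "agree B S e e' \<Longrightarrow> agree B S e' e"
  by (auto simp: agree_def)

lemma agree_mono: "agree B S e e' \<Longrightarrow> B' \<subseteq> B \<Longrightarrow> S' \<subseteq> S \<Longrightarrow> agree B' S' e e'"
  by (auto simp: agree_def)

lemma avoid_sets: "A \<in> sets Wsp \<Longrightarrow> {e. fst e \<inter> A = {}} \<in> sets ENV"
  by (rule sets_ENV_Collect) (rule pred_avoid)

lemma determined_iff: "determined_by B S E \<Longrightarrow> agree B S e e' \<Longrightarrow> e \<in> E \<longleftrightarrow> e' \<in> E"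
  unfolding determined_by_def using agree_sym by blast

lemma determined_restr: "determined_by B S E \<Longrightarrow> restr B S -` E = E"
  using determined_iff[OF _ agree_restr] by blast

lemma determined_sets: "determined_by B S E \<Longrightarrow> E \<in> sets ENV"
  by (simp add: determined_by_def)

lemma determined_mono: "determined_by B S E \<Longrightarrow> B \<subseteq> B' \<Longrightarrow> S \<subseteq> S' \<Longrightarrow> determined_by B' S' E"
  unfolding determined_by_def using agree_mono by blast

lemma determined_Int: "determined_by B S E \<Longrightarrow> determined_by B S E' \<Longrightarrow> determined_by B S (E \<inter> E')"
  unfolding determined_by_def by blast

lemma determined_restr_vimage:
  assumes "B \<in> sets Wsp" "E \<in> sets ENV"
  shows "determined_by B S (restr B S -` E)"
proof -
  have "restr B S -` E \<inter> space ENV \<in> sets ENV"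
    using assms by measurable
  moreover have "restr B S e = restr B S e'" if "agree B S e e'" for e e'
    using that by (auto simp: agree_def restr_def)
  ultimately show ?thesis by (auto simp: determined_by_def)
qed

lemma path_shift_comp: "path_shift y (path_shift z w) = path_shift (y + z) w"
  by (auto simp: path_shift_def fun_eq_iff algebra_simps)

lemma path_shift_0 [simp]: "path_shift 0 w = w"
  by (auto simp: path_shift_def)

lemma path_shift_measurable [measurable]: "path_shift y \<in> measurable Wsp Wsp"
proof -
  have "(\<lambda>w n. w (n + snd y) - fst y) \<in> measurable Wsp (PiM UNIV (\<lambda>_::int. count_space (UNIV::int set)))"
    by (rule measurable_PiM_single') (auto simp: space_PiM PiE_UNIV_domain)
  then show ?thesis by (simp add: path_shift_def[abs_def] Wsp_def)
qed

lemma path_shift_sets: "A \<in> sets Wsp \<Longrightarrow> path_shift y -` A \<in> sets Wsp"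
  using measurable_sets[OF path_shift_measurable, of A y] by simp

lemma env_shift_0 [simp]: "env_shift 0 e = e"
  by (auto simp: env_shift_def)

lemma env_shift_comp: "env_shift y (env_shift z e) = env_shift (y + z) e"
  by (auto simp: env_shift_def path_shift_comp image_image fun_eq_iff ac_simps)

lemma env_shift_vimage_cyl:
  "env_shift y -` cyl A J t = cyl (path_shift y -` A) ((\<lambda>z. z + y) ` J) (\<lambda>z. t (z - y))"
  unfolding cyl_def env_shift_def by auto

lemma env_shift_measurable [measurable]: "env_shift y \<in> measurable ENV ENV"
  by (rule measurable_into_ENV) (auto simp: env_shift_vimage_cyl intro!: cyl_in_sets path_shift_sets)

text \<open>All that is kept of the Poisson process are its void probabilities and the shift
  invariance of its intensity; \<open>F\<close> is the distribution function of a single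
  mark.\<close>

locale env_law = prob_space P for P :: "env measure" +
  fixes \<mu> :: "path measure" and F :: "real \<Rightarrow> real"
  assumes sets_P [measurable_cong]: "sets P = sets ENV"
    and sets_mu: "sets \<mu> = sets Wsp"
    and law: "\<And>A J t. A \<in> sets Wsp \<Longrightarrow> finite J \<Longrightarrow>
        prob (cyl A J t) = void_prob (emeasure \<mu> A) * (\<Prod>z\<in>J. F (t z))"
    and mu_shift: "\<And>A y. A \<in> sets Wsp \<Longrightarrow> emeasure \<mu> (path_shift y -` A) = emeasure \<mu> A"
begin

lemma space_P [simp]: "space P = UNIV"
  using sets_eq_imp_space_eq[OF sets_P] by simp

lemma void_prob_Un:
  assumes "A \<in> sets Wsp" "A' \<in> sets Wsp" "A \<inter> A' = {}"
  shows "void_prob (emeasure \<mu> (A \<union> A')) = void_prob (emeasure \<mu> A) * void_prob (emeasure \<mu> A')"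
proof -
  have "emeasure \<mu> (A \<union> A') = emeasure \<mu> A + emeasure \<mu> A'"
    by (rule plus_emeasure[symmetric]) (use assms sets_mu in auto)
  then show ?thesis
    by (auto simp: void_prob_def enn2real_plus exp_add less_top)
       (metis add_uminus_conv_diff exp_add minus_add_distrib)
qed

lemma prob_cyl_Int:
  assumes "A \<in> sets Wsp" "finite J" "A' \<in> sets Wsp" "finite J'" "A \<inter> A' = {}" "J \<inter> J' = {}"
  shows "prob (cyl A J t \<inter> cyl A' J' t') = prob (cyl A J t) * prob (cyl A' J' t')"
proof -
  let ?t = "\<lambda>z. if z \<in> J then if z \<in> J' then min (t z) (t' z) else t z else t' z"
  have "(\<Prod>z\<in>J \<union> J'. F (?t z)) = (\<Prod>z\<in>J. F (?t z)) * (\<Prod>z\<in>J'. F (?t z))"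
    using assms by (intro prod.union_disjoint) auto
  moreover have "(\<Prod>z\<in>J. F (?t z)) = (\<Prod>z\<in>J. F (t z))"
    using assms by (intro prod.cong) auto
  moreover have "(\<Prod>z\<in>J'. F (?t z)) = (\<Prod>z\<in>J'. F (t' z))"
    using assms by (intro prod.cong) auto
  ultimately show ?thesis
    using assms by (simp add: cyl_Int law void_prob_Un)
qed

text \<open>On cylinders over disjoint sets the void probabilities and the products of
  \<open>F\<close> factorise; stability under intersection lifts this to the generated
  sigma-algebras.\<close>

lemma indep_restr:
  assumes B: "B \<in> sets Wsp" "B' \<in> sets Wsp" "B \<inter> B' = {}" "S \<inter> S' = {}"
  shows "indep_set (sigma_sets UNIV ((\<lambda>E. restr B S -` E) ` cyls))
                   (sigma_sets UNIV ((\<lambda>E. restr B' S' -` E) ` cyls))"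
proof -
  have ev: "(\<lambda>E. restr B S -` E) ` cyls \<subseteq> events" if "B \<in> sets Wsp" for B S
    using that by (auto simp: cyls_def sets_P restr_vimage_cyl intro!: cyl_in_sets)
  have st: "Int_stable ((\<lambda>E. restr B S -` E) ` cyls)" for B S
    using Int_stable_cyls unfolding Int_stable_def
    by (auto simp: vimage_Int[symmetric] simp del: vimage_Int)
  have "indep_set ((\<lambda>E. restr B S -` E) ` cyls) ((\<lambda>E. restr B' S' -` E) ` cyls)"
  proof (rule indep_setI)
    fix a b assume "a \<in> (\<lambda>E. restr B S -` E) ` cyls" "b \<in> (\<lambda>E. restr B' S' -` E) ` cyls"
    then obtain A J t A' J' t' where *: "A \<in> sets Wsp" "finite J" "A' \<in> sets Wsp" "finite J'"
       "a = restr B S -` cyl A J t" "b = restr B' S' -` cyl A' J' t'"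
      unfolding cyls_def by blast
    have "prob (cyl (A \<inter> B) (J \<inter> S) t \<inter> cyl (A' \<inter> B') (J' \<inter> S') t')
        = prob (cyl (A \<inter> B) (J \<inter> S) t) * prob (cyl (A' \<inter> B') (J' \<inter> S') t')"
      by (rule prob_cyl_Int) (use * B in auto)
    then show "prob (a \<inter> b) = prob a * prob b"
      unfolding * restr_vimage_cyl by auto
  qed (use ev B in auto)
  from indep_set_sigma_sets[OF this st st] show ?thesis by simp
qed

lemma prob_determined_Int:
  assumes "B \<in> sets Wsp" "B' \<in> sets Wsp" "B \<inter> B' = {}" "S \<inter> S' = {}"
    and E: "determined_by B S E" "determined_by B' S' E'"
  shows "prob (E \<inter> E') = prob E * prob E'"
proof -
  have "restr B S -` E \<in> sigma_sets UNIV ((\<lambda>E. restr B S -` E) ` cyls)" if "E \<in> sets ENV" for B S E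
  proof -
    have "{restr B S -` A \<inter> UNIV | A. A \<in> sigma_sets UNIV cyls}
        = sigma_sets UNIV {restr B S -` A \<inter> UNIV | A. A \<in> cyls}"
      by (rule sigma_sets_vimage_commute) auto
    then show ?thesis using that unfolding sets_ENV
      by (auto simp: image_def) (smt (verit, ccfv_SIG) Collect_cong mem_Collect_eq)
  qed
  from indep_setD[OF indep_restr[OF assms(1-4)] this this] E
  show ?thesis by (metis determined_restr determined_sets)
qed

text \<open>The shifted law and \<open>P\<close> agree on the intersection-stable generator, since a
  shift moves cylinders to cylinders and preserves the intensity.\<close>

lemma prob_shift:
  assumes "E \<in> sets ENV"
  shows "prob (env_shift y -` E) = prob E"
proof -
  have [measurable]: "env_shift y \<in> measurable P P"
    by (simp add: measurable_cong_sets[OF sets_P sets_P])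
  interpret D: prob_space "distr P P (env_shift y)"
    by (rule prob_space_distr) simp
  have "distr P P (env_shift y) = P"
  proof (rule measure_eqI_generator_eq[where E=cyls and \<Omega>=UNIV and A="\<lambda>_. UNIV"])
    fix X assume "X \<in> cyls"
    then obtain A J t where *: "X = cyl A J t" "A \<in> sets Wsp" "finite J" by (auto simp: cyls_def)
    have "prob (env_shift y -` X) = prob X"
      using * by (simp add: env_shift_vimage_cyl law path_shift_sets mu_shift prod.reindex)
    moreover have "X \<in> sets P" using * by (simp add: sets_P cyl_in_sets)
    ultimately show "emeasure (distr P P (env_shift y)) X = emeasure P X"
      by (simp add: emeasure_distr emeasure_eq_measure)
  next
    show "range (\<lambda>_. UNIV) \<subseteq> cyls"
      using cyl_empty[of "\<lambda>_. 0"] by (auto simp: cyls_def)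
  qed (auto simp: Int_stable_cyls sets_P sets_ENV D.emeasure_eq_measure)
  then have "prob E = measure (distr P P (env_shift y)) E" by simp
  also have "\<dots> = prob (env_shift y -` E)"
    using assms by (subst measure_distr) (auto simp: sets_P)
  finally show ?thesis by simp
qed

lemma prob_avoid:
  assumes "A \<in> sets Wsp"
  shows "prob {e. fst e \<inter> A = {}} = void_prob (emeasure \<mu> A)"
  using law[OF assms, of "{}" "\<lambda>_. 0"] by (simp add: cyl_def)

text \<open>This is \<open>1 - exp (- x) \<le> x\<close>; stated in \<open>ennreal\<close>, it
  covers infinite intensity too.\<close>

lemma emeasure_hit_le:
  assumes A: "A \<in> sets Wsp"
  shows "emeasure P {e. fst e \<inter> A \<noteq> {}} \<le> emeasure \<mu> A"
proof (cases "emeasure \<mu> A = \<infinity>")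
  case False
  have "{e. fst e \<inter> A = {}} \<in> sets ENV"
    using pred_avoid[OF A] by (simp add: pred_def)
  then have "prob (UNIV - {e. fst e \<inter> A = {}}) = 1 - prob {e. fst e \<inter> A = {}}"
    using prob_compl[of "{e. fst e \<inter> A = {}}"] by (simp add: sets_P)
  moreover have "UNIV - {e. fst e \<inter> A = {}} = {e. fst e \<inter> A \<noteq> {}}" by auto
  ultimately have "prob {e. fst e \<inter> A \<noteq> {}} = 1 - exp (- enn2real (emeasure \<mu> A))"
    using False prob_avoid[OF A] unfolding void_prob_def by (metis infinity_ennreal_def)
  also have "\<dots> \<le> enn2real (emeasure \<mu> A)"
    using exp_ge_add_one_self[of "- enn2real (emeasure \<mu> A)"] by simp
  finally show ?thesis
    using False by (simp add: emeasure_eq_measure ennreal_le_iff2 less_top)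
       (metis ennreal_enn2real ennreal_leI infinity_ennreal_def less_top)
qed simp

lemma prob_marks:
  assumes "finite J"
  shows "prob {e. \<forall>z\<in>J. snd e z \<le> t z} = (\<Prod>z\<in>J. F (t z))"
  using law[of "{}" J t] assms by (simp add: cyl_def void_prob_def)

end

section \<open>Cones and the walk\<close>

definition hit_cone :: "real \<Rightarrow> site \<Rightarrow> path set" where
  "hit_cone v y = {w. \<exists>n. (w n, n) \<in> cone v y}"

definition hit_rev :: "real \<Rightarrow> site \<Rightarrow> path set" where
  "hit_rev v y = {w. \<exists>n. (w n, n) \<in> cone_rev v y}"

text \<open>The linear functional that is constant along the slanted sides of the cones. The
  condition defining \<open>R_k\<close> says that the height has reached
  \<open>(1 - v) * k\<close>.\<close>

definition height :: "real \<Rightarrow> site \<Rightarrow> real" where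
  "height v z = real_of_int (fst z) - v * real_of_int (snd z)"

lemma height_add: "height v (y + z) = height v y + height v z"
  by (simp add: height_def algebra_simps)

lemma height_diff: "height v (y - z) = height v y - height v z"
  by (simp add: height_def algebra_simps)

lemma height_0 [simp]: "height v 0 = 0"
  by (simp add: height_def)

lemma height_pair: "height v (a, b) = real_of_int a - v * real_of_int b"
  by (simp add: height_def)

lemma Wcross_eq: "Wcross v y = hit_cone v y \<inter> hit_rev v y"
  by (auto simp: Wcross_def hit_cone_def hit_rev_def)

lemma sets_exists_time: 
  assumes "\<And>n. {w. P n (w n)} \<in> sets Wsp"
  shows "{w. \<exists>n::int. P n (w n)} \<in> sets Wsp"
proof -
  have "{w. \<exists>n::int. P n (w n)} = (\<Union>n. {w. P n (w n)})" by auto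
  then show ?thesis using assms by auto
qed

lemma sets_at_time: "{w. P (w n)} \<in> sets Wsp"
proof -
  have "{w \<in> space Wsp. P (w n)} \<in> sets Wsp" by measurable
  then show ?thesis by simp
qed

lemma hit_cone_sets [measurable]: "hit_cone v y \<in> sets Wsp"
  unfolding hit_cone_def using sets_exists_time[OF sets_at_time, of "\<lambda>n x. (x, n) \<in> cone v y"] .

lemma hit_rev_sets [measurable]: "hit_rev v y \<in> sets Wsp"
  unfolding hit_rev_def using sets_exists_time[OF sets_at_time, of "\<lambda>n x. (x, n) \<in> cone_rev v y"] .

lemma Wcross_sets [measurable]: "Wcross v y \<in> sets Wsp"
  unfolding Wcross_eq by measurable

lemma through_subset: "z \<in> A \<Longrightarrow> w \<in> through z \<Longrightarrow> \<exists>n. (w n, n) \<in> A"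
  unfolding through_def by (rule exI[of _ "snd z"]) simp

lemma through_hit_cone: "z \<in> cone v y \<Longrightarrow> through z \<subseteq> hit_cone v y"
  unfolding hit_cone_def using through_subset by blast

lemma through_hit_rev: "z \<in> cone_rev v y \<Longrightarrow> through z \<subseteq> hit_rev v y"
  unfolding hit_rev_def using through_subset by blast

locale cones =
  fixes v :: real
  assumes v: "0 < v" "v < 1"
begin

abbreviation "C \<equiv> cone v"
abbreviation "CR \<equiv> cone_rev v"
abbreviation "H \<equiv> hit_cone v"
abbreviation "HR \<equiv> hit_rev v"
abbreviation "ht \<equiv> height v"

text \<open>As \<open>v > 0\<close>, the cone is an up-set of the product of the time order and the
  height order. Inclusions of cones then become transitivity.\<close>

lemma cone_iff: "z \<in> C y \<longleftrightarrow> snd y \<le> snd z \<and> ht y \<le> ht z"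
proof
  assume *: "snd y \<le> snd z \<and> ht y \<le> ht z"
  then have "v * (snd z - snd y) \<ge> 0" using v by simp
  with * have "0 \<le> fst z - fst y" "0 \<le> snd z - snd y"
      "v * real_of_int (snd z - snd y) \<le> real_of_int (fst z - fst y)"
    by (auto simp: height_def algebra_simps)
  moreover have "z = (fst y + (fst z - fst y), snd y + (snd z - snd y))" by simp
  ultimately show "z \<in> C y" unfolding cone_def by blast
qed (auto simp: cone_def height_def algebra_simps)

lemma cone_rev_iff: "z \<in> CR y \<longleftrightarrow> snd z \<le> snd y \<and> ht z < ht y"
proof
  assume *: "snd z \<le> snd y \<and> ht z < ht y"
  then have "v * (snd z - snd y) \<le> 0" using v by (simp add: mult_le_0_iff)
  with * have "fst z - fst y \<le> 0" "snd z - snd y \<le> 0"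
      "v * real_of_int (snd z - snd y) > real_of_int (fst z - fst y)"
    by (auto simp: height_def algebra_simps)
  moreover have "z = (fst y + (fst z - fst y), snd y + (snd z - snd y))" by simp
  ultimately show "z \<in> CR y" unfolding cone_rev_def by blast
qed (auto simp: cone_rev_def height_def algebra_simps)

lemma cone_self [simp]: "y \<in> C y"
  by (simp add: cone_iff)

lemma cone_subset: "z \<in> C y \<Longrightarrow> C z \<subseteq> C y"
  by (auto simp: cone_iff)

lemma H_subset: "z \<in> C y \<Longrightarrow> H z \<subseteq> H y"
  using cone_subset unfolding hit_cone_def by blast

lemma HR_subset: "z \<in> C y \<Longrightarrow> HR y \<subseteq> HR z"
  unfolding hit_rev_def by (auto simp: cone_rev_iff cone_iff) (meson dual_order.trans less_le_trans)

lemma diag_in_cone: "0 \<le> l \<Longrightarrow> y + (l, l) \<in> C y"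
  using v by (simp add: cone_iff height_add height_pair mult_left_le_one_le)

lemma height_diag: "ht (y + (l, l)) = ht y + (1 - v) * l"
  by (simp add: height_add height_pair algebra_simps)

end

section \<open>The walk, its records and its regenerations\<close>

locale walk = cones +
  fixes pc pb :: real
  assumes pc: "0 \<le> pc" and pb: "0 \<le> pb"
begin

definition goes_up :: "env \<Rightarrow> site \<Rightarrow> bool" where
  "goes_up e z \<longleftrightarrow> snd e z \<le> (if fst e \<inter> through z = {} then pc else pb)"

primrec Y :: "env \<Rightarrow> site \<Rightarrow> nat \<Rightarrow> site" where
  "Y e y 0 = y"
| "Y e y (Suc n) = Y e y n + (if goes_up e (Y e y n) then (1, 1) else (-1, 1))"

definition good_at :: "env \<Rightarrow> site \<Rightarrow> bool" where
  "good_at e y \<longleftrightarrow> fst e \<inter> Wcross v y = {} \<and> (\<forall>i. Y e y i \<in> C y)"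

text \<open>A relation expressing \<open>R_k = r\<close>: it holds for no \<open>r\<close> if the
  level is never reached, where \<open>LEAST\<close> would return an arbitrary number.\<close>

definition record_at :: "env \<Rightarrow> nat \<Rightarrow> nat \<Rightarrow> bool" where
  "record_at e k r \<longleftrightarrow> (\<forall>i<r. ht (Y e 0 i) < (1 - v) * k) \<and> (1 - v) * k \<le> ht (Y e 0 r)"

definition regen :: "env \<Rightarrow> nat \<Rightarrow> nat \<Rightarrow> bool" where
  "regen e k r \<longleftrightarrow> 1 \<le> k \<and> record_at e k r \<and> good_at e (Y e 0 r) \<and>
     (\<forall>k' r'. 1 \<le> k' \<longrightarrow> k' < k \<longrightarrow> record_at e k' r' \<longrightarrow> \<not> good_at e (Y e 0 r'))"

lemma snd_Y [simp]: "snd (Y e y n) = snd y + int n"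
  by (induction n) (auto simp: algebra_simps)

lemma Y_add: "Y e y (m + n) = Y e (Y e y m) n"
  by (induction n) auto

lemma goes_up_cong:
  assumes "fst e \<inter> through z = fst e' \<inter> through z" "snd e z = snd e' z"
  shows "goes_up e z = goes_up e' z"
  using assms by (simp add: goes_up_def)

lemma env_shift_through:
  "fst (env_shift y e) \<inter> through z = {} \<longleftrightarrow> fst e \<inter> through (z + y) = {}"
  by (auto simp: env_shift_def through_def path_shift_def)

lemma goes_up_shift: "goes_up (env_shift y e) z = goes_up e (z + y)"
  by (simp add: goes_up_def env_shift_through) (simp add: env_shift_def)

lemma Y_shift: "Y (env_shift y e) z n = Y e (z + y) n - y"
  by (induction n) (auto simp: goes_up_shift algebra_simps)

lemma path_shift_cone: "(path_shift y w n, n) \<in> C z \<longleftrightarrow> (w (n + snd y), n + snd y) \<in> C (z + y)"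
  by (simp add: cone_iff height_add height_pair path_shift_def) (simp add: height_def algebra_simps)

lemma path_shift_cone_rev: "(path_shift y w n, n) \<in> CR z \<longleftrightarrow> (w (n + snd y), n + snd y) \<in> CR (z + y)"
  by (simp add: cone_rev_iff height_add height_pair path_shift_def) (simp add: height_def algebra_simps)

lemma path_shift_H: "path_shift y w \<in> H z \<longleftrightarrow> w \<in> H (z + y)"
  unfolding hit_cone_def mem_Collect_eq path_shift_cone
  by (metis diff_add_cancel)

lemma path_shift_HR: "path_shift y w \<in> HR z \<longleftrightarrow> w \<in> HR (z + y)"
  unfolding hit_rev_def mem_Collect_eq path_shift_cone_rev
  by (metis diff_add_cancel)

lemma cone_shift: "z - y \<in> C x \<longleftrightarrow> z \<in> C (x + y)"
  by (auto simp: cone_iff height_add height_diff)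

lemma good_at_shift: "good_at (env_shift y e) z = good_at e (z + y)"
proof -
  have "fst (env_shift y e) \<inter> (H z \<inter> HR z) = {} \<longleftrightarrow> fst e \<inter> (H (z + y) \<inter> HR (z + y)) = {}"
    by (auto simp: env_shift_def path_shift_H path_shift_HR)
  then show ?thesis
    unfolding good_at_def Wcross_eq Y_shift cone_shift by simp
qed

lemma height_Y_Suc: "ht (Y e y (Suc n)) \<le> ht (Y e y n) + (1 - v)"
  by (auto simp: height_add height_pair)

lemma record_unique: "record_at e k r \<Longrightarrow> record_at e k r' \<Longrightarrow> r = r'"
  unfolding record_at_def by (metis linorder_neqE_nat not_le)

lemma record_mono:
  assumes "record_at e k r" "record_at e k' r'" "k' \<le> k" shows "r' \<le> r"
proof (rule ccontr)
  assume "\<not> r' \<le> r"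
  then have "ht (Y e 0 r) < (1 - v) * k'" using assms by (auto simp: record_at_def)
  moreover have "(1 - v) * k' \<le> (1 - v) * k" using assms v by simp
  ultimately show False using assms by (auto simp: record_at_def)
qed

lemma record_exists:
  assumes "(1 - v) * k \<le> ht (Y e 0 n)" obtains r where "record_at e k r" "r \<le> n"
proof -
  let ?r = "LEAST n. (1 - v) * k \<le> ht (Y e 0 n)"
  have "record_at e k ?r" unfolding record_at_def
  proof (intro conjI allI impI)
    show "(1 - v) * k \<le> ht (Y e 0 ?r)" using assms by (rule LeastI)
    show "ht (Y e 0 i) < (1 - v) * k" if "i < ?r" for i using not_less_Least[OF that] by simp
  qed
  moreover have "?r \<le> n" using assms by (rule Least_le)
  ultimately show ?thesis using that by blast
qed

lemma record_smaller:
  assumes "record_at e k r" "k' \<le> k" obtains r' where "record_at e k' r'" "r' \<le> r"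
proof -
  have "(1 - v) * k' \<le> (1 - v) * k" using assms v by simp
  also have "\<dots> \<le> ht (Y e 0 r)" using assms by (simp add: record_at_def)
  finally show ?thesis by (rule record_exists) (use that in blast)
qed

lemma record_0 [simp]: "record_at e 0 0"
  by (simp add: record_at_def)

text \<open>A step gains at most \<open>1 - v\<close>, which is exactly the spacing of the levels.
  So a record overshoots by less than one level, and distinct indices have distinct record
  times.\<close>

lemma record_upper:
  assumes "record_at e k r" shows "ht (Y e 0 r) < (1 - v) * (real k + 1)"
proof (cases r)
  case 0
  then show ?thesis using v by simp
next
  case (Suc n)
  then have "ht (Y e 0 n) < (1 - v) * k" using assms by (auto simp: record_at_def)
  then show ?thesis using height_Y_Suc[of e 0 n] Suc by (simp add: algebra_simps)
qed

lemma record_strict: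
  assumes "record_at e k r" "record_at e k' r'" "k' < k" shows "r' < r"
proof -
  have "r' \<noteq> r"
  proof
    assume "r' = r"
    have "(1 - v) * (real k' + 1) \<le> (1 - v) * k"
      using assms v by (intro mult_left_mono) auto
    then show False using record_upper[OF assms(2)] assms(1) \<open>r' = r\<close> by (simp add: record_at_def)
  qed
  then show ?thesis using record_mono[OF assms(1,2)] assms(3) by simp
qed

lemma record_ge: "record_at e k r \<Longrightarrow> k \<le> r"
proof (induction k arbitrary: r)
  case (Suc k)
  from record_smaller[OF Suc.prems, of k] obtain r' where "record_at e k r'" by auto
  then show ?case using Suc.IH[of r'] record_strict[OF Suc.prems, of k r'] by simp
qed simp

lemma record_in_cone:
  assumes "record_at e k r" "record_at e k' r'" "k' \<le> k" shows "Y e 0 r \<in> C (Y e 0 r')"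
proof (cases "r' = r")
  case False
  then have "r' < r" using record_mono[OF assms] by simp
  then have "ht (Y e 0 r') < ht (Y e 0 r)"
    using assms(1) unfolding record_at_def by (meson less_le_trans)
  then show ?thesis using \<open>r' < r\<close> by (simp add: cone_iff)
qed simp

lemma before_record:
  assumes "record_at e k r" "i < r" shows "Y e 0 i \<in> CR (Y e 0 r)"
proof -
  have "ht (Y e 0 i) < ht (Y e 0 r)"
    using assms unfolding record_at_def by (meson less_le_trans)
  then show ?thesis using assms by (simp add: cone_rev_iff)
qed

lemma regen_unique:
  assumes "regen e k r" "regen e k' r'" shows "k = k'" "r = r'"
proof -
  have "\<not> k < k'" "\<not> k' < k" using assms unfolding regen_def by blast+
  then show "k = k'" by simp
  then show "r = r'" using assms record_unique unfolding regen_def by blast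
qed

lemma ex_regen:
  assumes "1 \<le> k" "record_at e k r" "good_at e (Y e 0 r)" shows "\<exists>k r. regen e k r"
proof -
  let ?P = "\<lambda>k. 1 \<le> k \<and> (\<exists>r. record_at e k r \<and> good_at e (Y e 0 r))"
  have "?P (LEAST k. ?P k)" by (rule LeastI[of ?P k]) (use assms in blast)
  moreover have "\<not> ?P k'" if "k' < (LEAST k. ?P k)" for k'
    using not_less_Least[OF that] .
  ultimately show ?thesis unfolding regen_def by blast
qed

section \<open>What decides the past and the future of a good site\<close>

lemma not_good_at_crossing: "good_at e y \<Longrightarrow> w \<in> fst e \<Longrightarrow> w \<in> HR y \<Longrightarrow> w \<notin> H y"
  by (auto simp: good_at_def Wcross_eq)

text \<open>While the walk stays in the cone, it reads only marks in the cone and paths through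
  sites of the cone, and these paths hit the cone.\<close>

lemma fut_transfer:
  assumes ag: "agree (H y) (C y) e e'" and st: "\<And>i. Y e z i \<in> C y"
  shows "Y e' z i = Y e z i"
proof (induction i)
  case (Suc i)
  have "goes_up e (Y e z i) = goes_up e' (Y e z i)"
  proof (rule goes_up_cong)
    show "fst e \<inter> through (Y e z i) = fst e' \<inter> through (Y e z i)"
      using ag through_hit_cone[OF st[of i]] by (auto simp: agree_def)
  qed (use ag st in \<open>auto simp: agree_def\<close>)
  then show ?case using Suc by simp
qed simp

lemma good_at_transfer:
  assumes ag: "agree (H y) (C y) e e'" and g: "good_at e z" and z: "z \<in> C y"
  shows "good_at e' z" "Y e' z i = Y e z i"
proof -
  have ag': "agree (H z) (C z) e e'"
    using ag by (rule agree_mono) (use H_subset cone_subset z in auto)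
  have *: "Y e' z i = Y e z i" for i
    by (rule fut_transfer[OF ag']) (use g in \<open>simp add: good_at_def\<close>)
  show "Y e' z i = Y e z i" by (rule *)
  have "fst e' \<inter> Wcross v z = fst e \<inter> Wcross v z"
    using ag' by (auto simp: agree_def Wcross_eq)
  then show "good_at e' z" using g by (simp add: good_at_def *)
qed

lemma good_at_transfer_iff:
  assumes "agree (H y) (C y) e e'" "z \<in> C y"
  shows "good_at e z \<longleftrightarrow> good_at e' z"
  using assms good_at_transfer(1) agree_sym by blast

lemma regen_fut_transfer:
  assumes ag: "agree (H 0) (C 0) e e'" and g: "good_at e 0" and r: "regen e k r"
  shows "regen e' k r"
proof -
  have Y: "Y e' 0 i = Y e 0 i" for i using good_at_transfer(2)[OF ag g] by simp
  have "good_at e' (Y e 0 i) = good_at e (Y e 0 i)" for i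
    using good_at_transfer_iff[OF ag, of "Y e 0 i"] g unfolding good_at_def[of e 0] by blast
  with r show ?thesis unfolding regen_def record_at_def Y by simp
qed

text \<open>Goodness of \<open>y\<close> in both environments forbids occupied paths in
  \<open>H y \<inter> HR y\<close>, so agreement off \<open>H y\<close> gives agreement on
  \<open>HR y\<close>. This fixes the trajectory up to \<open>y\<close> and the crossing paths of
  earlier records, whose reverse cones lie in that of \<open>y\<close>.\<close>

lemma past_transfer:
  assumes ag: "agree (- H y) (- C y) e e'" and g: "good_at e y" "good_at e' y"
    and r: "record_at e k r" and y: "y = Y e 0 r"
  shows "i \<le> r \<Longrightarrow> Y e' 0 i = Y e 0 i"
    and "k' \<le> k \<Longrightarrow> record_at e k' r' \<Longrightarrow> record_at e' k' r'"
    and "k' \<le> k \<Longrightarrow> record_at e k' r' \<Longrightarrow> good_at e (Y e 0 r') \<Longrightarrow> good_at e' (Y e 0 r')"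
proof -
  have rev_eq: "fst e \<inter> HR y = fst e' \<inter> HR y"
    using not_good_at_crossing[OF g(1)] not_good_at_crossing[OF g(2)] ag by (auto simp: agree_def)
  have Y: "Y e' 0 i = Y e 0 i" if "i \<le> r" for i
    using that
  proof (induction i)
    case (Suc i)
    then have z: "Y e 0 i \<in> CR y" using before_record[OF r, of i] y by simp
    have "goes_up e (Y e 0 i) = goes_up e' (Y e 0 i)"
    proof (rule goes_up_cong)
      show "fst e \<inter> through (Y e 0 i) = fst e' \<inter> through (Y e 0 i)"
        using rev_eq through_hit_rev[OF z] by auto
      \<comment> \<open>Strictness in the reverse cone keeps it disjoint from the cone, so this mark
        is among those that agree.\<close>
      have "Y e 0 i \<notin> C y" using z by (auto simp: cone_rev_iff cone_iff)
      then show "snd e (Y e 0 i) = snd e' (Y e 0 i)" using ag by (auto simp: agree_def)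
    qed
    then show ?case using Suc by simp
  qed simp
  show "i \<le> r \<Longrightarrow> Y e' 0 i = Y e 0 i" by (rule Y)
  show "record_at e' k' r'" if "k' \<le> k" "record_at e k' r'"
  proof -
    have "r' \<le> r" using record_mono[OF r that(2,1)] .
    moreover have "Y e' 0 i = Y e 0 i" if "i \<le> r'" for i using Y that \<open>r' \<le> r\<close> by simp
    ultimately show ?thesis using that unfolding record_at_def by simp
  qed
  show "good_at e' (Y e 0 r')" if "k' \<le> k" "record_at e k' r'" and gd': "good_at e (Y e 0 r')"
  proof -
    let ?y = "Y e 0 r'"
    have r': "r' \<le> r" using record_mono[OF r that(2,1)] .
    have yc: "y \<in> C ?y" unfolding y by (rule record_in_cone[OF r that(2,1)])
    have 1: "fst e' \<inter> Wcross v ?y = {}"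
      using gd' rev_eq HR_subset[OF yc] unfolding good_at_def Wcross_eq by auto
    \<comment> \<open>Before time \<open>r\<close> the walk is the one in \<open>e\<close>;
      afterwards goodness of \<open>y\<close> in \<open>e'\<close> keeps it in the cone of
      \<open>y\<close>, which lies in the cone of \<open>?y\<close>.\<close>
    have 2: "Y e' ?y i \<in> C ?y" for i
    proof (cases "r' + i \<le> r")
      case True
      have "Y e' ?y i = Y e' 0 (r' + i)" using Y[OF r'] by (simp add: Y_add)
      also have "\<dots> = Y e ?y i" using Y[OF True] by (simp add: Y_add)
      finally show ?thesis using gd' by (simp add: good_at_def)
    next
      case False
      define j where "j = r' + i - r"
      have j: "r' + i = r + j" using False by (simp add: j_def)
      have "Y e' ?y i = Y e' 0 (r' + i)" using Y[OF r'] by (simp add: Y_add)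
      also have "\<dots> = Y e' y j" unfolding j y using Y[of r] by (simp add: Y_add)
      also have "\<dots> \<in> C y" using g(2) by (simp add: good_at_def)
      finally show ?thesis using cone_subset[OF yc] by blast
    qed
    show ?thesis unfolding good_at_def using 1 2 by blast
  qed
qed

lemma regen_past_transfer:
  assumes ag: "agree (- H y) (- C y) e e'" and g: "good_at e y" "good_at e' y"
    and r: "regen e k r" and y: "y = Y e 0 r"
  shows "regen e' k r" "i \<le> r \<Longrightarrow> Y e' 0 i = Y e 0 i" "good_at e' 0 \<longleftrightarrow> good_at e 0"
proof -
  have rec: "record_at e k r" using r by (simp add: regen_def)
  note T = past_transfer[OF ag g rec y]
  have y': "y = Y e' 0 r" and rec': "record_at e' k r" using T(1)[of r] T(2)[of k r] rec y by auto
  note T' = past_transfer[OF agree_sym[OF ag] g(2,1) rec' y']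
  show "i \<le> r \<Longrightarrow> Y e' 0 i = Y e 0 i" by (rule T(1))
  \<comment> \<open>The origin is the record of index 0, so its goodness transfers like that of any
    earlier record.\<close>
  show "good_at e' 0 \<longleftrightarrow> good_at e 0" using T(3)[of 0 0] T'(3)[of 0 0] by auto
  have "\<not> good_at e' (Y e' 0 r')" if k': "1 \<le> k'" "k' < k" and r': "record_at e' k' r'" for k' r'
  proof
    assume good_at: "good_at e' (Y e' 0 r')"
    have "good_at e (Y e' 0 r')" "record_at e k' r'" using T'(2,3)[OF less_imp_le[OF k'(2)] r'] good_at by auto
    moreover have "Y e' 0 r' = Y e 0 r'"
      using record_mono[OF rec' r'] k' by (intro T(1)) simp
    ultimately show False using r k' by (auto simp: regen_def)
  qed
  then show "regen e' k r" using r rec' g(2) y' by (auto simp: regen_def)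
qed

text \<open>A mark below both thresholds forces an up-step whether or not the site is occupied, so
  the paths need not be known.\<close>

lemma Y_diag:
  assumes "\<And>j. j < l \<Longrightarrow> snd e (y + (int j, int j)) \<le> min pc pb" "i \<le> l"
  shows "Y e y i = y + (int i, int i)"
  using assms(2)
proof (induction i)
  case (Suc i)
  have IH: "Y e y i = y + (int i, int i)" using Suc by simp
  have "goes_up e (y + (int i, int i))" using assms(1)[of i] Suc.prems by (auto simp: goes_up_def)
  then show ?case unfolding Y.simps IH by (simp add: prod_eq_iff)
qed (simp add: zero_prod_def[symmetric])

text \<open>Each forced up-step gains exactly one level. Since the starting record overshoots by
  less than one level, level \<open>k + l\<close> is not passed before the last of these
  steps.\<close>

lemma record_diag:
  assumes r: "record_at e k r" and d: "\<And>j. j < l \<Longrightarrow> snd e (Y e 0 r + (int j, int j)) \<le> min pc pb"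
  shows "record_at e (k + l) (r + l)" "Y e 0 (r + l) = Y e 0 r + (int l, int l)"
proof -
  have *: "Y e 0 (r + i) = Y e 0 r + (int i, int i)" if "i \<le> l" for i
    unfolding Y_add by (rule Y_diag[OF d that])
  show "Y e 0 (r + l) = Y e 0 r + (int l, int l)" by (rule *) simp
  have low: "(1 - v) * k \<le> ht (Y e 0 r)" using r by (simp add: record_at_def)
  have "ht (Y e 0 i) < (1 - v) * (k + l)" if "i < r + l" for i
  proof (cases "i < r")
    case True
    then have "ht (Y e 0 i) < (1 - v) * k" using r by (simp add: record_at_def)
    also have "\<dots> \<le> (1 - v) * (k + l)" using v by simp
    finally show ?thesis .
  next
    case False
    define j where "j = i - r"
    have j: "i = r + j" "j < l" using False that by (auto simp: j_def)
    have "ht (Y e 0 i) = ht (Y e 0 r) + (1 - v) * j"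
      using *[of j] j height_diag[of "Y e 0 r" "int j"] by simp
    also have "\<dots> < (1 - v) * (real k + 1) + (1 - v) * j" using record_upper[OF r] by simp
    also have "\<dots> = (1 - v) * (real k + real (Suc j))" by (simp add: algebra_simps)
    also have "\<dots> \<le> (1 - v) * (k + l)" using v j by (intro mult_left_mono) auto
    finally show ?thesis .
  qed
  moreover have "(1 - v) * (k + l) \<le> ht (Y e 0 (r + l))"
    using low *[of l] height_diag[of "Y e 0 r" "int l"] by (simp add: algebra_simps)
  ultimately show "record_at e (k + l) (r + l)" by (simp add: record_at_def)
qed

section \<open>Measurability of walk, records and regenerations\<close>

lemma pred_goes_up [measurable]: "Measurable.pred ENV (\<lambda>e. goes_up e z)"
proof -
  have "goes_up e z \<longleftrightarrow> (if fst e \<inter> through z = {} then snd e z \<le> pc else snd e z \<le> pb)" for e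
    by (simp add: goes_up_def)
  then show ?thesis by simp
qed

lemma measurable_Y [measurable]: "(\<lambda>e. Y e y n) \<in> measurable ENV (count_space UNIV)"
proof (induction n)
  case (Suc n)
  have "(\<lambda>e. (\<lambda>z e. z + (if goes_up e z then (1, 1) else (-1, 1))) (Y e y n) e)
      \<in> measurable ENV (count_space UNIV)"
    by (rule measurable_compose_countable[OF _ Suc]) measurable
  then show ?case by simp
qed simp

lemma pred_good_at [measurable]: "Measurable.pred ENV (\<lambda>e. good_at e y)"
  unfolding good_at_def by measurable

lemma pred_good_at_Y [measurable]: "Measurable.pred ENV (\<lambda>e. good_at e (Y e y n))"
  by (rule measurable_compose_countable[where f="\<lambda>z e. good_at e z"]) measurable

lemma pred_record [measurable]: "Measurable.pred ENV (\<lambda>e. record_at e k r)"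
  unfolding record_at_def by measurable

lemma pred_regen [measurable]: "Measurable.pred ENV (\<lambda>e. regen e k r)"
  unfolding regen_def by measurable

lemma determined_good_at: "determined_by (H y) (C y) {e. good_at e y}"
  unfolding determined_by_def
proof (intro conjI allI impI)
  show "{e. good_at e y} \<in> sets ENV" using pred_good_at[of y] by (simp add: pred_def)
  fix e e' assume "agree (H y) (C y) e e'" "e \<in> {e. good_at e y}"
  then show "e' \<in> {e. good_at e y}" using good_at_transfer(1)[of y e e' y] by simp
qed

end

section \<open>The renewal identity\<close>

type_synonym seg = "nat \<times> int list"

lemma determined_shift:
  assumes "0 < v" "v < 1" "determined_by (hit_cone v 0) (cone v 0) E"
  shows "determined_by (hit_cone v y) (cone v y) (env_shift y -` E)"
proof -
  interpret cones v by unfold_locales fact+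
  \<comment> \<open>Only the shift rules for cones are wanted from this locale, so the thresholds
    can be any nonnegative numbers.\<close>
  interpret walk v 1 1 by unfold_locales auto
  have "agree (H 0) (C 0) (env_shift y e) (env_shift y e')" if ag: "agree (H y) (C y) e e'" for e e'
  proof -
    have "path_shift y ` fst e \<inter> H 0 = path_shift y ` (fst e \<inter> H y)" for e :: env
      by (auto simp: path_shift_H)
    moreover have "z + y \<in> C y" if "z \<in> C 0" for z using that by (simp add: cone_iff height_add)
    ultimately show ?thesis using ag by (simp add: agree_def env_shift_def)
  qed
  moreover have "env_shift y -` E \<in> sets ENV"
    using measurable_sets[OF env_shift_measurable determined_sets[OF assms(3)], of y] by simp
  ultimately show ?thesis using assms(3) unfolding determined_by_def vimage_eq by blast
qed

section \<open>Segments and chains of regenerations\<close>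

context walk
begin

definition seg :: "env \<Rightarrow> nat \<Rightarrow> seg" where
  "seg e r = (r, map (\<lambda>j. fst (Y e 0 j)) [0..<Suc r])"

text \<open>Existence of all the regenerations is part of the event, so no default value of a
  regeneration time can enter.\<close>

primrec chain :: "seg set list \<Rightarrow> env set" where
  "chain [] = UNIV"
| "chain (A # As) = {e. \<exists>k r. regen e k r \<and> seg e r \<in> A \<and> env_shift (Y e 0 r) e \<in> chain As}"

text \<open>Fixing the segment makes the regeneration site deterministic, which allows independence
  at a fixed site to be applied.\<close>

lemma seg_eqD: "seg e r = a \<Longrightarrow> Y e 0 r = (snd a ! r, int r)"
proof -
  assume a: "seg e r = a"
  show ?thesis unfolding a[symmetric] by (simp add: seg_def prod_eq_iff nth_append)
qed

lemma seg_cong: "(\<And>i. i \<le> r \<Longrightarrow> Y e 0 i = Y e' 0 i) \<Longrightarrow> seg e r = seg e' r"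
  by (auto simp: seg_def)

lemma pred_seg [measurable]: "Measurable.pred ENV (\<lambda>e. seg e r = a)"
proof -
  have "seg e r = a \<longleftrightarrow> fst a = r \<and> length (snd a) = Suc r \<and> (\<forall>j<Suc r. fst (Y e 0 j) = snd a ! j)" for e
    unfolding seg_def prod_eq_iff fst_conv snd_conv list_eq_iff_nth_eq length_map length_upt nth_map_upt
    by (auto simp del: upt_Suc)
  then show ?thesis by simp
qed

lemma pred_seg_in [measurable]: "Measurable.pred ENV (\<lambda>e. seg e r \<in> A)"
proof -
  have "seg e r \<in> A \<longleftrightarrow> (\<exists>a. a \<in> A \<and> seg e r = a)" for e by blast
  then show ?thesis by simp
qed

lemma pred_env_shift_Y:
  assumes [measurable]: "E \<in> sets ENV"
  shows "Measurable.pred ENV (\<lambda>e. env_shift (Y e 0 r) e \<in> E)"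
  by (rule measurable_compose_countable[where f="\<lambda>z e. env_shift z e \<in> E"]) measurable

lemma chain_sets: "chain As \<in> sets ENV"
proof (induction As)
  case (Cons A As)
  note [measurable] = pred_env_shift_Y[OF Cons]
  show ?case unfolding chain.simps by (rule sets_ENV_Collect) measurable
qed (use sets.top[of ENV] in simp)

text \<open>Restricting replaces the marks in the cone by \<open>0\<close>, hence by up-steps, so the restricted
  environment is automatically good at \<open>y\<close>.\<close>

lemma good_at_restr: "good_at (restr (- H y) (- C y) e) y"
proof -
  let ?e = "restr (- H y) (- C y) e"
  have d: "snd ?e (y + (int j, int j)) \<le> min pc pb" for j
    using pc pb diag_in_cone[of "int j" y] by (simp add: restr_def)
  have "Y ?e y i \<in> C y" for i
    using Y_diag[of i ?e y i, OF d] diag_in_cone[of "int i" y] by simp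
  then show ?thesis by (auto simp: good_at_def restr_def Wcross_eq)
qed

text \<open>Goodness at the origin confines the trajectory to the cone, so that the cone decides the
  first regeneration. The regeneration site is good again, which is what the induction needs for the
  shifted environment.\<close>

lemma determined_chain: "determined_by (H 0) (C 0) (chain As \<inter> {e. good_at e 0})"
proof -
  have "e' \<in> chain As" if "agree (H 0) (C 0) e e'" "good_at e 0" "e \<in> chain As" for e e'
    using that
  proof (induction As arbitrary: e e')
    case (Cons A As)
    from Cons.prems obtain k r where
      r: "regen e k r" "seg e r \<in> A" "env_shift (Y e 0 r) e \<in> chain As" by auto
    let ?y = "Y e 0 r"
    have Y: "Y e' 0 i = Y e 0 i" for i using good_at_transfer(2)[OF Cons.prems(1,2)] by simp
    have yC: "?y \<in> C 0" using Cons.prems by (simp add: good_at_def)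
    have "agree (H 0) (C 0) (env_shift ?y e) (env_shift ?y e')"
    proof -
      have "path_shift ?y ` fst e \<inter> H 0 = path_shift ?y ` (fst e \<inter> H ?y)" for e :: env
        by (auto simp: path_shift_H)
      moreover have "fst e \<inter> H ?y = fst e' \<inter> H ?y"
        using Cons.prems(1) H_subset[OF yC] by (auto simp: agree_def)
      moreover have "z + ?y \<in> C 0" if "z \<in> C 0" for z
        using that yC by (simp add: cone_iff height_add)
      ultimately show ?thesis using Cons.prems(1) by (simp add: agree_def env_shift_def)
    qed
    moreover have "good_at (env_shift ?y e) 0" using r by (simp add: good_at_shift regen_def)
    ultimately have "env_shift ?y e' \<in> chain As" using Cons.IH r by blast
    then have "env_shift (Y e' 0 r) e' \<in> chain As" unfolding Y .
    moreover have "regen e' k r" by (rule regen_fut_transfer[OF Cons.prems(1,2) r(1)])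
    moreover have "seg e' r \<in> A" using r(2) seg_cong[of r e' e] Y by simp
    ultimately show ?case unfolding chain.simps by blast
  qed simp
  moreover have "good_at e' 0" if "agree (H 0) (C 0) e e'" "good_at e 0" for e e'
    using good_at_transfer(1)[OF that] by simp
  moreover have "chain As \<inter> {e. good_at e 0} \<in> sets ENV"
    using chain_sets sets_ENV_Collect[OF pred_good_at[of 0]] by blast
  ultimately show ?thesis unfolding determined_by_def
  proof (intro conjI allI impI)
    fix e e' assume "agree (H 0) (C 0) e e'" "e \<in> chain As \<inter> {e. good_at e 0}"
    then show "e' \<in> chain As \<inter> {e. good_at e 0}"
      using \<open>\<And>e e'. agree (H 0) (C 0) e e' \<Longrightarrow> good_at e 0 \<Longrightarrow> e \<in> chain As \<Longrightarrow> e' \<in> chain As\<close>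
        \<open>\<And>e e'. agree (H 0) (C 0) e e' \<Longrightarrow> good_at e 0 \<Longrightarrow> good_at e' 0\<close> by simp
  qed
qed

end

section \<open>Factorisation at the regeneration site\<close>

locale walk_law = walk + env_law
begin

definition p_good :: real where
  "p_good = prob {e. good_at e 0}"

lemma sets_P_Collect: "Measurable.pred ENV Q \<Longrightarrow> {e. Q e} \<in> events"
  unfolding sets_P by (rule sets_ENV_Collect)

text \<open>Both probabilities of regeneration events carry the same factor
  \<open>prob Past\<close>, multiplied by the probability of what the cone of \<open>y\<close> sees;
  cross-multiplication eliminates it. The flag \<open>b\<close> treats the laws with and without
  goodness of the origin at once.\<close>

lemma regen_split:
  fixes b :: bool and a :: seg and r :: nat
  defines "y \<equiv> (snd a ! r, int r)"
  assumes B: "determined_by (H 0) (C 0) (B \<inter> {e. good_at e 0})"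
  shows "prob {e. regen e k r \<and> seg e r = a \<and> (b \<longrightarrow> good_at e 0) \<and> env_shift (Y e 0 r) e \<in> B} * p_good
       = prob {e. regen e k r \<and> seg e r = a \<and> (b \<longrightarrow> good_at e 0)} * prob (B \<inter> {e. good_at e 0})"
proof -
  define D where "D = {e. regen e k r \<and> seg e r = a \<and> (b \<longrightarrow> good_at e 0)}"
  \<comment> \<open>The erased environment is good at \<open>y\<close>, so evaluating
    \<open>D\<close> there turns it into an event that ignores the cone, without loss on the event
    that \<open>y\<close> is good.\<close>
  define Past where "Past = restr (- H y) (- C y) -` D"
  have D_sets: "D \<in> sets ENV" unfolding D_def by (rule sets_ENV_Collect) measurable
  have yD: "Y e 0 r = y" if "e \<in> D" for e using that seg_eqD by (auto simp: D_def y_def)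
  have transfer: "e' \<in> D" if "agree (- H y) (- C y) e e'" "good_at e y" "good_at e' y" "e \<in> D" for e e'
  proof -
    have *: "regen e k r" "seg e r = a" "b \<longrightarrow> good_at e 0" using that(4) by (auto simp: D_def)
    note T = regen_past_transfer[OF that(1-3) *(1) yD[OF that(4), symmetric]]
    have "seg e' r = a" using T(2) *(2) seg_cong[of r e' e] by simp
    then show ?thesis using T(1,3) * by (simp add: D_def)
  qed
  have past: "e \<in> D \<longleftrightarrow> e \<in> Past \<and> good_at e y" for e
  proof
    assume e: "e \<in> D"
    then have "good_at e y" using yD[OF e] by (auto simp: D_def regen_def)
    with transfer[OF agree_restr this good_at_restr e] show "e \<in> Past \<and> good_at e y" by (simp add: Past_def)
  next
    assume "e \<in> Past \<and> good_at e y"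
    then show "e \<in> D"
      using transfer[OF agree_sym[OF agree_restr] good_at_restr, of e] by (auto simp: Past_def)
  qed
  have sets_c: "- H y \<in> sets Wsp"
    using sets.compl_sets[OF hit_cone_sets[of v y]] by (simp add: Compl_eq_Diff_UNIV)
  have detP: "determined_by (- H y) (- C y) Past"
    unfolding Past_def by (rule determined_restr_vimage[OF sets_c D_sets])
  have main: "prob (Past \<inter> env_shift y -` E) = prob Past * prob E" if E: "determined_by (H 0) (C 0) E" for E
  proof -
    have "prob (Past \<inter> env_shift y -` E) = prob Past * prob (env_shift y -` E)"
      by (rule prob_determined_Int[OF sets_c hit_cone_sets _ _ detP determined_shift[OF v E]]) auto
    then show ?thesis using prob_shift[OF determined_sets[OF E]] by simp
  qed
  have 1: "{e. regen e k r \<and> seg e r = a \<and> (b \<longrightarrow> good_at e 0) \<and> env_shift (Y e 0 r) e \<in> B}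
      = Past \<inter> env_shift y -` (B \<inter> {e. good_at e 0})"
  proof -
    have "{e. regen e k r \<and> seg e r = a \<and> (b \<longrightarrow> good_at e 0) \<and> env_shift (Y e 0 r) e \<in> B}
      = {e. e \<in> D \<and> env_shift (Y e 0 r) e \<in> B}" by (auto simp: D_def)
    also have "\<dots> = {e. e \<in> D \<and> env_shift y e \<in> B}" using yD by auto
    finally show ?thesis using past by (auto simp: good_at_shift)
  qed
  have 2: "D = Past \<inter> env_shift y -` {e. good_at e 0}"
    using past by (auto simp: good_at_shift)
  show ?thesis
    unfolding 1 D_def[symmetric] main[OF B]
    by (subst 2, subst main[OF determined_good_at]) (simp add: p_good_def)
qed

text \<open>\<open>regen_split\<close> summed over the countably many values of index, time and
  segment. The events are disjoint because a regeneration is unique.\<close>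

lemma regen_identity:
  fixes b :: bool
  assumes B: "determined_by (H 0) (C 0) (B \<inter> {e. good_at e 0})" and Bm: "B \<in> sets ENV"
  shows "prob {e. (b \<longrightarrow> good_at e 0) \<and> (\<exists>k r. regen e k r \<and> seg e r \<in> A \<and> env_shift (Y e 0 r) e \<in> B)} * p_good
       = prob {e. (b \<longrightarrow> good_at e 0) \<and> (\<exists>k r. regen e k r \<and> seg e r \<in> A)} * prob (B \<inter> {e. good_at e 0})"
proof -
  let ?I = "{i :: nat \<times> nat \<times> seg. snd (snd i) \<in> A}"
  define X where "X B = (\<lambda>(k, r, a). {e. regen e k r \<and> seg e r = a \<and> (b \<longrightarrow> good_at e 0) \<and> env_shift (Y e 0 r) e \<in> B})"
    for B :: "env set"
  have XE: "X B (k, r, a) = {e. regen e k r \<and> seg e r = a \<and> (b \<longrightarrow> good_at e 0) \<and> env_shift (Y e 0 r) e \<in> B}"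
    for k r a B by (simp add: X_def)
  have sum: "emeasure P (\<Union>i\<in>?I. X B i) = (\<integral>\<^sup>+ i. emeasure P (X B i) \<partial>count_space ?I)"
    if Bm: "B \<in> sets ENV" for B
  proof (rule emeasure_UN_countable)
    fix i assume "i \<in> ?I"
    note [measurable] = pred_env_shift_Y[OF Bm]
    obtain k r a where "i = (k, r, a)" by (metis prod_cases3)
    then show "X B i \<in> events" unfolding XE \<open>i = _\<close> by (intro sets_P_Collect) measurable
  next
    show "disjoint_family_on (X B) ?I"
    proof (unfold disjoint_family_on_def, intro ballI impI equals0I)
      fix i j e assume ij: "i \<noteq> j" and e: "e \<in> X B i \<inter> X B j"
      obtain k r a k' r' a' where *: "i = (k, r, a)" "j = (k', r', a')" by (metis prod_cases3)
      have "regen e k r" "regen e k' r'" "seg e r = a" "seg e r' = a'"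
        using e by (simp_all add: * XE)
      then show False using regen_unique[of e k r k' r'] ij * by simp
    qed
  qed simp
  have "emeasure P (\<Union>i\<in>?I. X B i) * ennreal p_good
      = (\<integral>\<^sup>+ i. emeasure P (X B i) * ennreal p_good \<partial>count_space ?I)"
    by (subst sum[OF Bm], subst nn_integral_multc) auto
  also have "\<dots> = (\<integral>\<^sup>+ i. emeasure P (X UNIV i) * emeasure P (B \<inter> {e. good_at e 0}) \<partial>count_space ?I)"
  proof (rule nn_integral_cong)
    fix i :: "nat \<times> nat \<times> seg"
    obtain k r a where "i = (k, r, a)" by (metis prod_cases3)
    then have "prob (X B i) * p_good = prob (X UNIV i) * prob (B \<inter> {e. good_at e 0})"
      using regen_split[OF B, of k r a b] by (simp add: XE)
    then show "emeasure P (X B i) * ennreal p_good = emeasure P (X UNIV i) * emeasure P (B \<inter> {e. good_at e 0})"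
      by (simp add: emeasure_eq_measure ennreal_mult[symmetric] p_good_def)
  qed
  also have "\<dots> = emeasure P (\<Union>i\<in>?I. X UNIV i) * emeasure P (B \<inter> {e. good_at e 0})"
    by (subst sum, use sets.top[of ENV] in simp, subst nn_integral_multc) auto
  finally have "prob (\<Union>i\<in>?I. X B i) * p_good = prob (\<Union>i\<in>?I. X UNIV i) * prob (B \<inter> {e. good_at e 0})"
    by (simp add: emeasure_eq_measure ennreal_mult[symmetric] p_good_def)
  moreover have "(\<Union>i\<in>?I. X B i)
      = {e. (b \<longrightarrow> good_at e 0) \<and> (\<exists>k r. regen e k r \<and> seg e r \<in> A \<and> env_shift (Y e 0 r) e \<in> B)}" for B
  proof (intro equalityI subsetI)
    fix e assume "e \<in> {e. (b \<longrightarrow> good_at e 0) \<and> (\<exists>k r. regen e k r \<and> seg e r \<in> A \<and> env_shift (Y e 0 r) e \<in> B)}"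
    then obtain k r where "b \<longrightarrow> good_at e 0" "regen e k r" "seg e r \<in> A" "env_shift (Y e 0 r) e \<in> B" by blast
    then show "e \<in> (\<Union>i\<in>?I. X B i)" by (intro UN_I[of "(k, r, seg e r)"]) (simp_all add: XE)
  next
    fix e assume "e \<in> (\<Union>i\<in>?I. X B i)"
    then obtain i where i: "i \<in> ?I" "e \<in> X B i" by blast
    obtain k r a where "i = (k, r, a)" by (metis prod_cases3)
    with i have "regen e k r" "seg e r \<in> A" "b \<longrightarrow> good_at e 0" "env_shift (Y e 0 r) e \<in> B"
      by (auto simp: XE)
    then show "e \<in> {e. (b \<longrightarrow> good_at e 0) \<and> (\<exists>k r. regen e k r \<and> seg e r \<in> A \<and> env_shift (Y e 0 r) e \<in> B)}"
      by blast
  qed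
  ultimately show ?thesis by simp
qed

definition first_seg :: "bool \<Rightarrow> seg set \<Rightarrow> real" where
  "first_seg b A = prob {e. (b \<longrightarrow> good_at e 0) \<and> (\<exists>k r. regen e k r \<and> seg e r \<in> A)}"

text \<open>The identity with \<open>b = True\<close> reproduces goodness at the origin after each
  renewal, so every piece contributes the same conditional law.\<close>

lemma chain_good:
  assumes "p_good > 0"
  shows "prob (chain As \<inter> {e. good_at e 0}) = p_good * (\<Prod>A\<leftarrow>As. first_seg True A / p_good)"
proof (induction As)
  case (Cons A As)
  have "prob (chain (A # As) \<inter> {e. good_at e 0}) * p_good
      = first_seg True A * prob (chain As \<inter> {e. good_at e 0})"
    using regen_identity[OF determined_chain chain_sets, of True A As]
    by (simp add: first_seg_def Int_def conj_commute)
  then show ?case using assms Cons by (simp add: field_simps)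
qed (simp add: p_good_def)

lemma chain_prob:
  assumes "p_good > 0"
  shows "prob (chain (A # As)) = first_seg False A * (\<Prod>A\<leftarrow>As. first_seg True A / p_good)"
proof -
  have "prob (chain (A # As)) * p_good = first_seg False A * prob (chain As \<inter> {e. good_at e 0})"
    using regen_identity[OF determined_chain chain_sets, of False A As] by (simp add: first_seg_def)
  then show ?thesis using assms by (simp add: chain_good)
qed

end

section \<open>Exploration along the records\<close>

text \<open>A pointwise comparison of the numbers of occurring events, integrated. It converts the
  combinatorial charging of bad records into a bound on probabilities.\<close>

lemma (in prob_space) sum_prob_le_by_count:
  assumes "finite I" "finite J" "\<And>i. i \<in> I \<Longrightarrow> A i \<in> events" "\<And>j. j \<in> J \<Longrightarrow> B j \<in> events"
    and le: "\<And>x. x \<in> space M \<Longrightarrow> card {i \<in> I. x \<in> A i} \<le> card {j \<in> J. x \<in> B j}"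
  shows "(\<Sum>i\<in>I. prob (A i)) \<le> (\<Sum>j\<in>J. prob (B j))"
proof -
  have count: "(\<Sum>i\<in>I. indicator (A i) x) = real (card {i \<in> I. x \<in> A i})" if "finite I" for I x and A :: "_ \<Rightarrow> 'a set"
    using that by (simp add: indicator_def sum.If_cases Int_def)
  have int: "integrable M (\<lambda>x. indicator E x :: real)" if "E \<in> events" for E
    using that by (intro integrable_real_indicator) (auto simp: emeasure_eq_measure)
  have exp: "(\<Sum>i\<in>I. prob (A i)) = expectation (\<lambda>x. \<Sum>i\<in>I. indicator (A i) x)"
      "integrable M (\<lambda>x. \<Sum>i\<in>I. indicator (A i) x :: real)"
    if "\<And>i. i \<in> I \<Longrightarrow> A i \<in> events" for I :: "'z set" and A
    using that int by (auto simp: Bochner_Integration.integral_sum intro!: Bochner_Integration.integrable_sum sum.cong)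
  have "(\<Sum>i\<in>I. prob (A i)) = expectation (\<lambda>x. \<Sum>i\<in>I. indicator (A i) x)"
    by (rule exp(1)) (rule assms)
  also have "\<dots> \<le> expectation (\<lambda>x. \<Sum>j\<in>J. indicator (B j) x)"
    by (rule integral_mono[OF exp(2) exp(2)]) (use assms in \<open>auto simp: count\<close>)
  also have "\<dots> = (\<Sum>j\<in>J. prob (B j))"
    by (rule exp(1)[symmetric]) (rule assms)
  finally show ?thesis .
qed

context walk
begin

definition traj :: "env \<Rightarrow> nat \<Rightarrow> site list" where
  "traj e r = map (Y e 0) [0..<Suc r]"

text \<open>Stopping at the \<open>k\<close>-th record as a property of the trajectory alone, which
  allows a sum over all stopped trajectories.\<close>

definition rec_list :: "nat \<Rightarrow> site list \<Rightarrow> bool" where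
  "rec_list k zs \<longleftrightarrow> (\<forall>i<length zs - 1. ht (zs ! i) < (1 - v) * k) \<and> (1 - v) * k \<le> ht (last zs)"

text \<open>The last site is left out: the walk has arrived there but has not yet inspected its
  paths.\<close>

definition visited :: "site list \<Rightarrow> path set" where
  "visited zs = (\<Union>z\<in>set (butlast zs). through z)"

lemma traj_length [simp]: "length (traj e r) = Suc r"
  by (simp add: traj_def)

lemma traj_nth [simp]: "i \<le> r \<Longrightarrow> traj e r ! i = Y e 0 i"
  unfolding traj_def by (subst nth_map) (auto simp del: upt_Suc)

lemma traj_last [simp]: "last (traj e r) = Y e 0 r"
  by (simp add: traj_def)

lemma traj_butlast: "butlast (traj e r) = map (Y e 0) [0..<r]"
  by (simp add: traj_def butlast_append)

lemma visited_traj: "visited (traj e r) = (\<Union>i<r. through (Y e 0 i))"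
  unfolding visited_def traj_butlast by auto

lemma traj_cong: "(\<And>i. i \<le> r \<Longrightarrow> Y e 0 i = Y e' 0 i) \<Longrightarrow> traj e r = traj e' r"
  by (auto simp: traj_def)

lemma rec_list_traj: "rec_list k (traj e r) \<longleftrightarrow> record_at e k r"
  by (auto simp: rec_list_def record_at_def)

lemma pred_traj [measurable]: "Measurable.pred ENV (\<lambda>e. traj e r = zs)"
proof -
  have "traj e r = zs \<longleftrightarrow> length zs = Suc r \<and> (\<forall>j<Suc r. Y e 0 j = zs ! j)" for e
    unfolding traj_def list_eq_iff_nth_eq length_map length_upt by (auto simp del: upt_Suc)
  then show ?thesis by simp
qed

lemma visited_sets [measurable]: "visited zs \<in> sets Wsp"
  unfolding visited_def by auto

lemma traj_transfer:
  assumes "\<And>i. i < r \<Longrightarrow> fst e \<inter> through (Y e 0 i) = fst e' \<inter> through (Y e 0 i)"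
    and "\<And>i. i < r \<Longrightarrow> snd e (Y e 0 i) = snd e' (Y e 0 i)"
  shows "i \<le> r \<Longrightarrow> Y e' 0 i = Y e 0 i"
proof (induction i)
  case (Suc i)
  have "goes_up e (Y e 0 i) = goes_up e' (Y e 0 i)"
    by (rule goes_up_cong) (use assms[of i] Suc.prems in auto)
  then show ?case using Suc by simp
qed simp

lemma determined_traj: "determined_by (visited zs) UNIV {e. traj e (length zs - 1) = zs}"
  unfolding determined_by_def
proof (intro conjI allI impI)
  show "{e. traj e (length zs - 1) = zs} \<in> sets ENV" by (rule sets_ENV_Collect) measurable
  fix e e' assume ag: "agree (visited zs) UNIV e e'" and e: "e \<in> {e. traj e (length zs - 1) = zs}"
  let ?r = "length zs - 1"
  have zs: "zs = traj e ?r" using e by simp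
  have "Y e' 0 i = Y e 0 i" if "i \<le> ?r" for i
  proof (rule traj_transfer[OF _ _ that])
    fix i assume "i < ?r"
    then have "through (Y e 0 i) \<subseteq> visited zs" by (subst zs) (auto simp: visited_traj)
    then show "fst e \<inter> through (Y e 0 i) = fst e' \<inter> through (Y e 0 i)"
      using ag by (auto simp: agree_def)
    show "snd e (Y e 0 i) = snd e' (Y e 0 i)" using ag unfolding agree_def by blast
  qed
  then have "traj e' ?r = traj e ?r" by (intro traj_cong) auto
  then show "e' \<in> {e. traj e ?r = zs}" using zs by simp
qed

section \<open>Forced up-steps and the future of a site\<close>

definition diag_up :: "site \<Rightarrow> nat \<Rightarrow> env set" where
  "diag_up y l = {e. \<forall>j<l. snd e (y + (int j, int j)) \<le> min pc pb}"

lemma diag_up_sets: "diag_up y l \<in> sets ENV"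
  unfolding diag_up_def by (rule sets_ENV_Collect) measurable

lemma determined_diag_up: "determined_by {} {z. snd y \<le> snd z \<and> snd z < snd y + int l} (diag_up y l)"
  unfolding determined_by_def
proof (intro conjI allI impI)
  fix e e' assume "agree {} {z. snd y \<le> snd z \<and> snd z < snd y + int l} e e'" "e \<in> diag_up y l"
  moreover have "y + (int j, int j) \<in> {z. snd y \<le> snd z \<and> snd z < snd y + int l}" if "j < l" for j
    using that by simp
  ultimately have "e \<in> diag_up y l" "\<And>j. j < l \<Longrightarrow> snd e (y + (int j, int j)) = snd e' (y + (int j, int j))"
    unfolding agree_def by blast+
  then show "e' \<in> diag_up y l" by (simp add: diag_up_def)
qed (rule diag_up_sets)

text \<open>Time only increases along the walk, so marks earlier than \<open>z\<close> are never
  read from \<open>z\<close> on. After the restriction only paths in \<open>B\<close> are left to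
  matter.\<close>

lemma determined_future:
  assumes B: "B \<in> sets Wsp" and E: "E \<in> sets ENV"
    and dep: "\<And>e e'. (\<And>i. Y e z i = Y e' z i) \<Longrightarrow> fst e = fst e' \<Longrightarrow> e \<in> E \<Longrightarrow> e' \<in> E"
  shows "determined_by B {x. snd z \<le> snd x} (restr B UNIV -` E)"
  unfolding determined_by_def
proof (intro conjI allI impI)
  show "restr B UNIV -` E \<in> sets ENV"
    using measurable_sets[OF restr_measurable[OF B] E] by simp
  fix e e' assume ag: "agree B {x. snd z \<le> snd x} e e'" and e: "e \<in> restr B UNIV -` E"
  have fst: "fst (restr B UNIV e) = fst (restr B UNIV e')"
    using ag by (simp add: agree_def restr_def)
  have "Y (restr B UNIV e) z i = Y (restr B UNIV e') z i" for i
  proof (induction i)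
    case (Suc i)
    have "goes_up (restr B UNIV e) (Y (restr B UNIV e') z i) = goes_up (restr B UNIV e') (Y (restr B UNIV e') z i)"
    proof (rule goes_up_cong)
      have mark: "snd (restr B UNIV e) x = snd (restr B UNIV e') x" if "snd z \<le> snd x" for x
        using ag that by (cases x) (simp add: agree_def restr_def)
      show "snd (restr B UNIV e) (Y (restr B UNIV e') z i) = snd (restr B UNIV e') (Y (restr B UNIV e') z i)"
        by (rule mark) simp
    qed (simp add: fst)
    then show ?case using Suc by simp
  qed simp
  then show "e' \<in> restr B UNIV -` E" using dep[OF _ fst] e by simp
qed

lemma compl_sets_Wsp: "B \<in> sets Wsp \<Longrightarrow> - B \<in> sets Wsp"
  using sets.compl_sets[of B Wsp] by (simp add: Compl_eq_Diff_UNIV)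

text \<open>Without occupied paths from the reverse cone of \<open>y\<close> to the cone of
  \<open>z\<close>, erasing all paths that meet the former is invisible from the latter.\<close>

lemma agree_outside_past:
  assumes "fst e \<inter> (HR y \<inter> H z) = {}"
  shows "agree (H z) (C z) e (restr (- HR y) UNIV e)"
  using assms by (auto simp: agree_def restr_def)

section \<open>Paths that make a record bad\<close>

definition exceed :: "site \<Rightarrow> real \<Rightarrow> path set" where
  "exceed z s = {w \<in> through z. \<exists>n\<ge>snd z. ht z + s \<le> ht (w n, n)}"

lemma exceed_sets [measurable]: "exceed z s \<in> sets Wsp"
proof -
  have "exceed z s = through z \<inter> {w. \<exists>n. n \<ge> snd z \<and> ht z + s \<le> ht (w n, n)}"
    by (auto simp: exceed_def)
  then show ?thesis
    using sets_exists_time[OF sets_at_time, of "\<lambda>n x. n \<ge> snd z \<and> ht z + s \<le> ht (x, n)"]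
    by simp
qed

lemma exceed_shift: "exceed z s = path_shift z -` exceed 0 s"
proof -
  have "(\<exists>n\<ge>snd z. ht z + s \<le> ht (w n, n)) \<longleftrightarrow> (\<exists>n\<ge>0. s \<le> ht (path_shift z w n, n))" for w
  proof -
    have "s \<le> ht (path_shift z w n, n) \<longleftrightarrow> ht z + s \<le> ht (w (n + snd z), n + snd z)" for n
      by (simp add: height_def path_shift_def algebra_simps)
    then have "(\<exists>n\<ge>0. s \<le> ht (path_shift z w n, n)) \<longleftrightarrow> (\<exists>n\<ge>0. ht z + s \<le> ht (w (n + snd z), n + snd z))"
      by simp
    also have "\<dots> \<longleftrightarrow> (\<exists>n\<ge>snd z. ht z + s \<le> ht (w n, n))" (is "?L \<longleftrightarrow> ?R")
    proof
      assume ?L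
      then obtain n where "n \<ge> 0" "ht z + s \<le> ht (w (n + snd z), n + snd z)" by blast
      then show ?R by (intro exI[of _ "n + snd z"]) simp
    next
      assume ?R
      then obtain n where "n \<ge> snd z" "ht z + s \<le> ht (w n, n)" by blast
      then show ?L by (intro exI[of _ "n - snd z"]) simp
    qed
    finally show ?thesis by simp
  qed
  then show ?thesis by (auto simp: exceed_def through_def path_shift_def)
qed

definition bad :: "nat \<Rightarrow> nat \<Rightarrow> env set" where
  "bad k l = {e. \<exists>r. record_at e k r \<and> fst e \<inter> (HR (Y e 0 r) \<inter> H (Y e 0 r + (int l, int l))) \<noteq> {}}"

definition bad_visited :: "nat \<Rightarrow> nat \<Rightarrow> env set" where
  "bad_visited k l =
     {e. \<exists>r. record_at e k r \<and> (\<exists>i<r. fst e \<inter> (through (Y e 0 i) \<inter> H (Y e 0 r + (int l, int l))) \<noteq> {})}"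

definition bad_unvisited :: "nat \<Rightarrow> nat \<Rightarrow> env set" where
  "bad_unvisited k l = {e. \<exists>r. record_at e k r \<and>
     fst e \<inter> ((HR (Y e 0 r) \<inter> H (Y e 0 r + (int l, int l))) - visited (traj e r)) \<noteq> {}}"

text \<open>Removing the paths met before time \<open>i\<close> makes \<open>i\<close> the time of
  the first meeting, when the path is still fresh.\<close>

definition first_exceed :: "nat \<Rightarrow> real \<Rightarrow> env set" where
  "first_exceed i s = {e. fst e \<inter> (exceed (Y e 0 i) s - visited (traj e i)) \<noteq> {}}"

lemma bad_subset: "bad k l \<subseteq> bad_unvisited k l \<union> bad_visited k l"
  unfolding bad_def bad_visited_def bad_unvisited_def visited_traj by blast

lemma bad_sets: "bad k l \<in> sets ENV"
proof -
  have [measurable]: "Measurable.pred ENV (\<lambda>e. fst e \<inter> (HR (Y e 0 r) \<inter> H (Y e 0 r + (int l, int l))) = {})" for r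
  proof (rule measurable_compose_countable[where f="\<lambda>z e. fst e \<inter> (HR z \<inter> H (z + (int l, int l))) = {}"])
    show "Measurable.pred ENV (\<lambda>e. fst e \<inter> (HR z \<inter> H (z + (int l, int l))) = {})" for z
      by (rule pred_avoid) measurable
  qed measurable
  show ?thesis unfolding bad_def by (rule sets_ENV_Collect) measurable
qed

lemma bad_visited_sets: "bad_visited k l \<in> sets ENV"
proof -
  have *: "Measurable.pred ENV (\<lambda>e. fst e \<inter> (through x \<inter> H (z + (int l, int l))) = {})" for x z
    by (rule pred_avoid) measurable
  have **: "Measurable.pred ENV (\<lambda>e. fst e \<inter> (through (Y e 0 i) \<inter> H (z + (int l, int l))) = {})" for i z
    by (rule measurable_compose_countable[where f="\<lambda>x e. fst e \<inter> (through x \<inter> H (z + (int l, int l))) = {}"])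
       (rule *, measurable)
  have [measurable]: "Measurable.pred ENV (\<lambda>e. fst e \<inter> (through (Y e 0 i) \<inter> H (Y e 0 r + (int l, int l))) = {})" for i r
    by (rule measurable_compose_countable[where f="\<lambda>z e. fst e \<inter> (through (Y e 0 i) \<inter> H (z + (int l, int l))) = {}"])
       (rule **, measurable)
  show ?thesis unfolding bad_visited_def by (rule sets_ENV_Collect) measurable
qed

text \<open>A visited path that is bad for the \<open>k\<close>-th record exceeds, from the time it is first met, the
  first record level after that time by at least \<open>l\<close> plus the number of records in between.\<close>

lemma bad_visited_count:
  assumes R: "record_at e n R" "R \<le> N"
  shows "card {k \<in> {..<n}. e \<in> bad_visited k l}
    \<le> card {ij \<in> {..<N} \<times> {..<n}. e \<in> first_exceed (fst ij) ((1 - v) * (real l + real (snd ij)))}"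
    (is "card ?A \<le> card ?B")
proof -
  \<comment> \<open>The first record index reached strictly after time \<open>i\<close>. Since
    \<open>k\<close> is recovered from the pair \<open>(i, k - \<kappa> i)\<close>, different bad
    records are charged to different pairs.\<close>
  define \<kappa> where "\<kappa> i = (LEAST k. \<exists>r. record_at e k r \<and> i < r)" for i
  have "?A \<subseteq> (\<lambda>ij. \<kappa> (fst ij) + snd ij) ` ?B"
  proof
    fix k assume "k \<in> ?A"
    then obtain r i0 w where k: "k < n" "record_at e k r" and i0: "i0 < r" "w \<in> through (Y e 0 i0)"
      and w: "w \<in> fst e" "w \<in> H (Y e 0 r + (int l, int l))"
      by (auto simp: bad_visited_def)
    define i where "i = (LEAST i. w \<in> through (Y e 0 i))"
    have i: "w \<in> through (Y e 0 i)" "i \<le> i0" unfolding i_def using i0(2) by (auto intro: LeastI Least_le)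
    have first: "w \<notin> through (Y e 0 j)" if "j < i" for j
      using not_less_Least[of j "\<lambda>i. w \<in> through (Y e 0 i)"] that unfolding i_def by blast
    have ir: "i < r" using i i0 by simp
    have rR: "r \<le> R" using record_mono[OF R(1) k(2)] k(1) by simp
    have P: "\<exists>r. record_at e k r \<and> i < r" using k ir by blast
    have "\<exists>r. record_at e (\<kappa> i) r \<and> i < r" unfolding \<kappa>_def using P by (rule LeastI)
    then have hi: "ht (Y e 0 i) < (1 - v) * \<kappa> i" by (auto simp: record_at_def)
    have \<kappa>k: "\<kappa> i \<le> k" unfolding \<kappa>_def using P by (rule Least_le)
    from w obtain m where m: "(w m, m) \<in> C (Y e 0 r + (int l, int l))" by (auto simp: hit_cone_def)
    have "(1 - v) * (real l + real (k - \<kappa> i)) + (1 - v) * \<kappa> i = (1 - v) * k + (1 - v) * l"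
      using \<kappa>k by (simp add: of_nat_diff algebra_simps)
    also have "\<dots> \<le> ht (w m, m)"
      using m k(2) height_diag[of "Y e 0 r" "int l"] by (simp add: cone_iff record_at_def)
    finally have "ht (Y e 0 i) + (1 - v) * (real l + real (k - \<kappa> i)) \<le> ht (w m, m)" using hi by simp
    moreover have "snd (Y e 0 i) \<le> m" using m ir by (simp add: cone_iff)
    ultimately have "w \<in> exceed (Y e 0 i) ((1 - v) * (real l + real (k - \<kappa> i)))"
      using i by (auto simp: exceed_def)
    then have "e \<in> first_exceed i ((1 - v) * (real l + real (k - \<kappa> i)))"
      using w first by (auto simp: first_exceed_def visited_traj)
    then have "(i, k - \<kappa> i) \<in> ?B" using ir rR R k by auto
    then show "k \<in> (\<lambda>ij. \<kappa> (fst ij) + snd ij) ` ?B"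
      using \<kappa>k by (intro image_eqI[of _ _ "(i, k - \<kappa> i)"]) auto
  qed
  then show ?thesis by (intro surj_card_le[of ?B]) auto
qed

end

section \<open>Probability bounds along a stopped trajectory\<close>

context walk_law
begin

lemma diag_up_prob: "prob (diag_up y l) = F (min pc pb) ^ l"
proof -
  let ?J = "(\<lambda>j. y + (int j, int j)) ` {..<l}"
  have inj: "inj_on (\<lambda>j. y + (int j, int j)) {..<l}" by (auto simp: inj_on_def)
  have "diag_up y l = {e. \<forall>z\<in>?J. snd e z \<le> min pc pb}" by (auto simp: diag_up_def)
  also have "prob \<dots> = (\<Prod>z\<in>?J. F (min pc pb))" by (rule prob_marks) auto
  also have "\<dots> = F (min pc pb) ^ l" by (simp add: card_image[OF inj])
  finally show ?thesis .
qed

lemma prob_diag_up_Int: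
  assumes B: "B \<in> sets Wsp" and E: "determined_by B {z. snd y + int l \<le> snd z} E"
  shows "prob (diag_up y l \<inter> E) = F (min pc pb) ^ l * prob E"
proof -
  have "prob (diag_up y l \<inter> E) = prob (diag_up y l) * prob E"
    by (rule prob_determined_Int[OF _ B _ _ determined_diag_up E]) auto
  then show ?thesis by (simp add: diag_up_prob)
qed

lemma traj_disjoint:
  assumes "\<And>e r r'. traj e r \<in> S \<Longrightarrow> traj e r' \<in> S \<Longrightarrow> r = r'"
    and "\<And>zs. zs \<in> S \<Longrightarrow> A zs \<subseteq> {e. traj e (length zs - 1) = zs}"
  shows "disjoint_family_on A S"
  unfolding disjoint_family_on_def
proof (intro ballI impI equals0I)
  fix zs zs' e assume *: "zs \<in> S" "zs' \<in> S" "zs \<noteq> zs'" "e \<in> A zs \<inter> A zs'"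
  then have "traj e (length zs - 1) = zs" "traj e (length zs' - 1) = zs'" using assms(2) by blast+
  then show False using assms(1)[of e "length zs - 1" "length zs' - 1"] * by metis
qed

text \<open>Along a stopped trajectory the paths that have not been visited form a fresh Poisson process.\<close>

lemma explore:
  assumes S: "\<And>e r r'. traj e r \<in> S \<Longrightarrow> traj e r' \<in> S \<Longrightarrow> r = r'"
    and B: "\<And>zs. zs \<in> S \<Longrightarrow> B zs \<in> sets Wsp" "\<And>zs. zs \<in> S \<Longrightarrow> emeasure \<mu> (B zs) \<le> b"
  shows "emeasure P {e. \<exists>r. traj e r \<in> S \<and> fst e \<inter> (B (traj e r) - visited (traj e r)) \<noteq> {}} \<le> b"
proof -
  define T where "T zs = {e. traj e (length zs - 1) = zs}" for zs
  define K where "K zs = {e :: env. fst e \<inter> (B zs - visited zs) \<noteq> {}}" for zs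
  have sK: "K zs \<in> sets ENV" if "zs \<in> S" for zs
  proof -
    have [measurable]: "Measurable.pred ENV (\<lambda>e. fst e \<inter> (B zs - visited zs) = {})"
      by (rule pred_avoid) (use B(1)[OF that] in auto)
    show ?thesis unfolding K_def by (rule sets_ENV_Collect) measurable
  qed
  have sT: "T zs \<in> sets ENV" for zs unfolding T_def by (rule sets_ENV_Collect) measurable
  have TK: "emeasure P (T zs \<inter> K zs) \<le> emeasure P (T zs) * b" if zs: "zs \<in> S" for zs
  proof -
    have dK: "determined_by (- visited zs) {} (K zs)"
      using sK[OF zs] unfolding determined_by_def agree_def K_def by blast
    \<comment> \<open>A given trajectory reads only marks and visited paths, while
      \<open>K zs\<close> concerns unvisited paths only.\<close>
    have "prob (T zs \<inter> K zs) = prob (T zs) * prob (K zs)"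
      unfolding T_def by (rule prob_determined_Int[OF visited_sets compl_sets_Wsp[OF visited_sets] _ _ determined_traj dK]) auto
    then have "emeasure P (T zs \<inter> K zs) = emeasure P (T zs) * emeasure P (K zs)"
      by (simp add: emeasure_eq_measure ennreal_mult)
    also have "emeasure P (K zs) \<le> emeasure \<mu> (B zs - visited zs)"
      unfolding K_def by (rule emeasure_hit_le) (use B(1)[OF zs] in auto)
    also have "\<dots> \<le> emeasure \<mu> (B zs)"
      by (rule emeasure_mono) (use B(1)[OF zs] sets_mu in auto)
    also have "\<dots> \<le> b" by (rule B(2)[OF zs])
    finally show ?thesis by (simp add: mult_left_mono)
  qed
  have "{e. \<exists>r. traj e r \<in> S \<and> fst e \<inter> (B (traj e r) - visited (traj e r)) \<noteq> {}} = (\<Union>zs\<in>S. T zs \<inter> K zs)"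
    (is "?L = ?R")
  proof (intro equalityI subsetI)
    fix e assume "e \<in> ?L"
    then obtain r where "traj e r \<in> S" "fst e \<inter> (B (traj e r) - visited (traj e r)) \<noteq> {}" by blast
    then show "e \<in> ?R" by (intro UN_I[of "traj e r"]) (auto simp: T_def K_def)
  next
    fix e assume "e \<in> ?R"
    then obtain zs where "zs \<in> S" "traj e (length zs - 1) = zs" "fst e \<inter> (B zs - visited zs) \<noteq> {}"
      by (auto simp: T_def K_def)
    then show "e \<in> ?L" by (intro CollectI exI[of _ "length zs - 1"]) simp
  qed
  also have "emeasure P \<dots> = (\<integral>\<^sup>+ zs. emeasure P (T zs \<inter> K zs) \<partial>count_space S)"
  proof (rule emeasure_UN_countable)
    show "T zs \<inter> K zs \<in> events" if "zs \<in> S" for zs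
      unfolding sets_P by (rule sets.Int[OF sT sK[OF that]])
    show "disjoint_family_on (\<lambda>zs. T zs \<inter> K zs) S"
      by (rule traj_disjoint[OF S]) (auto simp: T_def)
  qed simp
  also have "\<dots> \<le> (\<integral>\<^sup>+ zs. emeasure P (T zs) * b \<partial>count_space S)"
    by (rule nn_integral_mono) (use TK in auto)
  also have "\<dots> = (\<integral>\<^sup>+ zs. emeasure P (T zs) \<partial>count_space S) * b"
    by (rule nn_integral_multc) auto
  also have "(\<integral>\<^sup>+ zs. emeasure P (T zs) \<partial>count_space S) = emeasure P (\<Union>zs\<in>S. T zs)"
  proof (rule emeasure_UN_countable[symmetric])
    show "T zs \<in> events" for zs unfolding sets_P by (rule sT)
    show "disjoint_family_on T S" by (rule traj_disjoint[OF S]) (auto simp: T_def)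
  qed simp
  also have "\<dots> \<le> 1" by (rule emeasure_le_1)
  finally show ?thesis by (simp add: mult_right_mono order.trans)
qed

end

section \<open>Good sites have positive probability; tightness of bad records\<close>

lemma exp_decay: "(\<lambda>l::nat. a * exp (- b * real l)) \<longlonglongrightarrow> 0" if "0 < b"
proof -
  have "(\<lambda>l. exp (- b) ^ l) \<longlonglongrightarrow> 0" by (rule LIMSEQ_power_zero) (use that in simp)
  then have "(\<lambda>l. a * exp (- b) ^ l) \<longlonglongrightarrow> a * 0" by (rule tendsto_mult_left)
  moreover have "exp (- b) ^ l = exp (- b * real l)" for l
    by (simp add: exp_of_nat_mult[symmetric] mult.commute)
  ultimately show ?thesis by simp
qed

text \<open>The speed \<open>3 * v\<close> is the given \<open>vstar\<close>. In terms of height it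
  leaves a linear gain of rate \<open>2 * v\<close>, see \<open>ahead_height\<close>. A single pair
  \<open>c\<close>, \<open>\<theta>\<close> serves both path bounds.\<close>

locale ballistic_law = walk_law +
  fixes c \<theta> :: real
  assumes v_half: "v \<le> 1 / 2"
    and c: "0 \<le> c" and \<theta>: "0 < \<theta>"
    and exceed_bound: "\<And>s. 0 \<le> s \<Longrightarrow> emeasure \<mu> (exceed 0 s) \<le> ennreal (c * exp (- \<theta> * s))"
    and cross_bound: "\<And>l. emeasure \<mu> (HR 0 \<inter> H (int l, int l)) \<le> ennreal (c * exp (- \<theta> * real l))"
    and F_pos: "0 < F (min pc pb)"
    and ballistic: "(\<lambda>L. prob {e. \<exists>n. real_of_int (fst (Y e 0 n)) < real n * (3 * v) - real L}) \<longlonglongrightarrow> 0"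
begin

definition ahead :: "site \<Rightarrow> nat \<Rightarrow> env set" where
  "ahead z L = {e. \<forall>n. real n * (3 * v) - real L \<le> real_of_int (fst (Y e z n)) - real_of_int (fst z)}"

lemma ahead_sets: "ahead z L \<in> sets ENV"
  unfolding ahead_def by (rule sets_ENV_Collect) measurable

lemma ahead_0: "prob (ahead 0 L) = 1 - prob {e. \<exists>n. real_of_int (fst (Y e 0 n)) < real n * (3 * v) - real L}"
proof -
  have "- ahead 0 L = {e. \<exists>n. real_of_int (fst (Y e 0 n)) < real n * (3 * v) - real L}"
  proof (intro equalityI subsetI)
    fix e assume "e \<in> - ahead 0 L"
    then show "e \<in> {e. \<exists>n. real_of_int (fst (Y e 0 n)) < real n * (3 * v) - real L}"
      by (simp add: ahead_def not_le)
  next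
    fix e assume "e \<in> {e. \<exists>n. real_of_int (fst (Y e 0 n)) < real n * (3 * v) - real L}"
    then obtain n where "real_of_int (fst (Y e 0 n)) < real n * (3 * v) - real L" by blast
    then show "e \<in> - ahead 0 L" by (simp add: ahead_def not_le exI[of _ n])
  qed
  then show ?thesis
    using prob_compl[of "ahead 0 L"] ahead_sets[of 0 L] by (simp add: sets_P Compl_eq_Diff_UNIV)
qed

lemma ahead_tendsto: "(\<lambda>L. prob (ahead 0 L)) \<longlonglongrightarrow> 1"
  unfolding ahead_0 using tendsto_diff[OF tendsto_const ballistic, of 1] by simp

lemma ahead_shift: "prob (ahead z L) = prob (ahead 0 L)"
proof -
  have "env_shift z -` ahead 0 L = ahead z L" by (auto simp: ahead_def Y_shift)
  then show ?thesis using prob_shift[OF ahead_sets, of z 0 L] by simp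
qed

lemma ahead_height: "e \<in> ahead z L \<Longrightarrow> ht z + 2 * v * n - L \<le> ht (Y e z n)"
  by (auto simp: ahead_def height_def algebra_simps dest!: spec[of _ n])

lemma cross_shift: "emeasure \<mu> (HR y \<inter> H (y + (int l, int l))) \<le> ennreal (c * exp (- \<theta> * real l))"
proof -
  have "HR y \<inter> H (y + (int l, int l)) = path_shift y -` (HR 0 \<inter> H (int l, int l))"
    by (auto simp: path_shift_H path_shift_HR add.commute)
  moreover have "HR 0 \<inter> H (int l, int l) \<in> sets Wsp" by measurable
  ultimately show ?thesis using mu_shift[of "HR 0 \<inter> H (int l, int l)" y] cross_bound[of l] by simp
qed

lemma exceed_bound': "0 \<le> s \<Longrightarrow> emeasure \<mu> (exceed z s) \<le> ennreal (c * exp (- \<theta> * s))"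
  unfolding exceed_shift[of z] using mu_shift[OF exceed_sets, of z 0 s] exceed_bound by simp

text \<open>The walk is forced along the diagonal to \<open>z2\<close>; from there, ballisticity
  keeps it in the cone of \<open>z1\<close>. To separate this from the absence of crossing paths,
  the later walk is run without the paths that meet \<open>HR 0\<close>. With probability at least
  \<open>3/4 - 1/4\<close> the walk is ahead and no such path reaches the cone of \<open>z1\<close>,
  so that the removal changes nothing.\<close>

lemma p_good_pos: "0 < p_good"
proof -
  have "\<forall>\<^sub>F L in sequentially. prob (ahead 0 L) > 3/4"
    using ahead_tendsto by (rule order_tendstoD) simp
  then obtain L where L: "prob (ahead 0 L) > 3/4" by (auto simp: eventually_sequentially)
  have "\<forall>\<^sub>F l in sequentially. c * exp (- \<theta> * real l) < 1/4"
    using exp_decay[OF \<theta>] by (rule order_tendstoD) simp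
  then obtain l1 where l1: "c * exp (- \<theta> * real l1) < 1/4" by (auto simp: eventually_sequentially)
  \<comment> \<open>Since \<open>1 - v \<ge> 1/2\<close>, the additional \<open>2 * L\<close>
    diagonal steps gain height at least \<open>L\<close>, which is all that a walk in
    \<open>ahead z2 L\<close> can lose.\<close>
  define l2 where "l2 = l1 + 2 * L"
  define z1 :: site where "z1 = (int l1, int l1)"
  define z2 :: site where "z2 = (int l2, int l2)"
  have "real L \<le> (1 - v) * (2 * real L)" using v_half mult_left_mono[of "1/2" "1 - v" "2 * real L"]
    by (simp add: mult.commute)
  then have ht12: "ht z1 + L \<le> ht z2" by (simp add: z1_def z2_def l2_def height_pair algebra_simps)
  have z1C: "z1 \<in> C 0" using diag_in_cone[of "int l1" 0] by (simp add: z1_def)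
  have HR_c: "- HR 0 \<in> sets Wsp" by (rule compl_sets_Wsp) measurable
  have cr: "HR 0 \<inter> H z \<in> sets Wsp" for z by measurable

  define E1 where "E1 = {e::env. fst e \<inter> (HR 0 \<inter> H 0) = {}}"
  define S where "S = {e. \<forall>i. Y e z2 i \<in> C z1}"
  \<comment> \<open>Reads no path of \<open>HR 0\<close>, hence is independent of \<open>E1\<close>,
    and no mark before \<open>z2\<close>, hence is independent of the forced steps.\<close>
  define E3 where "E3 = restr (- HR 0) UNIV -` S"
  have S_sets: "S \<in> sets ENV" unfolding S_def by (rule sets_ENV_Collect) measurable
  have det3: "determined_by (- HR 0) {x. snd z2 \<le> snd x} E3"
    unfolding E3_def by (rule determined_future[OF HR_c S_sets]) (simp add: S_def)
  have "ahead z2 L \<inter> {e. fst e \<inter> (HR 0 \<inter> H z1) = {}} \<subseteq> E3"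
  proof
    fix e assume e: "e \<in> ahead z2 L \<inter> {e. fst e \<inter> (HR 0 \<inter> H z1) = {}}"
    have st: "Y e z2 i \<in> C z1" for i
    proof -
      have "0 \<le> 2 * v * real i" using v by simp
      then have "ht z1 \<le> ht (Y e z2 i)" using ahead_height[of e z2 L i] e ht12 by simp
      then show ?thesis by (simp add: cone_iff z1_def z2_def l2_def)
    qed
    have ag: "agree (H z1) (C z1) e (restr (- HR 0) UNIV e)"
      by (rule agree_outside_past) (use e in simp)
    show "e \<in> E3" unfolding E3_def S_def using fut_transfer[OF ag st] st by simp
  qed
  moreover have "prob (ahead z2 L \<inter> {e. fst e \<inter> (HR 0 \<inter> H z1) = {}}) \<ge> 1/2"
  proof -
    have "{e :: env. fst e \<inter> (HR 0 \<inter> H z1) \<noteq> {}} = UNIV - {e. fst e \<inter> (HR 0 \<inter> H z1) = {}}" by auto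
    then have evs: "ahead z2 L \<inter> {e. fst e \<inter> (HR 0 \<inter> H z1) = {}} \<in> events"
        "{e. fst e \<inter> (HR 0 \<inter> H z1) \<noteq> {}} \<in> events"
      using ahead_sets[of z2 L] avoid_sets[OF cr, of z1] sets.compl_sets[OF avoid_sets[OF cr, of z1]]
      by (auto simp only: sets_P sets.Int space_ENV)
    have "emeasure P {e. fst e \<inter> (HR 0 \<inter> H z1) \<noteq> {}} \<le> ennreal (1/4)"
    proof (rule order.trans[OF emeasure_hit_le[OF cr]])
      have "emeasure \<mu> (HR 0 \<inter> H z1) \<le> ennreal (c * exp (- \<theta> * real l1))"
        unfolding z1_def by (rule cross_bound)
      also have "\<dots> \<le> ennreal (1 / 4)" by (rule ennreal_leI) (use l1 in simp)
      finally show "emeasure \<mu> (HR 0 \<inter> H z1) \<le> ennreal (1 / 4)" .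
    qed
    then have "prob {e. fst e \<inter> (HR 0 \<inter> H z1) \<noteq> {}} \<le> 1/4"
      by (simp add: emeasure_eq_measure)
    moreover have "prob (ahead z2 L) \<le> prob (ahead z2 L \<inter> {e. fst e \<inter> (HR 0 \<inter> H z1) = {}} \<union> {e. fst e \<inter> (HR 0 \<inter> H z1) \<noteq> {}})"
      by (rule finite_measure_mono) (use evs in auto)
    moreover have "\<dots> \<le> prob (ahead z2 L \<inter> {e. fst e \<inter> (HR 0 \<inter> H z1) = {}}) + prob {e. fst e \<inter> (HR 0 \<inter> H z1) \<noteq> {}}"
      by (rule measure_Un_le) (use evs in auto)
    ultimately show ?thesis using L ahead_shift[of z2 L] by simp
  qed
  moreover have "E3 \<in> events" using determined_sets[OF det3] by (simp add: sets_P)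
  ultimately have p3: "prob E3 \<ge> 1/2" by (meson finite_measure_mono order.trans)
  have p23: "prob (diag_up 0 l2 \<inter> E3) = F (min pc pb) ^ l2 * prob E3"
    by (rule prob_diag_up_Int[OF HR_c determined_mono[OF det3]]) (auto simp: z2_def)
  have "determined_by (- HR 0) UNIV (diag_up 0 l2)" by (rule determined_mono[OF determined_diag_up]) auto
  moreover have "determined_by (- HR 0) UNIV E3" by (rule determined_mono[OF det3]) auto
  ultimately have d23: "determined_by (- HR 0) UNIV (diag_up 0 l2 \<inter> E3)" by (rule determined_Int)
  have d1: "determined_by (HR 0) {} E1"
    unfolding determined_by_def E1_def using avoid_sets[OF cr, of 0] by (auto simp: agree_def)
  have "prob (E1 \<inter> (diag_up 0 l2 \<inter> E3)) = prob E1 * prob (diag_up 0 l2 \<inter> E3)"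
    by (rule prob_determined_Int[OF _ HR_c _ _ d1 d23]) auto
  moreover have "0 < prob E1"
  proof -
    have "emeasure \<mu> (HR 0 \<inter> H 0) \<noteq> \<infinity>" using cross_bound[of 0] by (auto simp: zero_prod_def top_unique)
    then show ?thesis using prob_avoid[OF cr, of 0] by (simp add: E1_def void_prob_def)
  qed
  moreover have "0 < prob (diag_up 0 l2 \<inter> E3)" unfolding p23 using F_pos p3 by simp
  moreover have "E1 \<inter> (diag_up 0 l2 \<inter> E3) \<subseteq> {e. good_at e 0}"
  proof
    fix e assume e: "e \<in> E1 \<inter> (diag_up 0 l2 \<inter> E3)"
    have diag: "Y e 0 i = (int i, int i)" if "i \<le> l2" for i
      using Y_diag[of l2 e 0 i] e that by (simp add: diag_up_def)
    have none: "fst e \<inter> (HR 0 \<inter> H z1) = {}" using e H_subset[OF z1C] by (auto simp: E1_def)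
    have ag: "agree (H z1) (C z1) (restr (- HR 0) UNIV e) e"
      by (rule agree_sym[OF agree_outside_past[OF none]])
    have st: "Y (restr (- HR 0) UNIV e) z2 i \<in> C z1" for i using e by (simp add: E3_def S_def)
    have "Y e z2 i \<in> C 0" for i using fut_transfer[OF ag st] st[of i] cone_subset[OF z1C] by auto
    have "Y e 0 i \<in> C 0" for i
    proof (cases "i \<le> l2")
      case True
      then show ?thesis using diag diag_in_cone[of "int i" 0] by simp
    next
      case False
      then have "Y e 0 i = Y e z2 (i - l2)"
        using Y_add[of e 0 l2 "i - l2"] diag[of l2] by (simp add: z2_def)
      then show ?thesis using \<open>\<And>i. Y e z2 i \<in> C 0\<close> by simp
    qed
    then show "e \<in> {e. good_at e 0}" using e by (auto simp: good_at_def E1_def Wcross_eq)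
  qed
  moreover have "{e. good_at e 0} \<in> events" by (rule sets_P_Collect) measurable
  ultimately have "prob (E1 \<inter> (diag_up 0 l2 \<inter> E3)) \<le> p_good" "0 < prob (E1 \<inter> (diag_up 0 l2 \<inter> E3))"
    unfolding p_good_def by (intro finite_measure_mono, simp_all only: mult_pos_pos)
  then show ?thesis by simp
qed

text \<open>At time \<open>m * n\<close> the height is at least \<open>2 * n - L \<ge> n\<close>,
  which is beyond the level \<open>(1 - v) * n\<close>.\<close>

lemma record_within:
  assumes e: "e \<in> ahead 0 L" and m: "1 \<le> real m * v" and n: "L \<le> n"
  obtains r where "record_at e n r" "r \<le> m * n"
proof -
  have "real n \<le> real n * (real m * v)" using m mult_left_mono[of 1 "real m * v" "real n"] by simp
  then have "real n \<le> 2 * v * real (m * n) - real L" using n by (simp add: algebra_simps)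
  moreover have "(1 - v) * real n \<le> real n" using v by (simp add: mult_left_le_one_le)
  ultimately have "(1 - v) * n \<le> ht (Y e 0 (m * n))"
    using ahead_height[OF e, of "m * n"] by simp
  then show ?thesis by (rule record_exists) (rule that)
qed

lemma all_records: "prob {e. \<forall>k. \<exists>r. record_at e k r} = 1"
proof -
  obtain m :: nat where "1 / v \<le> real m" using real_arch_simple by blast
  then have m: "1 \<le> real m * v" using v by (simp add: field_simps)
  have sub: "ahead 0 L \<subseteq> {e. \<forall>k. \<exists>r. record_at e k r}" for L
  proof (intro subsetI CollectI allI)
    fix e k assume e: "e \<in> ahead 0 L"
    obtain r where "record_at e (max L k) r" by (rule record_within[OF e m max.cobounded1])
    then obtain r' where "record_at e k r'" by (rule record_smaller[of e "max L k" r k]) auto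
    then show "\<exists>r. record_at e k r" by blast
  qed
  have "{e. \<forall>k. \<exists>r. record_at e k r} \<in> events" by (rule sets_P_Collect) measurable
  then have "prob (ahead 0 L) \<le> prob {e. \<forall>k. \<exists>r. record_at e k r}" for L
    using sub by (intro finite_measure_mono) auto
  then have "1 \<le> prob {e. \<forall>k. \<exists>r. record_at e k r}"
    using ahead_tendsto by (intro LIMSEQ_le_const2) auto
  then show ?thesis using prob_le_1 by (simp add: antisym)
qed

section \<open>Bad records are rare on average\<close>

lemma bad_unvisited_prob: "prob (bad_unvisited k l) \<le> c * exp (- \<theta> * real l)"
proof -
  let ?S = "{zs. rec_list k zs}"
  have "emeasure P {e. \<exists>r. traj e r \<in> ?S \<and>
      fst e \<inter> (HR (last (traj e r)) \<inter> H (last (traj e r) + (int l, int l)) - visited (traj e r)) \<noteq> {}}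
     \<le> ennreal (c * exp (- \<theta> * real l))"
    by (rule explore[where S="?S" and B="\<lambda>zs. HR (last zs) \<inter> H (last zs + (int l, int l))"])
       (auto simp: rec_list_traj intro: record_unique cross_shift[simplified])
  then show ?thesis
    using c by (simp add: rec_list_traj bad_unvisited_def emeasure_eq_measure)
qed

lemma first_exceed_prob:
  assumes "0 \<le> s" shows "prob (first_exceed i s) \<le> c * exp (- \<theta> * s)"
proof -
  let ?S = "{zs. length zs = Suc i}"
  have "emeasure P {e. \<exists>r. traj e r \<in> ?S \<and>
      fst e \<inter> (exceed (last (traj e r)) s - visited (traj e r)) \<noteq> {}} \<le> ennreal (c * exp (- \<theta> * s))"
    by (rule explore[where S="?S" and B="\<lambda>zs. exceed (last zs) s"])
       (auto intro: exceed_bound'[OF assms, simplified])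
  then show ?thesis
    using c by (simp add: first_exceed_def emeasure_eq_measure)
qed

lemma first_exceed_sets: "first_exceed i s \<in> sets ENV"
proof -
  have *: "first_exceed i s = {e. \<exists>zs. traj e i = zs \<and> \<not> fst e \<inter> (exceed (last zs) s - visited zs) = {}}"
    by (auto simp: first_exceed_def)
  have [measurable]: "Measurable.pred ENV (\<lambda>e. fst e \<inter> (exceed (last zs) s - visited zs) = {})" for zs
    by (rule pred_avoid) measurable
  show ?thesis unfolding * by (rule sets_ENV_Collect) measurable
qed

text \<open>At most \<open>m * n\<close> times of first meeting precede the \<open>n\<close>-th
  record. For each of them the exponential bounds sum over the later records to a geometric series,
  so the total is linear in \<open>n\<close> with a factor that is small in
  \<open>l\<close>.\<close>

lemma bad_visited_sum:
  assumes m: "1 \<le> real m * v" and n: "L \<le> n"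
  shows "(\<Sum>k<n. prob (bad_visited k l \<inter> ahead 0 L))
    \<le> real (m * n) * (c * exp (- \<theta> * (1 - v) * real l) / (1 - exp (- \<theta> * (1 - v))))"
proof -
  let ?J = "{..<m * n} \<times> {..<n}"
  let ?B = "\<lambda>ij. first_exceed (fst ij) ((1 - v) * (real l + real (snd ij)))"
  let ?a = "exp (- \<theta> * (1 - v))"
  have a: "0 \<le> ?a" "?a < 1" using \<theta> v by auto
  have "(\<Sum>k<n. prob (bad_visited k l \<inter> ahead 0 L)) \<le> (\<Sum>ij\<in>?J. prob (?B ij))"
  proof (rule sum_prob_le_by_count)
    fix e
    show "card {k \<in> {..<n}. e \<in> bad_visited k l \<inter> ahead 0 L} \<le> card {ij \<in> ?J. e \<in> ?B ij}"
    proof (cases "e \<in> ahead 0 L")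
      case True
      obtain R where R: "record_at e n R" "R \<le> m * n" by (rule record_within[OF True m n])
      show ?thesis using bad_visited_count[OF R, of l] True by simp
    qed simp
  qed (auto simp: sets_P first_exceed_sets intro: sets.Int bad_visited_sets ahead_sets)
  also have "\<dots> \<le> (\<Sum>ij\<in>?J. c * exp (- \<theta> * (1 - v) * real l) * ?a ^ snd ij)"
  proof (rule sum_mono)
    fix ij :: "nat \<times> nat"
    have "prob (?B ij) \<le> c * exp (- \<theta> * ((1 - v) * (real l + real (snd ij))))"
      by (rule first_exceed_prob) (use v in simp)
    also have "exp (- \<theta> * ((1 - v) * (real l + real (snd ij)))) = exp (- \<theta> * (1 - v) * real l) * ?a ^ snd ij"
      by (simp add: exp_of_nat_mult[symmetric] exp_add[symmetric] algebra_simps)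
    finally show "prob (?B ij) \<le> c * exp (- \<theta> * (1 - v) * real l) * ?a ^ snd ij" by (simp add: mult.assoc)
  qed
  also have "\<dots> = (\<Sum>(i, j)\<in>?J. c * exp (- \<theta> * (1 - v) * real l) * ?a ^ j)"
    by (simp add: case_prod_unfold)
  also have "\<dots> = (\<Sum>i<m * n. c * exp (- \<theta> * (1 - v) * real l) * (\<Sum>j<n. ?a ^ j))"
    unfolding sum.cartesian_product[symmetric] sum_distrib_left ..
  also have "\<dots> = real (m * n) * (c * exp (- \<theta> * (1 - v) * real l) * (\<Sum>j<n. ?a ^ j))" by simp
  also have "(\<Sum>j<n. ?a ^ j) \<le> 1 / (1 - ?a)"
    using a sum_le_suminf[of "\<lambda>j. ?a ^ j" "{..<n}"] by (simp add: suminf_geometric summable_geometric)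
  finally show ?thesis using c by (simp add: mult_left_mono)
qed

text \<open>If all records from \<open>K\<close> on were bad with probability above
  \<open>\<eta>\<close>, the average over \<open>k < n\<close> could not stay below
  \<open>\<eta> / 2\<close>. The choice of \<open>l\<close> depends on \<open>\<eta>\<close> only,
  which is what \<open>never_regen_null\<close> relies on.\<close>

lemma bad_tight:
  assumes "0 < \<eta>"
  shows "\<exists>l. \<forall>K. \<exists>k\<ge>K. prob (bad k l) \<le> \<eta>"
proof -
  obtain m :: nat where "1 / v \<le> real m" using real_arch_simple by blast
  then have m: "1 \<le> real m * v" using v by (simp add: field_simps)
  let ?D = "1 - exp (- \<theta> * (1 - v))"
  define f where "f l = c * exp (- \<theta> * real l) + real m * (c / ?D * exp (- (\<theta> * (1 - v)) * real l))" for l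
  have "f \<longlonglongrightarrow> 0 + real m * 0"
    unfolding f_def using \<theta> v by (intro tendsto_intros exp_decay) simp_all
  then have "\<forall>\<^sub>F l in sequentially. f l < \<eta> / 4" by (rule order_tendstoD) (use assms in simp)
  then obtain l where l: "f l < \<eta> / 4" by (auto simp: eventually_sequentially)
  have "\<forall>\<^sub>F L in sequentially. prob (ahead 0 L) > 1 - \<eta> / 4"
    using ahead_tendsto by (rule order_tendstoD) (use assms in simp)
  then obtain L where L: "prob (ahead 0 L) > 1 - \<eta> / 4" by (auto simp: eventually_sequentially)
  have "\<exists>k\<ge>K. prob (bad k l) \<le> \<eta>" for K
  proof (rule ccontr)
    assume "\<not> ?thesis"
    then have gt: "prob (bad k l) > \<eta>" if "k \<ge> K" for k using that by (meson not_le)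
    \<comment> \<open>More than half of the indices below \<open>n\<close> are then at least
      \<open>K\<close>, and \<open>L \<le> n\<close> as needed for
      \<open>bad_visited_sum\<close>.\<close>
    define n where "n = Suc (2 * K + L)"
    have compl: "prob (- ahead 0 L) < \<eta> / 4"
      using prob_compl[of "ahead 0 L"] L ahead_sets[of 0 L] by (simp add: sets_P Compl_eq_Diff_UNIV)
    have each: "prob (bad k l) \<le> c * exp (- \<theta> * real l) + prob (bad_visited k l \<inter> ahead 0 L) + \<eta> / 4" for k
    proof -
      have ev: "bad_unvisited k l \<in> events"
      proof -
        have *: "bad_unvisited k l = {e. \<exists>r. record_at e k r \<and> (\<exists>zs. traj e r = zs \<and>
             \<not> fst e \<inter> ((HR (last zs) \<inter> H (last zs + (int l, int l))) - visited zs) = {})}"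
          by (auto simp: bad_unvisited_def)
        have [measurable]: "Measurable.pred ENV (\<lambda>e. fst e \<inter> ((HR (last zs) \<inter> H (last zs + (int l, int l))) - visited zs) = {})" for zs
          by (rule pred_avoid) measurable
        show ?thesis unfolding * by (rule sets_P_Collect) measurable
      qed
      have ev2: "bad_visited k l \<inter> ahead 0 L \<in> events" "- ahead 0 L \<in> events"
        using bad_visited_sets ahead_sets[of 0 L] sets.compl_sets[OF ahead_sets[of 0 L]]
        by (auto simp: sets_P Compl_eq_Diff_UNIV)
      have "prob (bad k l) \<le> prob (bad_unvisited k l \<union> (bad_visited k l \<inter> ahead 0 L) \<union> - ahead 0 L)"
        by (rule finite_measure_mono) (use bad_subset ev ev2 in auto)
      also have "\<dots> \<le> prob (bad_unvisited k l \<union> (bad_visited k l \<inter> ahead 0 L)) + prob (- ahead 0 L)"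
        using ev ev2 by (intro measure_Un_le) auto
      also have "prob (bad_unvisited k l \<union> (bad_visited k l \<inter> ahead 0 L))
          \<le> prob (bad_unvisited k l) + prob (bad_visited k l \<inter> ahead 0 L)"
        using ev ev2 by (intro measure_Un_le) auto
      finally show ?thesis using compl bad_unvisited_prob[of k l] by simp
    qed
    have "(\<Sum>k<n. prob (bad k l)) \<le> (\<Sum>k<n. c * exp (- \<theta> * real l) + prob (bad_visited k l \<inter> ahead 0 L) + \<eta> / 4)"
      by (rule sum_mono) (rule each)
    also have "\<dots> = real n * (c * exp (- \<theta> * real l)) + (\<Sum>k<n. prob (bad_visited k l \<inter> ahead 0 L)) + real n * (\<eta> / 4)"
      by (simp add: sum.distrib)
    also have "\<dots> \<le> real n * f l + real n * (\<eta> / 4)"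
      using bad_visited_sum[OF m, of L n l] by (simp add: n_def f_def algebra_simps)
    also have "\<dots> < real n * (\<eta> / 2)"
      using l mult_strict_left_mono[of "f l" "\<eta> / 4" "real n"] by (simp add: n_def field_simps)
    finally have up: "(\<Sum>k<n. prob (bad k l)) < real n * (\<eta> / 2)" .
    have "(\<Sum>k\<in>{K..<n}. \<eta>) \<le> (\<Sum>k\<in>{K..<n}. prob (bad k l))"
      by (rule sum_mono) (use gt in \<open>auto intro: less_imp_le\<close>)
    also have "\<dots> \<le> (\<Sum>k<n. prob (bad k l))" by (rule sum_mono2) auto
    finally have "real (n - K) * \<eta> < real n * (\<eta> / 2)" using up by simp
    then have "real (n - K) < real n / 2" using assms by (simp add: field_simps)
    then show False by (simp add: n_def)
  qed
  then show ?thesis by blast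
qed

end

section \<open>Almost sure regeneration\<close>

lemma (in prob_space) prob_Int_almost_sure:
  assumes E: "E \<in> events" and R: "R \<in> events" "prob R = 1"
  shows "prob (E \<inter> R) = prob E"
proof (rule antisym)
  have "prob (space M - R) = 0" using prob_compl[OF R(1)] R(2) by simp
  moreover have "prob E \<le> prob ((E \<inter> R) \<union> (space M - R))"
    using E R sets.sets_into_space[OF E] by (intro finite_measure_mono) auto
  moreover have "\<dots> \<le> prob (E \<inter> R) + prob (space M - R)"
    using E R by (intro measure_Un_le) auto
  ultimately show "prob E \<le> prob (E \<inter> R)" by simp
  show "prob (E \<inter> R) \<le> prob E" using E by (intro finite_measure_mono) auto
qed

context walk
begin

definition no_regen :: "nat \<Rightarrow> env set" where
  "no_regen K = {e. \<forall>k r. 1 \<le> k \<longrightarrow> k \<le> K \<longrightarrow> record_at e k r \<longrightarrow> \<not> good_at e (Y e 0 r)}"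

definition never_regen :: "env set" where
  "never_regen = {e. \<forall>k r. 1 \<le> k \<longrightarrow> record_at e k r \<longrightarrow> \<not> good_at e (Y e 0 r)}"

text \<open>A failure witnessed by time \<open>r\<close>. Crossing paths are inspected at once: they
  meet the reverse cone of the earlier record, hence that of every later one.\<close>

definition failed_by :: "env \<Rightarrow> nat \<Rightarrow> nat \<Rightarrow> bool" where
  "failed_by e r' r \<longleftrightarrow> fst e \<inter> Wcross v (Y e 0 r') \<noteq> {} \<or> (\<exists>i. r' \<le> i \<and> i \<le> r \<and> Y e 0 i \<notin> C (Y e 0 r'))"

definition no_regen_by :: "nat \<Rightarrow> nat \<Rightarrow> env set" where
  "no_regen_by K k = {e. \<exists>r. record_at e k r \<and>
     (\<forall>k' r'. 1 \<le> k' \<longrightarrow> k' \<le> K \<longrightarrow> record_at e k' r' \<longrightarrow> failed_by e r' r)}"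

lemma pred_Y_in_cone [measurable]: "Measurable.pred ENV (\<lambda>e. Y e 0 i \<in> C (Y e 0 j))"
proof -
  have "Y e 0 i \<in> C (Y e 0 j) \<longleftrightarrow> (\<exists>z x. Y e 0 i = z \<and> Y e 0 j = x \<and> z \<in> C x)" for e by simp
  then show ?thesis by simp
qed

lemma pred_failed_by [measurable]: "Measurable.pred ENV (\<lambda>e. failed_by e r' r)"
proof -
  have [measurable]: "Measurable.pred ENV (\<lambda>e. fst e \<inter> Wcross v (Y e 0 r') = {})"
  proof (rule measurable_compose_countable[where f="\<lambda>z e. fst e \<inter> Wcross v z = {}"])
    show "Measurable.pred ENV (\<lambda>e. fst e \<inter> Wcross v z = {})" for z by (rule pred_avoid) measurable
  qed measurable
  show ?thesis unfolding failed_by_def by measurable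
qed

lemma no_regen_sets: "no_regen K \<in> sets ENV"
  unfolding no_regen_def by (rule sets_ENV_Collect) measurable

lemma never_regen_sets: "never_regen \<in> sets ENV"
  unfolding never_regen_def by (rule sets_ENV_Collect) measurable

lemma no_regen_by_sets: "no_regen_by K k \<in> sets ENV"
  unfolding no_regen_by_def by (rule sets_ENV_Collect) measurable

lemma failed_by_not_good_at: "failed_by e r' r \<Longrightarrow> \<not> good_at e (Y e 0 r')"
proof
  assume f: "failed_by e r' r" and g: "good_at e (Y e 0 r')"
  then obtain i where i: "r' \<le> i" "Y e 0 i \<notin> C (Y e 0 r')" by (auto simp: failed_by_def good_at_def)
  have "Y e 0 i = Y e (Y e 0 r') (i - r')" using Y_add[of e 0 r' "i - r'"] i by simp
  then show False using g i by (simp add: good_at_def)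
qed

lemma not_good_at_failed_by:
  assumes "\<not> good_at e (Y e 0 r')" shows "\<exists>b. \<forall>r\<ge>b. failed_by e r' r"
proof (cases "fst e \<inter> Wcross v (Y e 0 r') = {}")
  case True
  then obtain i where "Y e (Y e 0 r') i \<notin> C (Y e 0 r')" using assms by (auto simp: good_at_def)
  then have "Y e 0 (r' + i) \<notin> C (Y e 0 r')" by (simp add: Y_add)
  then have "failed_by e r' r" if "r' + i \<le> r" for r
    using that unfolding failed_by_def by (metis le_add1)
  then show ?thesis by blast
qed (auto simp: failed_by_def)

lemma failed_by_mono: "failed_by e r' r \<Longrightarrow> r \<le> s \<Longrightarrow> failed_by e r' s"
  unfolding failed_by_def by (meson le_trans)

text \<open>Everything inspected lies in the reverse cone of the current record: the paths through
  earlier sites, the crossing paths of earlier records, and the paths that make the current record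
  bad.\<close>

lemma determined_past:
  assumes KK: "K \<le> k" and rl: "rec_list k zs"
  shows "determined_by (HR (last zs)) {z. snd z < snd (last zs)}
    {e. e \<in> no_regen_by K k - bad k l \<and> traj e (length zs - 1) = zs}"
    (is "determined_by ?B ?S ?E")
  unfolding determined_by_def
proof (intro conjI allI impI)
  have "?E = (no_regen_by K k - bad k l) \<inter> {e. traj e (length zs - 1) = zs}" by auto
  moreover have "{e. traj e (length zs - 1) = zs} \<in> sets ENV" by (rule sets_ENV_Collect) measurable
  ultimately show "?E \<in> sets ENV" using no_regen_by_sets bad_sets by auto
  fix e e' assume ag: "agree ?B ?S e e'" and e: "e \<in> ?E"
  define r where "r = length zs - 1"
  define y where "y = last zs"
  have zs: "zs = traj e r" and y: "y = Y e 0 r" using e by (auto simp: r_def y_def) (metis traj_last)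
  have rec: "record_at e k r" using rl by (simp add: zs rec_list_traj)
  have fst_eq: "fst e \<inter> A = fst e' \<inter> A" if "A \<subseteq> HR y" for A
    using ag that by (auto simp: agree_def y_def)
  have Y: "Y e' 0 i = Y e 0 i" if "i \<le> r" for i
  proof (rule traj_transfer[OF _ _ that])
    fix i assume i: "i < r"
    have "Y e 0 i \<in> CR y" using before_record[OF rec i] y by simp
    then show "fst e \<inter> through (Y e 0 i) = fst e' \<inter> through (Y e 0 i)"
      by (intro fst_eq through_hit_rev)
    have "snd (Y e 0 i) < snd y" using i y by simp
    then show "snd e (Y e 0 i) = snd e' (Y e 0 i)" using ag unfolding agree_def y_def by blast
  qed
  have tr: "traj e' r = zs" using Y zs traj_cong[of r e' e] by simp
  have rec': "record_at e' k r" using rl by (simp add: tr[symmetric] rec_list_traj)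
  have "e' \<notin> bad k l"
  proof
    assume "e' \<in> bad k l"
    then have "fst e' \<inter> (HR y \<inter> H (y + (int l, int l))) \<noteq> {}"
      using record_unique[OF rec'] Y[of r] y by (auto simp: bad_def)
    then have "e \<in> bad k l" using fst_eq[of "HR y \<inter> H (y + (int l, int l))"] rec y
      by (auto simp: bad_def)
    then show False using e by simp
  qed
  moreover have "failed_by e' r' r" if k': "1 \<le> k'" "k' \<le> K" "record_at e' k' r'" for k' r'
  proof -
    have r': "r' \<le> r" using record_mono[OF rec' k'(3)] k' KK by simp
    have rk: "record_at e k' r'" using k'(3) Y r' unfolding record_at_def by simp
    obtain r1 where "record_at e k r1" "failed_by e r' r1" using e k' rk by (auto simp: no_regen_by_def)
    then have f: "failed_by e r' r" using record_unique[OF rec] by blast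
    have "HR (Y e 0 r') \<subseteq> HR y"
      unfolding y by (rule HR_subset, rule record_in_cone[OF rec rk]) (use k' KK in simp)
    then have "fst e \<inter> Wcross v (Y e 0 r') = fst e' \<inter> Wcross v (Y e 0 r')"
      by (intro fst_eq) (auto simp: Wcross_eq)
    then show ?thesis using f Y r' unfolding failed_by_def by auto
  qed
  ultimately show "e' \<in> ?E" using rec' tr by (auto simp: no_regen_by_def r_def)
qed

end

context ballistic_law
begin

text \<open>Off \<open>bad k l\<close>, the paths known from the past do not reach the cone of the
  target \<open>z\<close>, so goodness of \<open>z\<close> may be tested without them and becomes
  independent of the past. A success regenerates at index \<open>k + l\<close> after the first
  \<open>K\<close> attempts failed.\<close>

lemma success_prob:
  assumes "K \<le> k" "1 \<le> K"
  shows "(prob (no_regen_by K k) - prob (bad k l)) * (F (min pc pb) ^ l * p_good)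
    \<le> prob (no_regen K - never_regen)"
proof -
  let ?S = "{zs. rec_list k zs}"
  let ?\<delta> = "F (min pc pb) ^ l * p_good"
  define Past where "Past zs = {e. e \<in> no_regen_by K k - bad k l \<and> traj e (length zs - 1) = zs}" for zs
  \<comment> \<open>The paths meeting \<open>HR y\<close> are erased because \<open>Past\<close> may
    have revealed them.\<close>
  define Fut where "Fut y = diag_up y l \<inter> restr (- HR y) UNIV -` {e. good_at e (y + (int l, int l))}" for y
  have S: "traj e r \<in> ?S \<Longrightarrow> traj e r' \<in> ?S \<Longrightarrow> r = r'" for e r r'
    by (auto simp: rec_list_traj intro: record_unique)
  have good_at_sets: "{e. good_at e z} \<in> sets ENV" for z by (rule sets_ENV_Collect) measurable
  have HRc: "- HR y \<in> sets Wsp" for y by (rule compl_sets_Wsp) measurable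
  have dG: "determined_by (- HR y) {x. snd y + int l \<le> snd x} (restr (- HR y) UNIV -` {e. good_at e (y + (int l, int l))})" for y
    using determined_future[OF HRc good_at_sets, of "y + (int l, int l)" "y + (int l, int l)" y]
    by (simp add: good_at_def)
  have Fut_prob: "?\<delta> \<le> prob (Fut y)" for y
  proof -
    let ?z = "y + (int l, int l)"
    \<comment> \<open>Goodness of \<open>?z\<close> already excludes paths from \<open>HR y\<close>
      to its cone, because \<open>HR y\<close> lies in \<open>HR ?z\<close>. So erasing cannot
      destroy it, and \<open>p_good\<close> is a lower bound.\<close>
    have "{e. good_at e ?z} \<subseteq> restr (- HR y) UNIV -` {e. good_at e ?z}"
    proof
      fix e assume "e \<in> {e. good_at e ?z}"
      then have g: "good_at e ?z" by simp
      have "fst e \<inter> (HR y \<inter> H ?z) = {}"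
        using g HR_subset[OF diag_in_cone[of "int l" y]] by (auto simp: good_at_def Wcross_eq)
      from good_at_transfer(1)[OF agree_outside_past[OF this] g cone_self]
      show "e \<in> restr (- HR y) UNIV -` {e. good_at e ?z}" by simp
    qed
    moreover have "restr (- HR y) UNIV -` {e. good_at e ?z} \<in> events"
      using determined_sets[OF dG] by (simp add: sets_P)
    ultimately have "prob {e. good_at e ?z} \<le> prob (restr (- HR y) UNIV -` {e. good_at e ?z})"
      by (intro finite_measure_mono)
    moreover have "prob {e. good_at e ?z} = p_good"
      using prob_shift[OF good_at_sets[of 0], of ?z] by (simp add: p_good_def vimage_def good_at_shift)
    ultimately show ?thesis
      unfolding Fut_def prob_diag_up_Int[OF HRc dG] using F_pos by (simp add: mult_left_mono)
  qed
  have PF: "prob (Past zs \<inter> Fut (last zs)) = prob (Past zs) * prob (Fut (last zs))" if "rec_list k zs" for zs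
  proof -
    let ?y = "last zs"
    have "determined_by (- HR ?y) {z. snd ?y \<le> snd z} (diag_up ?y l)" by (rule determined_mono[OF determined_diag_up]) auto
    moreover have "determined_by (- HR ?y) {z. snd ?y \<le> snd z} (restr (- HR ?y) UNIV -` {e. good_at e (?y + (int l, int l))})"
      by (rule determined_mono[OF dG]) auto
    ultimately have "determined_by (- HR ?y) {z. snd ?y \<le> snd z} (Fut ?y)" unfolding Fut_def by (rule determined_Int)
    then show ?thesis
      unfolding Past_def
      by (intro prob_determined_Int[OF hit_rev_sets HRc _ _ determined_past[OF assms(1) that]]) auto
  qed
  have Past_sets: "Past zs \<in> events" if "rec_list k zs" for zs
    using determined_sets[OF determined_past[OF assms(1) that]] by (simp add: sets_P Past_def)
  have Fut_sets: "Fut y \<in> events" for y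
    using determined_sets[OF dG] diag_up_sets by (auto simp: sets_P Fut_def intro!: sets.Int)
  have dis: "disjoint_family_on Past ?S" "disjoint_family_on (\<lambda>zs. Past zs \<inter> Fut (last zs)) ?S"
    by (rule traj_disjoint[OF S], simp, simp, force simp: Past_def)+
  have "emeasure P (\<Union>zs\<in>?S. Past zs) * ennreal ?\<delta> = (\<integral>\<^sup>+ zs. emeasure P (Past zs) \<partial>count_space ?S) * ennreal ?\<delta>"
    by (subst emeasure_UN_countable) (auto intro!: Past_sets dis)
  also have "\<dots> = (\<integral>\<^sup>+ zs. emeasure P (Past zs) * ennreal ?\<delta> \<partial>count_space ?S)"
    by (rule nn_integral_multc[symmetric]) auto
  also have "\<dots> \<le> (\<integral>\<^sup>+ zs. emeasure P (Past zs \<inter> Fut (last zs)) \<partial>count_space ?S)"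
  proof (rule nn_integral_mono)
    fix zs assume "zs \<in> space (count_space ?S)"
    then have "prob (Past zs) * ?\<delta> \<le> prob (Past zs \<inter> Fut (last zs))"
      using PF[of zs] Fut_prob[of "last zs"] by (simp add: mult_left_mono)
    moreover have "0 \<le> ?\<delta>" using F_pos p_good_pos by simp
    ultimately show "emeasure P (Past zs) * ennreal ?\<delta> \<le> emeasure P (Past zs \<inter> Fut (last zs))"
      by (simp add: emeasure_eq_measure ennreal_mult[symmetric])
  qed
  also have "\<dots> = emeasure P (\<Union>zs\<in>?S. Past zs \<inter> Fut (last zs))"
    by (rule emeasure_UN_countable[symmetric])
       (auto intro!: Past_sets Fut_sets sets.Int dis)
  also have "\<dots> \<le> emeasure P (no_regen K - never_regen)"
  proof (rule emeasure_mono)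
    show "no_regen K - never_regen \<in> events"
      using no_regen_sets never_regen_sets by (auto simp: sets_P)
    show "(\<Union>zs\<in>?S. Past zs \<inter> Fut (last zs)) \<subseteq> no_regen K - never_regen"
    proof
      fix e assume "e \<in> (\<Union>zs\<in>?S. Past zs \<inter> Fut (last zs))"
      then obtain zs where rl: "rec_list k zs" and e: "e \<in> Past zs" "e \<in> Fut (last zs)" by blast
      define r where "r = length zs - 1"
      define y where "y = Y e 0 r"
      define z where "z = y + (int l, int l)"
      have zs: "zs = traj e r" using e(1) by (simp add: Past_def r_def)
      have y: "last zs = y" unfolding y_def zs by simp
      have rec: "record_at e k r" using rl unfolding zs rec_list_traj .
      have d: "snd e (Y e 0 r + (int j, int j)) \<le> min pc pb" if "j < l" for j
        using e(2) that by (simp add: Fut_def y diag_up_def y_def[symmetric])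
      note rd = record_diag[OF rec d]
      have none: "fst e \<inter> (HR y \<inter> H z) = {}"
        using e(1) rec by (auto simp: Past_def bad_def y_def z_def)
      have g: "good_at (restr (- HR y) UNIV e) z" using e(2) by (simp add: Fut_def y z_def)
      have "good_at e z"
        by (rule good_at_transfer(1)[OF agree_sym[OF agree_outside_past[OF none]] g cone_self])
      then have "good_at e (Y e 0 (r + l))" using rd(2) by (simp add: z_def y_def)
      moreover have "1 \<le> k + l" using assms by simp
      ultimately have "e \<notin> never_regen" using rd(1) unfolding never_regen_def by blast
      moreover have "e \<in> no_regen K"
        unfolding no_regen_def
      proof (intro CollectI allI impI)
        fix k' r' assume k': "1 \<le> k'" "k' \<le> K" "record_at e k' r'"
        obtain r1 where "failed_by e r' r1" using e(1) k' by (auto simp: Past_def no_regen_by_def)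
        then show "\<not> good_at e (Y e 0 r')" by (rule failed_by_not_good_at)
      qed
      ultimately show "e \<in> no_regen K - never_regen" by simp
    qed
  qed
  finally have "prob (\<Union>zs\<in>?S. Past zs) * ?\<delta> \<le> prob (no_regen K - never_regen)"
    using F_pos p_good_pos by (simp add: emeasure_eq_measure ennreal_mult[symmetric])
  moreover have "(\<Union>zs\<in>?S. Past zs) = no_regen_by K k - bad k l"
  proof (intro equalityI subsetI)
    fix e assume e: "e \<in> no_regen_by K k - bad k l"
    then obtain r where "record_at e k r" by (auto simp: no_regen_by_def)
    then show "e \<in> (\<Union>zs\<in>?S. Past zs)"
      using e by (intro UN_I[of "traj e r"]) (auto simp: Past_def rec_list_traj)
  qed (auto simp: Past_def)
  moreover have "prob (no_regen_by K k) - prob (bad k l) \<le> prob (no_regen_by K k - bad k l)"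
    using measure_Un_le[of "no_regen_by K k - bad k l" P "bad k l"]
      finite_measure_mono[of "no_regen_by K k" "no_regen_by K k - bad k l \<union> bad k l"]
      no_regen_by_sets bad_sets by (force simp: sets_P)
  moreover have "0 \<le> ?\<delta>" using F_pos p_good_pos by simp
  ultimately show ?thesis
    using mult_right_mono[of "prob (no_regen_by K k) - prob (bad k l)" "prob (no_regen_by K k - bad k l)" ?\<delta>]
    by simp
qed

text \<open>For fixed \<open>\<eta>\<close> and \<open>l\<close>, the chance to succeed after
  \<open>K\<close> failures dominates a fixed multiple of \<open>prob (no_regen K) - \<eta>\<close>.
  But it tends to 0 with \<open>K\<close>, since the events \<open>no_regen K\<close> decrease to
  \<open>never_regen\<close>. Hence \<open>prob never_regen \<le> \<eta>\<close>.\<close>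

lemma never_regen_null: "prob never_regen = 0"
proof -
  define RE where "RE = {e. \<forall>k. \<exists>r. record_at e k r}"
  have RE: "RE \<in> events" "prob RE = 1"
    unfolding RE_def by (rule sets_P_Collect, measurable) (rule all_records)
  have prob_RE: "prob (E \<inter> RE) = prob E" if "E \<in> events" for E
    by (rule prob_Int_almost_sure[OF that RE])
  have ev: "no_regen K \<in> events" "never_regen \<in> events" "no_regen_by K k \<in> events" for K k
    using no_regen_sets never_regen_sets no_regen_by_sets by (auto simp: sets_P)
  have lim: "(\<lambda>k. prob (no_regen_by K k \<inter> RE)) \<longlonglongrightarrow> prob (\<Union>k. no_regen_by K k \<inter> RE)" 
    and inc: "incseq (\<lambda>k. no_regen_by K k \<inter> RE)" for K
  proof -
    show inc: "incseq (\<lambda>k. no_regen_by K k \<inter> RE)"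
    proof (rule incseq_SucI, rule subsetI)
      fix k e assume e: "e \<in> no_regen_by K k \<inter> RE"
      then obtain r where r: "record_at e k r"
        "\<And>k' r'. 1 \<le> k' \<Longrightarrow> k' \<le> K \<Longrightarrow> record_at e k' r' \<Longrightarrow> failed_by e r' r"
        by (auto simp: no_regen_by_def)
      obtain s where s: "record_at e (Suc k) s" using e by (auto simp: RE_def)
      have "r \<le> s" using record_mono[OF s r(1)] by simp
      then show "e \<in> no_regen_by K (Suc k) \<inter> RE"
        using s r(2) failed_by_mono e unfolding no_regen_by_def by blast
    qed
    show "(\<lambda>k. prob (no_regen_by K k \<inter> RE)) \<longlonglongrightarrow> prob (\<Union>k. no_regen_by K k \<inter> RE)"
      by (rule finite_Lim_measure_incseq) (use inc RE ev in auto)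
  qed
  \<comment> \<open>Each of the \<open>K\<close> failures is witnessed at a finite time. The record
    with index the largest of these times occurs no earlier, by \<open>record_ge\<close>.\<close>
  have cover: "no_regen K \<inter> RE \<subseteq> (\<Union>k. no_regen_by K k \<inter> RE)" for K
  proof
    fix e assume e: "e \<in> no_regen K \<inter> RE"
    have "\<exists>b. \<forall>r\<ge>b. \<forall>r'. record_at e k' r' \<longrightarrow> failed_by e r' r" if "k' \<in> {1..K}" for k'
    proof -
      obtain r' where r': "record_at e k' r'" using e by (auto simp: RE_def)
      have "\<not> good_at e (Y e 0 r')" using e r' that by (auto simp: no_regen_def)
      from not_good_at_failed_by[OF this] show ?thesis using record_unique[OF r'] by blast
    qed
    then obtain b where b: "\<And>k' r r'. k' \<in> {1..K} \<Longrightarrow> b k' \<le> r \<Longrightarrow> record_at e k' r' \<Longrightarrow> failed_by e r' r"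
      by metis
    define k where "k = Max (insert 0 (b ` {1..K}))"
    have bk: "b k' \<le> k" if "k' \<in> {1..K}" for k' unfolding k_def using that by (intro Max_ge) auto
    obtain r where r: "record_at e k r" using e by (auto simp: RE_def)
    have "failed_by e r' r" if "1 \<le> k'" "k' \<le> K" "record_at e k' r'" for k' r'
      using b[of k' r r'] bk[of k'] record_ge[OF r] that by auto
    then show "e \<in> (\<Union>k. no_regen_by K k \<inter> RE)" using r e unfolding no_regen_by_def by blast
  qed
  \<comment> \<open>Tightness provides usable records only along a subsequence; monotonicity in
    \<open>k\<close> carries the bound to all \<open>k\<close>, and then to the limit.\<close>
  have step: "prob (no_regen K) \<le> \<eta> + prob (no_regen K - never_regen) / (F (min pc pb) ^ l * p_good)"
    if l: "\<forall>K. \<exists>k\<ge>K. prob (bad k l) \<le> \<eta>" and K: "1 \<le> K" for K l \<eta>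
  proof -
    let ?\<delta> = "F (min pc pb) ^ l * p_good"
    have \<delta>: "0 < ?\<delta>" using F_pos p_good_pos by simp
    have "prob (no_regen_by K k \<inter> RE) \<le> \<eta> + prob (no_regen K - never_regen) / ?\<delta>" for k
    proof -
      obtain k2 where k2: "k2 \<ge> max k K" "prob (bad k2 l) \<le> \<eta>" using l by blast
      have "prob (no_regen_by K k \<inter> RE) \<le> prob (no_regen_by K k2 \<inter> RE)"
        using incseqD[OF inc, of k k2 K] k2 ev RE by (intro finite_measure_mono) auto
      also have "\<dots> \<le> prob (no_regen_by K k2)" using ev by (intro finite_measure_mono) auto
      also have "\<dots> \<le> prob (bad k2 l) + prob (no_regen K - never_regen) / ?\<delta>"
      proof -
        have "prob (no_regen_by K k2) - prob (bad k2 l) \<le> prob (no_regen K - never_regen) / ?\<delta>"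
          unfolding pos_le_divide_eq[OF \<delta>] by (rule success_prob) (use k2 K in auto)
        then show ?thesis by simp
      qed
      finally show ?thesis using k2 by simp
    qed
    with lim have "prob (\<Union>k. no_regen_by K k \<inter> RE) \<le> \<eta> + prob (no_regen K - never_regen) / ?\<delta>"
      by (intro LIMSEQ_le_const2[OF lim]) auto
    moreover have "prob (no_regen K \<inter> RE) \<le> prob (\<Union>k. no_regen_by K k \<inter> RE)"
      using cover ev RE by (intro finite_measure_mono) auto
    ultimately show ?thesis using prob_RE[OF ev(1)] by simp
  qed
  have never: "never_regen = (\<Inter>K. no_regen K)"
    unfolding never_regen_def no_regen_def by blast
  have "(\<lambda>K. prob (no_regen K - never_regen)) \<longlonglongrightarrow> prob (\<Inter>K. no_regen K - never_regen)"
  proof (rule finite_Lim_measure_decseq)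
    show "decseq (\<lambda>K. no_regen K - never_regen)"
      by (rule decseq_SucI) (auto simp: no_regen_def)
  qed (use ev in auto)
  moreover have "(\<Inter>K. no_regen K - never_regen) = {}" unfolding never by blast
  ultimately have zero: "(\<lambda>K. prob (no_regen K - never_regen)) \<longlonglongrightarrow> 0"
    by (metis measure_empty)
  have small: "prob never_regen \<le> \<eta>" if \<eta>: "0 < \<eta>" for \<eta>
  proof -
    obtain l where l: "\<forall>K. \<exists>k\<ge>K. prob (bad k l) \<le> \<eta>" using bad_tight[OF \<eta>] by blast
    let ?f = "\<lambda>K. \<eta> + prob (no_regen K - never_regen) / (F (min pc pb) ^ l * p_good)"
    have lim: "?f \<longlonglongrightarrow> \<eta> + 0 / (F (min pc pb) ^ l * p_good)"
      using F_pos p_good_pos by (intro tendsto_intros zero) auto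
    have "prob never_regen \<le> ?f K" if "1 \<le> K" for K
    proof -
      have "prob never_regen \<le> prob (no_regen K)"
        by (rule finite_measure_mono[OF _ ev(1)]) (unfold never, blast)
      also have "\<dots> \<le> ?f K" by (rule step[OF l that])
      finally show ?thesis .
    qed
    then have "prob never_regen \<le> \<eta> + 0 / (F (min pc pb) ^ l * p_good)"
      by (intro LIMSEQ_le_const[OF lim] exI[of _ 1]) simp
    then show ?thesis by simp
  qed
  have "prob never_regen \<le> 0"
  proof (rule field_le_epsilon)
    show "prob never_regen \<le> 0 + \<eta>" if "0 < \<eta>" for \<eta> using small[OF that] by simp
  qed
  then show ?thesis by (simp add: measure_le_0_iff)
qed

lemma regen_prob: "prob {e. \<exists>k r. regen e k r} = 1"
proof -
  have "UNIV - never_regen \<subseteq> {e. \<exists>k r. regen e k r}"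
    using ex_regen unfolding never_regen_def by blast
  moreover have "{e. \<exists>k r. regen e k r} \<in> events" by (rule sets_P_Collect) measurable
  moreover have "prob (UNIV - never_regen) = 1"
    using prob_compl[of never_regen] never_regen_sets never_regen_null by (simp add: sets_P)
  ultimately show ?thesis by (metis finite_measure_mono antisym prob_le_1)
qed

end

section \<open>Random walk estimates and the intensity\<close>

abbreviation steps :: "real \<Rightarrow> (int \<Rightarrow> int) measure" where
  "steps q \<equiv> PiM UNIV (\<lambda>_::int. measure_pmf (lazy_step q))"

lemma pmf_lazy_step:
  assumes "0 < q" "q < 1"
  shows "pmf (lazy_step q) k = (if k = 0 then q else if \<bar>k\<bar> = 1 then (1 - q) / 2 else 0)"
  unfolding lazy_step_def
proof (rule pmf_embed_pmf)
  let ?f = "\<lambda>k::int. if k = 0 then q else if \<bar>k\<bar> = 1 then (1 - q) / 2 else 0"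
  have "(\<integral>\<^sup>+ x. ennreal (?f x) \<partial>count_space UNIV) = (\<integral>\<^sup>+ x. ennreal (?f x) \<partial>count_space {-1, 0, 1})"
    by (rule nn_integral_count_space_eq) auto
  also have "\<dots> = (\<Sum>x\<in>{-1, 0, 1}. ennreal (?f x))"
    by (rule nn_integral_count_space_finite) simp
  also have "\<dots> = ennreal ((1 - q) / 2 + (q + (1 - q) / 2))"
    using assms by (simp add: ennreal_plus[symmetric] del: ennreal_plus)
  finally show "(\<integral>\<^sup>+ x. ennreal (?f x) \<partial>count_space UNIV) = 1" by (simp add: field_simps)
qed (use assms in auto)

lemma nn_integral_lazy_step:
  assumes q: "0 < q" "q < 1" and f: "\<And>k. 0 \<le> f k"
  shows "(\<integral>\<^sup>+ k. ennreal (f k) \<partial>measure_pmf (lazy_step q)) = ennreal ((1 - q) / 2 * f (-1) + q * f 0 + (1 - q) / 2 * f 1)"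
proof -
  have set: "set_pmf (lazy_step q) \<subseteq> {-1, 0, 1}"
    by (auto simp: set_pmf_iff pmf_lazy_step[OF q] split: if_splits)
  have "(\<integral>\<^sup>+ k. ennreal (f k) \<partial>measure_pmf (lazy_step q)) = (\<Sum>k\<in>{-1, 0, 1}. ennreal (f k) * ennreal (pmf (lazy_step q) k))"
    by (rule nn_integral_measure_pmf_support) (use set in auto)
  also have "\<dots> = ennreal ((1 - q) / 2 * f (-1) + q * f 0 + (1 - q) / 2 * f 1)"
    using q f by (simp add: pmf_lazy_step[OF q] ennreal_mult[symmetric] ennreal_plus[symmetric] mult_ac add_ac del: ennreal_plus)
  finally show ?thesis .
qed

lemma prob_space_steps: "prob_space (steps q)"
  by (rule prob_space_PiM) (rule measure_pmf.prob_space_axioms)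

lemma space_steps [simp]: "space (steps q) = UNIV"
  by (simp add: space_PiM PiE_UNIV_domain)

lemma measurable_step [measurable]: "(\<lambda>\<xi>. \<xi> k) \<in> measurable (steps q) (count_space UNIV)"
proof -
  have "(\<lambda>\<xi>. \<xi> k) \<in> measurable (steps q) (measure_pmf (lazy_step q))"
    by (rule measurable_component_singleton) simp
  then show ?thesis by (simp add: measurable_cong_sets[OF refl sets_measure_pmf_count_space])
qed

lemma measurable_int_plus:
  fixes f g :: "'a \<Rightarrow> int"
  assumes [measurable]: "f \<in> measurable M (count_space UNIV)" "g \<in> measurable M (count_space UNIV)"
  shows "(\<lambda>x. f x + g x) \<in> measurable M (count_space UNIV)"
  by (rule measurable_compose_countable[where f="\<lambda>i x. i + g x"]) measurable

lemma measurable_step_sum: "(\<lambda>\<xi>. \<Sum>k\<in>J. \<xi> k) \<in> measurable (steps q) (count_space UNIV)"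
proof (cases "finite J")
  case True
  then show ?thesis
    by (induction J) (simp_all add: measurable_int_plus)
qed simp

lemma measurable_incr_to_path [measurable]: "incr_to_path x \<in> measurable (steps q) Wsp"
proof -
  have "(\<lambda>\<xi>. incr_to_path x \<xi> n) \<in> measurable (steps q) (count_space UNIV)" for n
  proof -
    have [measurable]: "(\<lambda>\<xi>. \<Sum>k\<in>J. \<xi> k) \<in> measurable (steps q) (count_space UNIV)" for J
      by (rule measurable_step_sum)
    show ?thesis unfolding incr_to_path_def by (cases "0 \<le> n") simp_all
  qed
  then have "(\<lambda>\<xi> n. incr_to_path x \<xi> n) \<in> measurable (steps q) (PiM UNIV (\<lambda>_::int. count_space (UNIV::int set)))"
    by (intro measurable_PiM_single') (auto simp: space_PiM PiE_UNIV_domain)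
  then show ?thesis unfolding Wsp_def by simp
qed

lemma incr_to_path_0 [simp]: "incr_to_path x \<xi> 0 = x"
  by (simp add: incr_to_path_def)

lemma incr_to_path_Suc: "incr_to_path x \<xi> (n + 1) = incr_to_path x \<xi> n + \<xi> n"
proof -
  have "{0..<n + 1} = insert n {0..<n}" if "0 \<le> n" using that by auto
  moreover have "{n..<0} = insert n {n + 1..<0}" if "n < 0" using that by auto
  ultimately show ?thesis
    by (cases "n < -1"; cases "n = -1") (auto simp: incr_to_path_def)
qed

lemma incr_to_path_shift:
  "incr_to_path x \<xi> (n + b) = incr_to_path (incr_to_path x \<xi> b) (\<lambda>k. \<xi> (k + b)) n"
proof (induction n rule: int_induct[where k=0])
  case (step1 i)
  then show ?case using incr_to_path_Suc[of x \<xi> "i + b"] incr_to_path_Suc[of _ "\<lambda>k. \<xi> (k + b)" i]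
    by (simp add: algebra_simps)
next
  case (step2 i)
  then show ?case using incr_to_path_Suc[of x \<xi> "i - 1 + b"] incr_to_path_Suc[of _ "\<lambda>k. \<xi> (k + b)" "i - 1"]
    by (simp add: algebra_simps)
qed simp

lemma incr_to_path_start: "incr_to_path x \<xi> n = x + incr_to_path 0 \<xi> n"
  by (simp add: incr_to_path_def)

section \<open>The intensity measure and its shift invariance\<close>

lemma emeasure_lazy_rw:
  "A \<in> sets Wsp \<Longrightarrow> emeasure (lazy_rw q x) A = emeasure (steps q) {\<xi>. incr_to_path x \<xi> \<in> A}"
  unfolding lazy_rw_def by (subst emeasure_distr) (auto simp: vimage_def)

lemma sets_intensity [simp]: "sets (intensity \<rho> q) = sets Wsp"
  unfolding intensity_def by (rule sets.sets_measure_of_eq)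

text \<open>\<open>measure_of\<close> yields the zero measure unless the given set function is a
  measure, so countable additivity has to be checked.\<close>

lemma emeasure_intensity:
  assumes "A \<in> sets Wsp"
  shows "emeasure (intensity \<rho> q) A
    = ennreal \<rho> * (\<integral>\<^sup>+ x. emeasure (lazy_rw q x) A \<partial>count_space UNIV)"
  using intensity_def
proof (rule emeasure_measure_of)
  show "sets Wsp \<subseteq> Pow (space Wsp)" by (simp add: sets.space_closed)
  show "positive (sets (intensity \<rho> q))
     (\<lambda>A. ennreal \<rho> * (\<integral>\<^sup>+ x. emeasure (lazy_rw q x) A \<partial>count_space (UNIV::int set)))"
    by (simp add: positive_def)
  show "countably_additive (sets (intensity \<rho> q))
     (\<lambda>A. ennreal \<rho> * (\<integral>\<^sup>+ x. emeasure (lazy_rw q x) A \<partial>count_space (UNIV::int set)))"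
  proof (rule countably_additiveI)
    fix A :: "nat \<Rightarrow> path set"
    assume A: "range A \<subseteq> sets (intensity \<rho> q)" "disjoint_family A"
    have s: "sets (lazy_rw q x) = sets Wsp" for x by (simp add: lazy_rw_def)
    have "(\<Sum>i. emeasure (lazy_rw q x) (A i)) = emeasure (lazy_rw q x) (\<Union>i. A i)" for x
      by (rule suminf_emeasure) (use A s in auto)
    then have "(\<Sum>i. \<integral>\<^sup>+ x. emeasure (lazy_rw q x) (A i) \<partial>count_space (UNIV::int set))
        = (\<integral>\<^sup>+ x. emeasure (lazy_rw q x) (\<Union>i. A i) \<partial>count_space UNIV)"
      by (subst nn_integral_suminf[symmetric]) auto
    then show "(\<Sum>i. ennreal \<rho> * (\<integral>\<^sup>+ x. emeasure (lazy_rw q x) (A i) \<partial>count_space (UNIV::int set)))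
        = ennreal \<rho> * (\<integral>\<^sup>+ x. emeasure (lazy_rw q x) (\<Union>i. A i) \<partial>count_space UNIV)"
      by simp
  qed
  show "A \<in> sets (intensity \<rho> q)" using assms by simp
qed

lemma steps_shift: "distr (steps q) (steps q) (\<lambda>\<xi> k. \<xi> (k + b)) = steps q"
  using distr_PiM_reindex[of UNIV "\<lambda>_. measure_pmf (lazy_step q)" "\<lambda>k::int. k + b" UNIV]
  by (simp add: measure_pmf.prob_space_axioms inj_on_def restrict_def)

text \<open>By Fubini, the sum over starting points is taken for fixed increments. A shift then
  translates the starting points, which does not change the sum, and moves the increments, whose
  product law is stationary.\<close>

lemma intensity_shift:
  assumes A: "A \<in> sets Wsp"
  shows "emeasure (intensity \<rho> q) (path_shift y -` A) = emeasure (intensity \<rho> q) A"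
proof -
  interpret S: prob_space "steps q" by (rule prob_space_steps)
  interpret C: sigma_finite_measure "count_space (UNIV :: int set)"
    by (rule sigma_finite_measure_count_space)
  interpret PS: pair_sigma_finite "steps q" "count_space (UNIV :: int set)" ..
  have meas: "case_prod (\<lambda>\<xi> x. indicator A (incr_to_path x \<xi>) :: ennreal)
      \<in> borel_measurable (steps q \<Otimes>\<^sub>M count_space (UNIV :: int set))" if [measurable]: "A \<in> sets Wsp" for A
    unfolding measurable_split_conv
    by (rule measurable_compose_countable'[where f="\<lambda>x z. indicator A (incr_to_path x (fst z))" and I=UNIV]) simp_all
  have swap: "(\<integral>\<^sup>+ x. emeasure (lazy_rw q x) A \<partial>count_space UNIV)
      = (\<integral>\<^sup>+ \<xi>. \<integral>\<^sup>+ x. indicator A (incr_to_path x \<xi>) \<partial>count_space UNIV \<partial>steps q)" if A: "A \<in> sets Wsp" for A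
  proof -
    have "emeasure (lazy_rw q x) A = (\<integral>\<^sup>+ \<xi>. indicator A (incr_to_path x \<xi>) \<partial>steps q)" for x
    proof -
      have "{\<xi>. incr_to_path x \<xi> \<in> A} \<in> sets (steps q)"
        using measurable_sets[OF measurable_incr_to_path A, of x q] by (simp add: vimage_def)
      moreover have "indicator A (incr_to_path x \<xi>) = (indicator {\<xi>. incr_to_path x \<xi> \<in> A} \<xi> :: ennreal)" for \<xi>
        by (simp add: indicator_def)
      ultimately show ?thesis by (simp add: emeasure_lazy_rw[OF A])
    qed
    then show ?thesis using PS.Fubini'[OF meas[OF A]] by simp
  qed
  have "(\<integral>\<^sup>+ x. indicator (path_shift y -` A) (incr_to_path x \<xi>) \<partial>count_space UNIV)
      = (\<integral>\<^sup>+ x. indicator A (incr_to_path x (\<lambda>k. \<xi> (k + snd y))) \<partial>count_space UNIV)" for \<xi>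
  proof -
    \<comment> \<open>The displacement of the starting point does not depend on \<open>x\<close>, so
      it acts as a bijection of the integers.\<close>
    let ?s = "incr_to_path 0 \<xi> (snd y) - fst y"
    have "path_shift y (incr_to_path x \<xi>) = incr_to_path (x + ?s) (\<lambda>k. \<xi> (k + snd y))" for x
    proof (rule ext)
      fix n
      have "path_shift y (incr_to_path x \<xi>) n = incr_to_path (incr_to_path x \<xi> (snd y)) (\<lambda>k. \<xi> (k + snd y)) n - fst y"
        by (simp add: path_shift_def incr_to_path_shift)
      then show "path_shift y (incr_to_path x \<xi>) n = incr_to_path (x + ?s) (\<lambda>k. \<xi> (k + snd y)) n"
        using incr_to_path_start[of x \<xi> "snd y"]
          incr_to_path_start[of "incr_to_path x \<xi> (snd y)" "\<lambda>k. \<xi> (k + snd y)" n]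
          incr_to_path_start[of "x + ?s" "\<lambda>k. \<xi> (k + snd y)" n] by simp
    qed
    then have "(\<integral>\<^sup>+ x. indicator (path_shift y -` A) (incr_to_path x \<xi>) \<partial>count_space UNIV)
        = (\<integral>\<^sup>+ x. indicator A (incr_to_path (x + ?s) (\<lambda>k. \<xi> (k + snd y))) \<partial>count_space UNIV)"
      by (simp add: indicator_def)
    also have "\<dots> = (\<integral>\<^sup>+ x. indicator A (incr_to_path x (\<lambda>k. \<xi> (k + snd y))) \<partial>count_space UNIV)"
      by (rule nn_integral_bij_count_space)
         (rule bij_betw_byWitness[where f'="\<lambda>x. x - ?s"], auto)
    finally show ?thesis .
  qed
  moreover have "(\<integral>\<^sup>+ \<xi>. \<integral>\<^sup>+ x. indicator A (incr_to_path x (\<lambda>k. \<xi> (k + snd y))) \<partial>count_space UNIV \<partial>steps q)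
      = (\<integral>\<^sup>+ \<xi>. \<integral>\<^sup>+ x. indicator A (incr_to_path x \<xi>) \<partial>count_space UNIV \<partial>steps q)"
  proof -
    have m: "(\<lambda>\<xi> k. \<xi> (k + snd y)) \<in> measurable (steps q) (steps q)"
      by (rule measurable_PiM_single') (auto simp: space_PiM PiE_UNIV_domain)
    have "(\<lambda>\<xi>. \<integral>\<^sup>+ x. indicator A (incr_to_path x \<xi>) \<partial>count_space UNIV) \<in> borel_measurable (steps q)"
      by (rule C.borel_measurable_nn_integral) (use meas[OF A] in simp)
    from nn_integral_distr[OF m, unfolded steps_shift, OF this] show ?thesis by simp
  qed
  ultimately show ?thesis
    using path_shift_sets[OF A, of y] A by (simp add: emeasure_intensity swap)
qed

section \<open>Exponential tail bounds for the lazy walk\<close>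

lemma nn_integral_steps_prod:
  assumes "finite J" "\<And>k. 0 \<le> f k"
  shows "(\<integral>\<^sup>+ \<xi>. (\<Prod>k\<in>J. ennreal (f (\<xi> k))) \<partial>steps q) = (\<integral>\<^sup>+ x. ennreal (f x) \<partial>measure_pmf (lazy_step q)) ^ card J"
proof -
  interpret product_sigma_finite "\<lambda>_::int. measure_pmf (lazy_step q)"
    by (rule product_sigma_finite.intro) (rule measure_pmf.sigma_finite_measure_axioms)
  let ?PJ = "PiM J (\<lambda>_::int. measure_pmf (lazy_step q))"
  have d: "distr (steps q) ?PJ (\<lambda>\<xi>. \<lambda>k\<in>J. \<xi> k) = ?PJ"
    using distr_PiM_reindex[of UNIV "\<lambda>_. measure_pmf (lazy_step q)" "\<lambda>k::int. k" J]
    by (simp add: measure_pmf.prob_space_axioms)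
  have [measurable]: "(\<lambda>\<xi>. ennreal (f (\<xi> k))) \<in> borel_measurable ?PJ" if "k \<in> J" for k
    by (rule measurable_compose[OF measurable_component_singleton[OF that]]) simp
  have "(\<integral>\<^sup>+ \<xi>. (\<Prod>k\<in>J. ennreal (f (\<xi> k))) \<partial>steps q)
      = (\<integral>\<^sup>+ \<xi>. (\<Prod>k\<in>J. ennreal (f ((\<lambda>k\<in>J. \<xi> k) k))) \<partial>steps q)"
    by (intro nn_integral_cong prod.cong) auto
  also have "\<dots> = (\<integral>\<^sup>+ \<xi>. (\<Prod>k\<in>J. ennreal (f (\<xi> k))) \<partial>distr (steps q) ?PJ (\<lambda>\<xi>. \<lambda>k\<in>J. \<xi> k))"
    by (subst nn_integral_distr) (auto intro!: measurable_restrict)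
  also have "\<dots> = (\<Prod>k\<in>J. \<integral>\<^sup>+ x. ennreal (f x) \<partial>measure_pmf (lazy_step q))"
    unfolding d by (rule product_nn_integral_prod) (use assms in auto)
  finally show ?thesis by simp
qed

text \<open>The exponential moment of \<open>\<theta> * (\<xi> - v)\<close> for a single step
  \<open>\<xi>\<close>.\<close>

definition chernoff :: "real \<Rightarrow> real \<Rightarrow> real \<Rightarrow> real" where
  "chernoff q v \<theta> = (1 - q) / 2 * exp (\<theta> * (- 1 - v)) + q * exp (\<theta> * (0 - v)) + (1 - q) / 2 * exp (\<theta> * (1 - v))"

lemma chernoff_nonneg: "0 < q \<Longrightarrow> q < 1 \<Longrightarrow> 0 \<le> chernoff q v \<theta>"
  by (simp add: chernoff_def)

text \<open>At \<open>\<theta> = 0\<close> the value is 1 and the derivative is \<open>- v\<close>,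
  because the step is centred.\<close>

lemma chernoff_less_1:
  assumes "0 < v" shows "\<exists>\<theta>>0. chernoff q v \<theta> < 1"
proof -
  have "((\<lambda>\<theta>. chernoff q v \<theta>) has_real_derivative - v) (at 0)"
    unfolding chernoff_def by (auto intro!: derivative_eq_intros simp: algebra_simps) (simp add: field_simps)
  from DERIV_neg_dec_right[OF this] assms obtain d where
    "0 < d" "\<And>h. 0 < h \<Longrightarrow> h < d \<Longrightarrow> chernoff q v (0 + h) < chernoff q v 0" by auto
  from this(2)[of "d / 2"] this(1) show ?thesis
    by (intro exI[of _ "d / 2"]) (simp add: chernoff_def field_simps)
qed

lemma steps_tail:
  fixes s v :: real
  assumes q: "0 < q" "q < 1" and J: "finite J" and "0 < \<theta>"
  shows "emeasure (steps q) {\<xi>. s + v * card J \<le> real_of_int (\<Sum>k\<in>J. \<xi> k)}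
    \<le> ennreal (exp (- \<theta> * s) * chernoff q v \<theta> ^ card J)"
proof -
  let ?E = "{\<xi>. s + v * card J \<le> real_of_int (\<Sum>k\<in>J. \<xi> k)}"
  let ?f = "\<lambda>x::int. exp (\<theta> * (real_of_int x - v))"
  have E: "?E \<in> sets (steps q)"
    using measurable_sets[OF measurable_step_sum[of J q], of "{x. s + v * card J \<le> real_of_int x}"]
    by (simp add: vimage_def)
  have "indicator ?E \<xi> \<le> ennreal (exp (- \<theta> * s)) * (\<Prod>k\<in>J. ennreal (?f (\<xi> k)))" for \<xi>
  proof -
    have "(\<Prod>k\<in>J. ennreal (?f (\<xi> k))) = ennreal (exp (\<Sum>k\<in>J. \<theta> * (real_of_int (\<xi> k) - v)))"
      using J by (simp add: prod_ennreal exp_sum)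
    also have "(\<Sum>k\<in>J. \<theta> * (real_of_int (\<xi> k) - v)) = \<theta> * (real_of_int (\<Sum>k\<in>J. \<xi> k) - v * card J)"
      by (simp add: sum_distrib_left[symmetric] sum_subtractf)
    finally have *: "ennreal (exp (- \<theta> * s)) * (\<Prod>k\<in>J. ennreal (?f (\<xi> k)))
        = ennreal (exp (\<theta> * (real_of_int (\<Sum>k\<in>J. \<xi> k) - v * card J - s)))"
      by (simp add: ennreal_mult[symmetric] exp_add[symmetric] algebra_simps)
    show ?thesis unfolding * using \<open>0 < \<theta>\<close>
      by (auto simp: indicator_def intro!: order.trans[OF _ ennreal_leI[of 1]] simp del: of_int_sum)
  qed
  then have "(\<integral>\<^sup>+ \<xi>. indicator ?E \<xi> \<partial>steps q) \<le> (\<integral>\<^sup>+ \<xi>. ennreal (exp (- \<theta> * s)) * (\<Prod>k\<in>J. ennreal (?f (\<xi> k))) \<partial>steps q)"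
    by (intro nn_integral_mono)
  also have "\<dots> = ennreal (exp (- \<theta> * s)) * (\<integral>\<^sup>+ \<xi>. (\<Prod>k\<in>J. ennreal (?f (\<xi> k))) \<partial>steps q)"
  proof (rule nn_integral_cmult)
    have [measurable]: "(\<lambda>\<xi>. ennreal (?f (\<xi> k))) \<in> borel_measurable (steps q)" for k
      by (rule measurable_compose[OF measurable_step]) simp
    show "(\<lambda>\<xi>. \<Prod>k\<in>J. ennreal (?f (\<xi> k))) \<in> borel_measurable (steps q)" by measurable
  qed
  also have "(\<integral>\<^sup>+ \<xi>. (\<Prod>k\<in>J. ennreal (?f (\<xi> k))) \<partial>steps q) = ennreal (chernoff q v \<theta>) ^ card J"
    by (subst nn_integral_steps_prod[OF J]) (simp_all add: nn_integral_lazy_step[OF q] chernoff_def)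
  also have "ennreal (exp (- \<theta> * s)) * ennreal (chernoff q v \<theta>) ^ card J
      = ennreal (exp (- \<theta> * s) * chernoff q v \<theta> ^ card J)"
    using q by (simp add: ennreal_power ennreal_mult chernoff_nonneg)
  finally show ?thesis using E by (simp del: of_int_sum)
qed

lemma suminf_geometric_ennreal:
  assumes "0 \<le> \<kappa>" "\<kappa> < 1" "0 \<le> a"
  shows "(\<Sum>n. ennreal (a * \<kappa> ^ n)) = ennreal (a / (1 - \<kappa>))"
proof -
  have "(\<lambda>n. a * \<kappa> ^ n) sums (a * (1 / (1 - \<kappa>)))"
    by (intro sums_mult geometric_sums) (use assms in simp)
  then show ?thesis using assms by (intro suminf_ennreal_eq) simp_all
qed

text \<open>A union over times, bounded by a geometric series in
  \<open>chernoff q v \<theta>\<close>. The backward walk is a sum over the steps in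
  \<open>{- n..<0}\<close>, to which the same tail bound applies.\<close>

lemma lazy_rw_exceed:
  fixes s v :: real
  assumes q: "0 < q" "q < 1" and \<theta>: "0 < \<theta>" "chernoff q v \<theta> < 1"
  shows "emeasure (steps q) {\<xi>. \<exists>n\<ge>0. s + v * real_of_int n \<le> real_of_int (incr_to_path x \<xi> n - x)}
      \<le> ennreal (exp (- \<theta> * s) / (1 - chernoff q v \<theta>))" (is "emeasure _ ?F \<le> ?r")
    and "emeasure (steps q) {\<xi>. \<exists>n\<le>0. s - v * real_of_int n \<le> real_of_int (x - incr_to_path x \<xi> n)}
      \<le> ennreal (exp (- \<theta> * s) / (1 - chernoff q v \<theta>))" (is "emeasure _ ?B \<le> ?r")
proof -
  have pos: "0 \<le> chernoff q v \<theta>" using q by (simp add: chernoff_def)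
  have bound: "emeasure (steps q) (\<Union>n. {\<xi>. s + v * card (J n) \<le> real_of_int (\<Sum>k\<in>J n. \<xi> k)}) \<le> ?r"
    if J: "\<And>n. finite (J n)" "\<And>n. card (J n) = n" for J :: "nat \<Rightarrow> int set"
  proof -
    have "emeasure (steps q) (\<Union>n. {\<xi>. s + v * card (J n) \<le> real_of_int (\<Sum>k\<in>J n. \<xi> k)})
        \<le> (\<Sum>n. emeasure (steps q) {\<xi>. s + v * card (J n) \<le> real_of_int (\<Sum>k\<in>J n. \<xi> k)})"
    proof (rule emeasure_subadditive_countably, rule image_subsetI)
      fix n
      show "{\<xi>. s + v * card (J n) \<le> real_of_int (\<Sum>k\<in>J n. \<xi> k)} \<in> sets (steps q)"
        using measurable_sets[OF measurable_step_sum[of "J n" q], of "{x. s + v * card (J n) \<le> real_of_int x}"]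
        by (simp add: vimage_def)
    qed
    also have "\<dots> \<le> (\<Sum>n. ennreal (exp (- \<theta> * s) * chernoff q v \<theta> ^ n))"
      by (intro suminf_le) (use steps_tail[OF q J(1) \<theta>(1), of s v] J(2) in auto)
    also have "\<dots> = ?r" by (rule suminf_geometric_ennreal) (use pos \<theta> in auto)
    finally show ?thesis .
  qed
  have meas: "(\<Union>n. {\<xi>. s + v * card (J n) \<le> real_of_int (\<Sum>k\<in>J n. \<xi> k)}) \<in> sets (steps q)"
    for J :: "nat \<Rightarrow> int set"
  proof (intro sets.countable_UN image_subsetI)
    fix n
    show "{\<xi>. s + v * card (J n) \<le> real_of_int (\<Sum>k\<in>J n. \<xi> k)} \<in> sets (steps q)"
      using measurable_sets[OF measurable_step_sum[of "J n" q], of "{x. s + v * card (J n) \<le> real_of_int x}"]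
      by (simp add: vimage_def)
  qed
  have "?F \<subseteq> (\<Union>n. {\<xi>. s + v * card {0..<int n} \<le> real_of_int (\<Sum>k\<in>{0..<int n}. \<xi> k)})"
  proof
    fix \<xi> assume "\<xi> \<in> ?F"
    then obtain n where "n \<ge> 0" "s + v * real_of_int n \<le> real_of_int (incr_to_path x \<xi> n - x)" by blast
    then show "\<xi> \<in> (\<Union>n. {\<xi>. s + v * card {0..<int n} \<le> real_of_int (\<Sum>k\<in>{0..<int n}. \<xi> k)})"
      by (intro UN_I[of "nat n"]) (simp_all add: incr_to_path_def)
  qed
  then have "emeasure (steps q) ?F \<le> emeasure (steps q) (\<Union>n. {\<xi>. s + v * card {0..<int n} \<le> real_of_int (\<Sum>k\<in>{0..<int n}. \<xi> k)})"
    by (rule emeasure_mono) (rule meas)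
  also have "\<dots> \<le> ?r" by (rule bound) auto
  finally show "emeasure (steps q) ?F \<le> ?r" .
  have "?B \<subseteq> (\<Union>n. {\<xi>. s + v * card {- int n..<0} \<le> real_of_int (\<Sum>k\<in>{- int n..<0}. \<xi> k)})"
  proof
    fix \<xi> assume "\<xi> \<in> ?B"
    then obtain n where "n \<le> 0" "s - v * real_of_int n \<le> real_of_int (x - incr_to_path x \<xi> n)" by blast
    then show "\<xi> \<in> (\<Union>n. {\<xi>. s + v * card {- int n..<0} \<le> real_of_int (\<Sum>k\<in>{- int n..<0}. \<xi> k)})"
      by (intro UN_I[of "nat (- n)"]) (auto simp: incr_to_path_def split: if_splits)
  qed
  then have "emeasure (steps q) ?B \<le> emeasure (steps q) (\<Union>n. {\<xi>. s + v * card {- int n..<0} \<le> real_of_int (\<Sum>k\<in>{- int n..<0}. \<xi> k)})"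
    by (rule emeasure_mono) (rule meas)
  also have "\<dots> \<le> ?r" by (rule bound) auto
  finally show "emeasure (steps q) ?B \<le> ?r" .
qed

lemma nn_integral_two_sided_geometric:
  assumes "0 \<le> r" "r < 1"
  shows "(\<integral>\<^sup>+ x. ennreal (r ^ nat \<bar>x::int\<bar>) \<partial>count_space UNIV) \<le> ennreal (2 / (1 - r))"
proof -
  have "ennreal (r ^ nat \<bar>x\<bar>) \<le> (\<Sum>n. ennreal (r ^ n) * indicator {int n, - int n} x)" for x :: int
  proof -
    have "ennreal (r ^ nat \<bar>x\<bar>) = (\<Sum>n\<in>{nat \<bar>x\<bar>}. ennreal (r ^ n) * indicator {int n, - int n} x)"
      by (auto simp: indicator_def abs_if split: if_splits)
    also have "\<dots> \<le> (\<Sum>n. ennreal (r ^ n) * indicator {int n, - int n} x)"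
      by (rule sum_le_suminf) auto
    finally show ?thesis .
  qed
  then have "(\<integral>\<^sup>+ x. ennreal (r ^ nat \<bar>x::int\<bar>) \<partial>count_space UNIV)
      \<le> (\<integral>\<^sup>+ x. (\<Sum>n. ennreal (r ^ n) * indicator {int n, - int n} x) \<partial>count_space UNIV)"
    by (intro nn_integral_mono)
  also have "\<dots> = (\<Sum>n. \<integral>\<^sup>+ x. ennreal (r ^ n) * indicator {int n, - int n} x \<partial>count_space UNIV)"
    by (rule nn_integral_suminf) auto
  also have "\<dots> \<le> (\<Sum>n. ennreal (2 * r ^ n))"
  proof (rule suminf_le)
    fix n
    have "emeasure (count_space UNIV) {int n, - int n} \<le> ennreal 2"
      by (simp add: card_insert_if)
    then have "ennreal (r ^ n) * emeasure (count_space UNIV) {int n, - int n} \<le> ennreal (r ^ n) * ennreal 2"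
      by (rule mult_left_mono) simp
    then show "(\<integral>\<^sup>+ x. ennreal (r ^ n) * indicator {int n, - int n} x \<partial>count_space UNIV) \<le> ennreal (2 * r ^ n)"
      using assms by (simp add: nn_integral_cmult_indicator ennreal_mult mult.commute)
  qed auto
  also have "\<dots> = ennreal (2 / (1 - r))" by (rule suminf_geometric_ennreal) (use assms in auto)
  finally show ?thesis .
qed

section \<open>Iterated regeneration\<close>

context walk
begin

lemma intensity_exceed:
  assumes q: "0 < q" "q < 1" and \<theta>: "0 < \<theta>" "chernoff q v \<theta> < 1" and \<rho>: "0 < \<rho>"
  shows "emeasure (intensity \<rho> q) (exceed 0 s) \<le> ennreal (\<rho> * (exp (- \<theta> * s) / (1 - chernoff q v \<theta>)))"
proof -
  let ?a = "exp (- \<theta> * s) / (1 - chernoff q v \<theta>)"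
  have "emeasure (lazy_rw q x) (exceed 0 s) \<le> ennreal ?a * indicator {0} x" for x
  proof (cases "x = 0")
    case True
    have "{\<xi>. incr_to_path 0 \<xi> \<in> exceed 0 s} =
       {\<xi>. \<exists>n\<ge>0. s + v * real_of_int n \<le> real_of_int (incr_to_path 0 \<xi> n - 0)}"
      by (auto simp: exceed_def through_def height_pair)
    then show ?thesis
      using lazy_rw_exceed(1)[OF q \<theta>, of s 0] True by (simp add: emeasure_lazy_rw)
  next
    case False
    then have "{\<xi>. incr_to_path x \<xi> \<in> exceed 0 s} = {}" by (auto simp: exceed_def through_def)
    then show ?thesis by (simp add: emeasure_lazy_rw)
  qed
  then have "(\<integral>\<^sup>+ x. emeasure (lazy_rw q x) (exceed 0 s) \<partial>count_space UNIV)
      \<le> (\<integral>\<^sup>+ x. ennreal ?a * indicator {0} x \<partial>count_space (UNIV :: int set))"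
    by (intro nn_integral_mono)
  also have "\<dots> = ennreal ?a" by (subst nn_integral_cmult_indicator) auto
  finally have "ennreal \<rho> * (\<integral>\<^sup>+ x. emeasure (lazy_rw q x) (exceed 0 s) \<partial>count_space UNIV) \<le> ennreal \<rho> * ennreal ?a"
    by (rule mult_left_mono) simp
  then show ?thesis
    unfolding emeasure_intensity[OF exceed_sets] ennreal_mult'[OF less_imp_le[OF \<rho>]] .
qed

lemma lazy_rw_cross:
  assumes q: "0 < q" "q < 1" and \<theta>: "0 < \<theta>" "chernoff q v \<theta> < 1"
  shows "emeasure (lazy_rw q x) (HR 0 \<inter> H (int l, int l))
    \<le> ennreal (exp (- (\<theta> * (1 - v) / 4) * real l) / (1 - chernoff q v \<theta>) * exp (- \<theta> / 2) ^ nat \<bar>x\<bar>)"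
proof -
  let ?a = "(1 - v) * real l"
  let ?E = "{\<xi>. incr_to_path x \<xi> \<in> HR 0 \<inter> H (int l, int l)}"
  have a: "0 \<le> ?a" using v by simp
  \<comment> \<open>If the start \<open>x\<close> is at least \<open>?a / 2\<close>, the path must
    drop by at least \<open>x\<close> relative to the slope when followed backwards; otherwise it
    must gain \<open>?a - x\<close> forwards. Either amount is at least
    \<open>?a / 4 + \<bar>x\<bar> / 2\<close>: the first term gives decay in \<open>l\<close>, the
    second makes the sum over \<open>x\<close> converge.\<close>
  have bound: "ennreal (exp (- \<theta> * s) / (1 - chernoff q v \<theta>))
      \<le> ennreal (exp (- (\<theta> * (1 - v) / 4) * real l) / (1 - chernoff q v \<theta>) * exp (- \<theta> / 2) ^ nat \<bar>x\<bar>)"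
    if "?a / 4 + \<bar>real_of_int x\<bar> / 2 \<le> s" for s
  proof -
    have "exp (- \<theta> * s) \<le> exp (- \<theta> * (?a / 4 + \<bar>real_of_int x\<bar> / 2))" using that \<theta> by simp
    also have "\<dots> = exp (- (\<theta> * (1 - v) / 4) * real l) * exp (real (nat \<bar>x\<bar>) * (- \<theta> / 2))"
      by (simp add: exp_add[symmetric] field_simps)
    also have "\<dots> = exp (- (\<theta> * (1 - v) / 4) * real l) * exp (- \<theta> / 2) ^ nat \<bar>x\<bar>"
      by (simp only: exp_of_nat_mult)
    finally show ?thesis using \<theta> by (intro ennreal_leI) (simp add: divide_right_mono)
  qed
  have meas: "{\<xi>. Q \<xi>} \<in> sets (steps q)" if "\<And>n. {\<xi>. R n \<xi>} \<in> sets (steps q)" "\<And>\<xi>. Q \<xi> \<longleftrightarrow> (\<exists>n::int. R n \<xi>)" for Q R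
  proof -
    have "{\<xi>. Q \<xi>} = (\<Union>n. {\<xi>. R n \<xi>})" using that(2) by auto
    then show ?thesis using that(1) by auto
  qed
  have coord: "{\<xi>. T (incr_to_path x \<xi> n)} \<in> sets (steps q)" for T n
    using measurable_sets[OF measurable_compose[OF measurable_incr_to_path measurable_eval_Wsp], of "{y. T y}" x n q]
    by (simp add: vimage_def)
  show ?thesis
  proof (cases "?a / 2 \<le> real_of_int x")
    case True
    let ?B = "{\<xi>. \<exists>n\<le>0. real_of_int x - v * real_of_int n \<le> real_of_int (x - incr_to_path x \<xi> n)}"
    have "?E \<subseteq> ?B"
      by (auto simp: hit_rev_def cone_rev_iff height_pair intro: less_imp_le)
    moreover have "?B \<in> sets (steps q)"
      by (rule meas[OF coord]) auto
    ultimately have "emeasure (steps q) ?E \<le> emeasure (steps q) ?B" by (intro emeasure_mono)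
    also have "\<dots> \<le> ennreal (exp (- \<theta> * real_of_int x) / (1 - chernoff q v \<theta>))"
      by (rule lazy_rw_exceed(2)[OF q \<theta>])
    also have "\<dots> \<le> ennreal (exp (- (\<theta> * (1 - v) / 4) * real l) / (1 - chernoff q v \<theta>) * exp (- \<theta> / 2) ^ nat \<bar>x\<bar>)"
      by (rule bound) (use True a in linarith)
    finally show ?thesis by (simp add: emeasure_lazy_rw)
  next
    case False
    let ?F = "{\<xi>. \<exists>n\<ge>0. (?a - real_of_int x) + v * real_of_int n \<le> real_of_int (incr_to_path x \<xi> n - x)}"
    have "?E \<subseteq> ?F"
    proof
      fix \<xi> assume "\<xi> \<in> ?E"
      then obtain n where "(incr_to_path x \<xi> n, n) \<in> C (int l, int l)" by (auto simp: hit_cone_def)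
      then show "\<xi> \<in> ?F"
        by (intro CollectI exI[of _ n]) (auto simp: cone_iff height_pair algebra_simps)
    qed
    moreover have "?F \<in> sets (steps q)"
      by (rule meas[OF coord]) auto
    ultimately have "emeasure (steps q) ?E \<le> emeasure (steps q) ?F" by (intro emeasure_mono)
    also have "\<dots> \<le> ennreal (exp (- \<theta> * (?a - real_of_int x)) / (1 - chernoff q v \<theta>))"
      by (rule lazy_rw_exceed(1)[OF q \<theta>])
    also have "\<dots> \<le> ennreal (exp (- (\<theta> * (1 - v) / 4) * real l) / (1 - chernoff q v \<theta>) * exp (- \<theta> / 2) ^ nat \<bar>x\<bar>)"
      by (rule bound) (use False a in linarith)
    finally show ?thesis by (simp add: emeasure_lazy_rw)
  qed
qed

lemma intensity_cross:
  assumes q: "0 < q" "q < 1" and \<theta>: "0 < \<theta>" "chernoff q v \<theta> < 1" and \<rho>: "0 < \<rho>"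
  shows "emeasure (intensity \<rho> q) (HR 0 \<inter> H (int l, int l))
    \<le> ennreal (\<rho> * (exp (- (\<theta> * (1 - v) / 4) * real l) / (1 - chernoff q v \<theta>) * (2 / (1 - exp (- \<theta> / 2)))))"
proof -
  let ?b = "exp (- (\<theta> * (1 - v) / 4) * real l) / (1 - chernoff q v \<theta>)"
  have b: "0 \<le> ?b" using \<theta> by simp
  have "(\<integral>\<^sup>+ x. emeasure (lazy_rw q x) (HR 0 \<inter> H (int l, int l)) \<partial>count_space UNIV)
      \<le> (\<integral>\<^sup>+ x. ennreal ?b * ennreal (exp (- \<theta> / 2) ^ nat \<bar>x\<bar>) \<partial>count_space UNIV)"
    using lazy_rw_cross[OF q \<theta>] b by (intro nn_integral_mono) (simp add: ennreal_mult[symmetric])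
  also have "\<dots> = ennreal ?b * (\<integral>\<^sup>+ x. ennreal (exp (- \<theta> / 2) ^ nat \<bar>x\<bar>) \<partial>count_space UNIV)"
    by (rule nn_integral_cmult) simp
  also have "\<dots> \<le> ennreal ?b * ennreal (2 / (1 - exp (- \<theta> / 2)))"
    by (rule mult_left_mono[OF nn_integral_two_sided_geometric]) (use \<theta> in auto)
  finally have "ennreal \<rho> * (\<integral>\<^sup>+ x. emeasure (lazy_rw q x) (HR 0 \<inter> H (int l, int l)) \<partial>count_space UNIV)
      \<le> ennreal \<rho> * (ennreal ?b * ennreal (2 / (1 - exp (- \<theta> / 2))))"
    by (rule mult_left_mono) simp
  moreover have "HR 0 \<inter> H (int l, int l) \<in> sets Wsp" by measurable
  ultimately show ?thesis
    by (simp only: emeasure_intensity ennreal_mult'[OF less_imp_le[OF \<rho>]] ennreal_mult'[OF b])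
qed

section \<open>Regeneration as a total map on environments\<close>

definition record_time :: "env \<Rightarrow> nat \<Rightarrow> nat" where
  "record_time e k = (LEAST n. (1 - v) * real k \<le> ht (Y e 0 n))"

text \<open>Total functions in the form of the model. They agree with the relation
  \<open>regen\<close> whenever a regeneration exists; otherwise their value is arbitrary.\<close>

definition regen_time :: "env \<Rightarrow> nat" where
  "regen_time e = record_time e (LEAST k. 1 \<le> k \<and> good_at e (Y e 0 (record_time e k)))"

definition first_piece :: "env \<Rightarrow> seg" where
  "first_piece e = seg e (regen_time e)"

definition renew :: "env \<Rightarrow> env" where
  "renew e = env_shift (Y e 0 (regen_time e)) e"

lemma record_time_eq: "record_at e k r \<Longrightarrow> record_time e k = r"
  unfolding record_time_def record_at_def by (rule Least_equality) (auto simp: not_le[symmetric] intro: leI)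

lemma regen_time_eq:
  assumes r: "regen e k r" shows "regen_time e = r"
proof -
  have rec: "record_at e k r" using r by (simp add: regen_def)
  have "(LEAST k. 1 \<le> k \<and> good_at e (Y e 0 (record_time e k))) = k"
  proof (rule Least_equality)
    show "1 \<le> k \<and> good_at e (Y e 0 (record_time e k))"
      using r record_time_eq[OF rec] by (simp add: regen_def)
    fix k' assume k': "1 \<le> k' \<and> good_at e (Y e 0 (record_time e k'))"
    show "k \<le> k'"
    proof (rule ccontr)
      assume "\<not> k \<le> k'"
      then obtain r' where r': "record_at e k' r'" using record_smaller[OF rec, of k'] by auto
      then show False using k' r record_time_eq[OF r'] \<open>\<not> k \<le> k'\<close> by (auto simp: regen_def)
    qed
  qed
  then show ?thesis unfolding regen_time_def using record_time_eq[OF rec] by simp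
qed

lemma chain_Cons_iff:
  "e \<in> chain (A # As) \<longleftrightarrow> (\<exists>k r. regen e k r) \<and> first_piece e \<in> A \<and> renew e \<in> chain As"
  unfolding chain.simps first_piece_def renew_def using regen_time_eq by blast

text \<open>Splits off the existence of the regenerations, which turns out to be almost sure, from
  the conditions on the pieces.\<close>

lemma chain_iff:
  "e \<in> chain As \<longleftrightarrow> e \<in> chain (map (\<lambda>_. UNIV) As) \<and> (\<forall>i<length As. first_piece ((renew ^^ i) e) \<in> As ! i)"
proof (induction As arbitrary: e)
  case (Cons A As)
  have "(\<forall>i<length (A # As). first_piece ((renew ^^ i) e) \<in> (A # As) ! i) \<longleftrightarrow>
     first_piece e \<in> A \<and> (\<forall>i<length As. first_piece ((renew ^^ i) (renew e)) \<in> As ! i)"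
    by (auto simp: All_less_Suc2 funpow_swap1)
  then show ?case using Cons[of "renew e"] unfolding chain_Cons_iff list.map by blast
qed simp

lemma measurable_record_time [measurable]: "(\<lambda>e. record_time e k) \<in> measurable ENV (count_space UNIV)"
proof -
  have [measurable]: "Measurable.pred ENV (\<lambda>e. (1 - v) * real k \<le> ht (Y e 0 n))" for n by measurable
  show ?thesis unfolding record_time_def by measurable
qed

lemma measurable_regen_time [measurable]: "regen_time \<in> measurable ENV (count_space UNIV)"
proof -
  have [measurable]: "Measurable.pred ENV (\<lambda>e. good_at e (Y e 0 (record_time e k)))" for k
    by (rule measurable_compose_countable[where f="\<lambda>r e. good_at e (Y e 0 r)"]) measurable
  have "(\<lambda>e. LEAST k. 1 \<le> k \<and> good_at e (Y e 0 (record_time e k))) \<in> measurable ENV (count_space UNIV)"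
    by measurable
  then have "(\<lambda>e. record_time e (LEAST k. 1 \<le> k \<and> good_at e (Y e 0 (record_time e k)))) \<in> measurable ENV (count_space UNIV)"
    by (rule measurable_compose_countable[where f="\<lambda>k e. record_time e k", rotated]) measurable
  then show ?thesis unfolding regen_time_def[abs_def] .
qed

lemma measurable_first_piece [measurable]: "first_piece \<in> measurable ENV (count_space UNIV)"
proof -
  have "(\<lambda>e. seg e r) \<in> measurable ENV (count_space UNIV)" for r
    unfolding measurable_count_space_eq2_countable
  proof (intro conjI ballI)
    fix a
    show "(\<lambda>e. seg e r) -` {a} \<inter> space ENV \<in> sets ENV"
      using sets_ENV_Collect[OF pred_seg, of r a] by (simp add: vimage_def)
  qed simp
  then have "(\<lambda>e. seg e (regen_time e)) \<in> measurable ENV (count_space UNIV)"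
    by (rule measurable_compose_countable[where f="\<lambda>r e. seg e r"]) measurable
  then show ?thesis unfolding first_piece_def[abs_def] .
qed

lemma measurable_renew [measurable]: "renew \<in> measurable ENV ENV"
proof -
  have "(\<lambda>e. Y e 0 (regen_time e)) \<in> measurable ENV (count_space UNIV)"
    by (rule measurable_compose_countable[where f="\<lambda>r e. Y e 0 r"]) measurable
  then have "(\<lambda>e. env_shift (Y e 0 (regen_time e)) e) \<in> measurable ENV ENV"
    by (rule measurable_compose_countable[where f="\<lambda>z e. env_shift z e", rotated]) measurable
  then show ?thesis unfolding renew_def[abs_def] .
qed

lemma measurable_renew_pow [measurable]: "renew ^^ n \<in> measurable ENV ENV"
  by (induction n) (simp_all add: measurable_comp[OF _ measurable_renew])

end

section \<open>The joint law of the pieces\<close>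

context ballistic_law
begin

definition piece_law :: "nat \<Rightarrow> seg set \<Rightarrow> real" where
  "piece_law n A = (if n = 0 then first_seg False A else first_seg True A / p_good)"

lemma prob_chain: "prob (chain As) = (\<Prod>i<length As. piece_law i (As ! i))"
proof (cases As)
  case Nil
  then show ?thesis using prob_space by simp
next
  case (Cons A Bs)
  have "(\<Prod>B\<leftarrow>Bs. first_seg True B / p_good) = (\<Prod>i<length Bs. piece_law (Suc i) (Bs ! i))"
    unfolding piece_law_def by (simp add: prod.list_conv_set_nth atLeast0LessThan)
  then show ?thesis unfolding Cons chain_prob[OF p_good_pos]
    by (simp add: prod.lessThan_Suc_shift piece_law_def del: prod.lessThan_Suc)
qed

lemma regen_sets: "{e. \<exists>k r. regen e k r} \<in> events"
  by (rule sets_P_Collect) measurable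

lemma piece_law_UNIV: "piece_law n UNIV = 1"
proof -
  have "prob {e. good_at e 0 \<and> (\<exists>k r. regen e k r)} = p_good"
    using prob_Int_almost_sure[OF _ regen_sets regen_prob, of "{e. good_at e 0}"] sets_P_Collect[OF pred_good_at[of 0]]
    by (simp add: p_good_def Int_def)
  then show ?thesis using p_good_pos regen_prob by (simp add: piece_law_def first_seg_def)
qed

lemma prob_pieces:
  "prob {e. \<forall>i<length As. first_piece ((renew ^^ i) e) \<in> As ! i} = (\<Prod>i<length As. piece_law i (As ! i))"
proof -
  let ?U = "chain (map (\<lambda>_. UNIV) As)"
  have "{e. \<forall>i<length As. first_piece ((renew ^^ i) e) \<in> As ! i} \<in> events"
    by (rule sets_P_Collect) measurable
  moreover have "?U \<in> events" using chain_sets by (simp add: sets_P)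
  moreover have "prob ?U = 1" by (simp add: prob_chain piece_law_UNIV)
  ultimately have "prob {e. \<forall>i<length As. first_piece ((renew ^^ i) e) \<in> As ! i}
     = prob ({e. \<forall>i<length As. first_piece ((renew ^^ i) e) \<in> As ! i} \<inter> ?U)"
    by (simp add: prob_Int_almost_sure)
  also have "{e. \<forall>i<length As. first_piece ((renew ^^ i) e) \<in> As ! i} \<inter> ?U = chain As"
    using chain_iff by blast
  finally show ?thesis by (simp add: prob_chain)
qed

lemma prob_pieces_finite:
  assumes J: "finite J" "J \<noteq> {}"
  shows "prob {e. \<forall>j\<in>J. first_piece ((renew ^^ j) e) \<in> A j} = (\<Prod>j\<in>J. piece_law j (A j))"
proof -
  define N where "N = Suc (Max J)"
  have JN: "J \<subseteq> {..<N}" using J by (auto simp: N_def less_Suc_eq_le)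
  \<comment> \<open>Missing indices receive the full set, whose mass is 1 by almost sure
    regeneration.\<close>
  define As where "As = map (\<lambda>i. if i \<in> J then A i else UNIV) [0..<N]"
  have "{e. \<forall>j\<in>J. first_piece ((renew ^^ j) e) \<in> A j} = {e. \<forall>i<length As. first_piece ((renew ^^ i) e) \<in> As ! i}"
    using JN by (auto simp: As_def)
  also have "prob \<dots> = (\<Prod>i<N. piece_law i (if i \<in> J then A i else UNIV))"
    unfolding prob_pieces by (auto simp: As_def intro!: prod.cong)
  also have "\<dots> = (\<Prod>j\<in>J. piece_law j (if j \<in> J then A j else UNIV))"
    by (rule prod.mono_neutral_right) (use JN piece_law_UNIV in auto)
  also have "\<dots> = (\<Prod>j\<in>J. piece_law j (A j))" by (rule prod.cong) auto
  finally show ?thesis .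
qed

lemma first_seg_good: "first_seg True A = prob {e. good_at e 0 \<and> first_piece e \<in> A}"
proof -
  have "{e. good_at e 0 \<and> first_piece e \<in> A} \<in> events"
    by (rule sets_P_Collect) measurable
  then have "prob {e. good_at e 0 \<and> first_piece e \<in> A} = prob ({e. good_at e 0 \<and> first_piece e \<in> A} \<inter> {e. \<exists>k r. regen e k r})"
    by (simp add: prob_Int_almost_sure regen_sets regen_prob)
  also have "{e. good_at e 0 \<and> first_piece e \<in> A} \<inter> {e. \<exists>k r. regen e k r} =
      {e. good_at e 0 \<and> (\<exists>k r. regen e k r \<and> seg e r \<in> A)}"
    unfolding first_piece_def using regen_time_eq by blast
  finally show ?thesis by (simp add: first_seg_def)
qed

end

section \<open>From the model to the law on environments\<close>

abbreviation config :: "(path \<Rightarrow> nat) \<Rightarrow> (site \<Rightarrow> real) \<Rightarrow> env" where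
  "config m u \<equiv> ({w. 0 < m w}, u)"

lemma pcount_eq_0_iff: "pcount m A = 0 \<longleftrightarrow> {w. 0 < m w} \<inter> A = {}"
proof -
  have "pcount m A = 0 \<longleftrightarrow> (AE w in count_space A. ennreal (of_nat (m w)) = 0)"
    unfolding pcount_def by (rule nn_integral_0_iff_AE) simp
  then show ?thesis by (auto simp: AE_count_space)
qed

context walk
begin

lemma Ywalk_eq: "Ywalk pc pb m u y n = Y (config m u) y n"
proof (induction n)
  case (Suc n)
  have tr: "z \<in> trace m \<longleftrightarrow> {w. 0 < m w} \<inter> through z \<noteq> {}" for z
    by (cases z) (auto simp: trace_def through_def)
  show ?case unfolding Ywalk.simps Y.simps Suc Let_def goes_up_def tr
    by (auto simp: prod_eq_iff)
qed simp

lemma good_iff: "good pc pb v m u y \<longleftrightarrow> good_at (config m u) y"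
  by (simp add: good_def good_at_def Aevent_def pcount_eq_0_iff Ywalk_eq)

lemma Xwalk_eq: "Xwalk pc pb m u n = fst (Y (config m u) 0 n)"
  by (simp add: Xwalk_def Ywalk_eq zero_prod_def)

lemma tau_eq: "tau pc pb v m u = regen_time (config m u)"
proof -
  have R: "Rtime pc pb v m u k = record_time (config m u) k" for k
    unfolding Rtime_def record_time_def Xwalk_eq by (simp add: height_def algebra_simps)
  show ?thesis
    unfolding tau_def Iindex_def regen_time_def R good_iff Ywalk_eq by (simp add: zero_prod_def)
qed

text \<open>Shifts compose additively, so \<open>n\<close> renewals amount to one recentring at the
  position of the walk after the first \<open>n\<close> regeneration times.\<close>

lemma renew_pow:
  "(renew ^^ n) e = env_shift (Y e 0 (\<Sum>i<n. regen_time ((renew ^^ i) e))) e"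
proof (induction n)
  case (Suc n)
  let ?s = "\<Sum>i<n. regen_time ((renew ^^ i) e)"
  let ?t = "regen_time ((renew ^^ n) e)"
  have "(renew ^^ Suc n) e = env_shift (Y ((renew ^^ n) e) 0 ?t) ((renew ^^ n) e)"
    by (simp add: renew_def)
  also have "\<dots> = env_shift (Y (env_shift (Y e 0 ?s) e) 0 ?t) (env_shift (Y e 0 ?s) e)"
    by (metis Suc)
  also have "\<dots> = env_shift (Y e 0 (?s + ?t)) e"
    by (simp add: env_shift_comp Y_shift Y_add)
  finally show ?case by simp
qed simp

lemma piece_eq:
  assumes "\<And>n s. \<tau>s (Suc n) s = regen_time ((renew ^^ n) (config (m s) (U s)))"
  shows "piece (Xwalk pc pb (m s) (U s)) \<tau>s n s = first_piece ((renew ^^ n) (config (m s) (U s)))"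
proof -
  let ?e = "config (m s) (U s)"
  have S: "Ssum \<tau>s n s = (\<Sum>i<n. regen_time ((renew ^^ i) ?e))"
    by (induction n) (simp_all add: Ssum_def assms)
  have "fst (Y ((renew ^^ n) ?e) 0 j) = fst (Y ?e 0 (Ssum \<tau>s n s + j)) - fst (Y ?e 0 (Ssum \<tau>s n s))" for j
  proof -
    have "(renew ^^ n) ?e = env_shift (Y ?e 0 (Ssum \<tau>s n s)) ?e"
      unfolding S by (rule renew_pow)
    then show ?thesis by (simp add: Y_shift Y_add)
  qed
  then show ?thesis
    unfolding piece_def first_piece_def seg_def Xwalk_eq assms by simp
qed

end

section \<open>The law of the environment in the model\<close>

lemma gen_sa_Collect:
  assumes "i \<in> I" "A \<in> sets (N i)"
  shows "{s \<in> space M. f i s \<in> A} \<in> gen_sa M I N f"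
proof -
  have "{s \<in> space M. f i s \<in> A} = f i -` A \<inter> space M" by auto
  then show ?thesis unfolding gen_sa_def using assms by (intro sigma_sets.Basic) blast
qed

lemma gen_sa_finite_Collect:
  assumes "finite J" "J \<subseteq> I" "\<And>i. i \<in> J \<Longrightarrow> A i \<in> sets (N i)"
  shows "{s \<in> space M. \<forall>i\<in>J. f i s \<in> A i} \<in> gen_sa M I N f"
  using assms
proof (induction J)
  case empty
  then show ?case by (simp add: gen_sa_def sigma_sets_top)
next
  case (insert i J)
  interpret sigma_algebra "space M" "gen_sa M I N f"
    unfolding gen_sa_def by (rule sigma_algebra_sigma_sets) auto
  have "{s \<in> space M. \<forall>j\<in>insert i J. f j s \<in> A j}
      = {s \<in> space M. f i s \<in> A i} \<inter> {s \<in> space M. \<forall>j\<in>J. f j s \<in> A j}" by auto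
  moreover have "{s \<in> space M. f i s \<in> A i} \<in> gen_sa M I N f"
    by (rule gen_sa_Collect) (use insert.prems in auto)
  moreover have "{s \<in> space M. \<forall>j\<in>J. f j s \<in> A j} \<in> gen_sa M I N f"
    using insert by auto
  ultimately show ?case by auto
qed

lemma poisson_law_void:
  assumes "prob_space M" "poisson_law M N lam" "N \<in> borel_measurable M"
  shows "measure M {s \<in> space M. N s = 0} = void_prob lam"
proof (cases "lam = \<infinity>")
  case True
  then have "AE s in M. N s = \<infinity>" using assms by (simp add: poisson_law_def)
  then have "AE s in M. N s \<noteq> 0" by eventually_elim simp
  moreover have "{s \<in> space M. N s = 0} \<in> sets M" using assms(3) by measurable
  ultimately have "emeasure M {s \<in> space M. N s = 0} = 0"
    using AE_iff_measurable[of "{s \<in> space M. N s = 0}" M "\<lambda>s. N s \<noteq> 0"] by simp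
  then show ?thesis using True by (simp add: void_prob_def measure_def)
next
  case False
  then show ?thesis using assms(2) unfolding poisson_law_def void_prob_def by (auto dest: spec[of _ 0])
qed

definition unif_cdf :: "real \<Rightarrow> real" where
  "unif_cdf t = measure (uniform_measure lborel {0..1}) {..t}"

lemma unif_cdf_pos: "0 < t \<Longrightarrow> 0 < unif_cdf t"
proof -
  assume t: "0 < t"
  have "{0..1} \<inter> {..t} = {0..min 1 t}" by auto
  then have "measure (uniform_measure lborel {0..1}) {..t} = min 1 t"
    using t by (subst measure_uniform_measure) auto
  then show ?thesis using t by (simp add: unif_cdf_def)
qed

text \<open>A cylinder pulls back to the event that a count vanishes, intersected with bounds on
  finitely many uniforms. The two events lie in independent sigma-algebras.\<close>

lemma env_law_of_model:
  fixes M :: "'a measure"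
    and m :: "'a \<Rightarrow> (int \<Rightarrow> int) \<Rightarrow> nat"
    and U :: "'a \<Rightarrow> int \<times> int \<Rightarrow> real"
    and V :: "'a \<Rightarrow> real"
  assumes M: "prob_space M"
    and PPP: "is_PPP M m (intensity \<rho> q)"
    and U_iid: "prob_space.indep_vars M (\<lambda>_. borel) (\<lambda>y s. U s y) UNIV"
    and U_unif: "\<forall>y. distr M lborel (\<lambda>s. U s y) = uniform_measure lborel {0..1::real}"
    and indep: "prob_space.indep_sets M
                  (\<lambda>i::nat. if i = 0 then gen_sa M (sets (intensity \<rho> q)) (\<lambda>_. borel) (\<lambda>A s. pcount (m s) A)
                            else if i = 1 then gen_sa M UNIV (\<lambda>_. borel) (\<lambda>y s. U s y)
                            else gen_sa M {()} (\<lambda>_. borel) (\<lambda>_. V))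
                  {0, 1, 2}"
  shows "(\<lambda>s. config (m s) (U s)) \<in> measurable M ENV"
    and "env_law (distr M ENV (\<lambda>s. config (m s) (U s))) (intensity \<rho> q) unif_cdf"
proof -
  interpret M: prob_space M by fact
  let ?\<mu> = "intensity \<rho> q"
  have Um [measurable]: "(\<lambda>s. U s y) \<in> borel_measurable M" for y
    using U_iid unfolding M.indep_vars_def by blast
  have Nm: "(\<lambda>s. pcount (m s) A) \<in> borel_measurable M"
    and Np: "poisson_law M (\<lambda>s. pcount (m s) A) (emeasure ?\<mu> A)" if "A \<in> sets Wsp" for A
    using PPP that by (auto simp: is_PPP_def)
  have pre: "(\<lambda>s. config (m s) (U s)) -` cyl A J t \<inter> space M
      = {s \<in> space M. pcount (m s) A = 0} \<inter> {s \<in> space M. \<forall>z\<in>J. U s z \<in> {..t z}}" for A J t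
    by (auto simp: cyl_def pcount_eq_0_iff)
  have ev0: "{s \<in> space M. pcount (m s) A = 0} \<in> sets M" if "A \<in> sets Wsp" for A
    using Nm[OF that] by measurable
  have ev1: "{s \<in> space M. \<forall>z\<in>J. U s z \<in> {..t z}} \<in> sets M" if "finite J" for J t
    using that by measurable
  show meas: "(\<lambda>s. config (m s) (U s)) \<in> measurable M ENV"
    by (rule measurable_into_ENV) (unfold pre, intro sets.Int ev0 ev1)
  have cdf: "M.prob {s \<in> space M. U s z \<in> {..t}} = unif_cdf t" for z t
  proof -
    have "unif_cdf t = measure (distr M lborel (\<lambda>s. U s z)) {..t}"
      by (simp only: unif_cdf_def U_unif[rule_format])
    also have "\<dots> = M.prob ((\<lambda>s. U s z) -` {..t} \<inter> space M)"
      by (rule measure_distr) auto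
    also have "(\<lambda>s. U s z) -` {..t} \<inter> space M = {s \<in> space M. U s z \<in> {..t}}" by auto
    finally show ?thesis by simp
  qed
  have marks: "M.prob {s \<in> space M. \<forall>z\<in>J. U s z \<in> {..t z}} = (\<Prod>z\<in>J. unif_cdf (t z))" if "finite J" for J t
  proof (cases "J = {}")
    case True
    then show ?thesis by (simp add: M.prob_space)
  next
    case False
    have "M.prob (\<Inter>z\<in>J. (\<lambda>s. U s z) -` {..t z} \<inter> space M)
        = (\<Prod>z\<in>J. M.prob ((\<lambda>s. U s z) -` {..t z} \<inter> space M))"
      by (rule M.indep_varsD[OF U_iid]) (use that False in auto)
    moreover have "(\<Inter>z\<in>J. (\<lambda>s. U s z) -` {..t z} \<inter> space M) = {s \<in> space M. \<forall>z\<in>J. U s z \<in> {..t z}}"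
      using False by auto
    moreover have "(\<lambda>s. U s z) -` {..t z} \<inter> space M = {s \<in> space M. U s z \<in> {..t z}}" for z by auto
    ultimately show ?thesis by (simp only: cdf)
  qed
  let ?P = "distr M ENV (\<lambda>s. config (m s) (U s))"
  interpret P: prob_space ?P by (rule M.prob_space_distr[OF meas])
  show "env_law ?P ?\<mu> unif_cdf"
  proof (unfold_locales)
    show "sets ?P = sets ENV" by simp
    show "sets ?\<mu> = sets Wsp" by simp
    show "emeasure ?\<mu> (path_shift y -` A) = emeasure ?\<mu> A" if "A \<in> sets Wsp" for A y
      by (rule intensity_shift[OF that])
    fix A and J :: "site set" and t :: "site \<Rightarrow> real" assume A: "A \<in> sets Wsp" and J: "finite J"
    let ?E0 = "{s \<in> space M. pcount (m s) A = 0}"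
    let ?E1 = "{s \<in> space M. \<forall>z\<in>J. U s z \<in> {..t z}}"
    let ?G = "\<lambda>i::nat. if i = 0 then gen_sa M (sets ?\<mu>) (\<lambda>_. borel) (\<lambda>A s. pcount (m s) A)
                            else if i = 1 then gen_sa M UNIV (\<lambda>_. borel) (\<lambda>y s. U s y)
                            else gen_sa M {()} (\<lambda>_. borel) (\<lambda>_. V)"
    have "?E0 \<in> gen_sa M (sets ?\<mu>) (\<lambda>_. borel) (\<lambda>A s. pcount (m s) A)"
      using gen_sa_Collect[of A "sets ?\<mu>" "{0}" "\<lambda>_. borel" M "\<lambda>A s. pcount (m s) A"] A by simp
    moreover have "?E1 \<in> gen_sa M UNIV (\<lambda>_. borel) (\<lambda>y s. U s y)"
      by (rule gen_sa_finite_Collect) (use J in auto)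
    ultimately have "\<forall>i\<in>{0, 1}. (if i = 0 then ?E0 else ?E1) \<in> ?G i" by simp
    from M.indep_setsD[OF indep, of "{0, 1}", OF _ _ _ this]
    have "M.prob (?E0 \<inter> ?E1) = M.prob ?E0 * M.prob ?E1" by (simp add: Int_commute)
    then show "measure ?P (cyl A J t) = void_prob (emeasure ?\<mu> A) * (\<Prod>z\<in>J. unif_cdf (t z))"
      by (subst measure_distr[OF meas cyl_in_sets[OF A J]])
         (simp only: pre marks[OF J] poisson_law_void[OF M Np[OF A] Nm[OF A]])
  qed
qed

theorem theorem4p7:
  fixes M :: "'a measure"
    and m :: "'a \<Rightarrow> (int \<Rightarrow> int) \<Rightarrow> nat"
    and U :: "'a \<Rightarrow> int \<times> int \<Rightarrow> real"
    and V :: "'a \<Rightarrow> real"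
    and q \<rho> pc pb vstar c0 \<gamma> :: real
  assumes M: "prob_space M"
    and q: "0 < q" "q < 1"
    and p: "0 \<le> pc" "pc \<le> 1" "0 \<le> pb" "pb \<le> 1"
    and vb: "2 * pb - 1 > 0"
    and vc: "2 * pc - 1 > -1"
    and rho: "0 < \<rho>"
    and PPP: "is_PPP M m (intensity \<rho> q)"
    and U_iid: "prob_space.indep_vars M (\<lambda>_. borel) (\<lambda>y s. U s y) UNIV"
    and U_unif: "\<forall>y. distr M lborel (\<lambda>s. U s y) = uniform_measure lborel {0..1::real}"
    and V_meas: "V \<in> borel_measurable M"
    and V_unif: "distr M lborel V = uniform_measure lborel {0..1::real}"
    and indep: "prob_space.indep_sets M
                  (\<lambda>i::nat. if i = 0 then gen_sa M (sets (intensity \<rho> q)) (\<lambda>_. borel) (\<lambda>A s. pcount (m s) A)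
                            else if i = 1 then gen_sa M UNIV (\<lambda>_. borel) (\<lambda>y s. U s y)
                            else gen_sa M {()} (\<lambda>_. borel) (\<lambda>_. V))
                  {0, 1, 2}"
    and vstar: "0 < vstar" "vstar < 2 * pb - 1"
    and c0: "0 < c0" and gam: "1 < \<gamma>"
    and ballistic: "\<forall>L::nat. 1 \<le> L \<longrightarrow>
          measure M {s \<in> space M. \<exists>n::nat. real_of_int (Xwalk pc pb (m s) (U s) n) < real n * vstar - real L}
            \<le> exp (- c0 * (ln (real L) powr \<gamma>)) / c0"
  shows "\<exists>\<tau>s :: nat \<Rightarrow> 'a \<Rightarrow> nat.
           (\<forall>s\<in>space M. \<tau>s 1 s = tau pc pb (vstar / 3) (m s) (U s)) \<and>
           prob_space.indep_vars M (\<lambda>_. count_space UNIV)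
              (\<lambda>n s. piece (Xwalk pc pb (m s) (U s)) \<tau>s n s) UNIV \<and>
           (\<forall>n\<ge>1. distr M (count_space UNIV) (\<lambda>s. piece (Xwalk pc pb (m s) (U s)) \<tau>s n s)
                  = distr (uniform_measure M {s \<in> space M. good pc pb (vstar / 3) (m s) (U s) (0, 0)})
                          (count_space UNIV) (\<lambda>s. piece (Xwalk pc pb (m s) (U s)) \<tau>s 0 s))"
proof -
  interpret M: prob_space M by fact
  define v where "v = vstar / 3"
  have v_bounds: "0 < v" "v < 1" "v \<le> 1 / 2" using vstar p by (auto simp: v_def)
  interpret walk v pc pb by unfold_locales (use v_bounds p in auto)
  define cf where "cf s = config (m s) (U s)" for s
  note model = env_law_of_model[OF M PPP U_iid U_unif indep, folded cf_def]
  note cf [measurable] = model(1)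
  define P where "P = distr M ENV cf"
  interpret env_law P "intensity \<rho> q" unif_cdf unfolding P_def by (rule model(2))
  interpret walk_law v pc pb P "intensity \<rho> q" unif_cdf by unfold_locales
  have P_M: "prob {e. Q e} = M.prob {s \<in> space M. Q (cf s)}" if "Measurable.pred ENV Q" for Q
  proof -
    have "prob {e. Q e} = M.prob (cf -` {e. Q e} \<inter> space M)"
      unfolding P_def by (rule measure_distr[OF cf sets_ENV_Collect[OF that]])
    also have "cf -` {e. Q e} \<inter> space M = {s \<in> space M. Q (cf s)}" by auto
    finally show ?thesis .
  qed
  obtain \<theta> where \<theta>: "0 < \<theta>" "chernoff q v \<theta> < 1" using chernoff_less_1[OF v_bounds(1)] by blast
  define D where "D = 2 / (1 - exp (- \<theta> / 2))"
  have D: "1 \<le> D" using \<theta> by (simp add: D_def field_simps)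
  \<comment> \<open>Common constants: \<open>intensity_cross\<close> gives exactly these, and
    \<open>intensity_exceed\<close> is weakened to them by \<open>1 \<le> D\<close> and
    \<open>\<theta>' \<le> \<theta>\<close>.\<close>
  define c where "c = \<rho> / (1 - chernoff q v \<theta>) * D"
  define \<theta>' where "\<theta>' = \<theta> * (1 - v) / 4"
  have c: "0 \<le> c" using rho \<theta> D by (simp add: c_def)
  have \<theta>': "0 < \<theta>'" "\<theta>' \<le> \<theta>"
    using \<theta> v_bounds mult_left_mono[of "(1 - v) / 4" 1 \<theta>] by (auto simp: \<theta>'_def)
  interpret ballistic_law v pc pb P "intensity \<rho> q" unif_cdf c \<theta>'
  proof unfold_locales
    show "emeasure (intensity \<rho> q) (exceed 0 s) \<le> ennreal (c * exp (- \<theta>' * s))" if "0 \<le> s" for s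
    proof -
      have "\<rho> * (exp (- \<theta> * s) / (1 - chernoff q v \<theta>)) \<le> c * exp (- \<theta>' * s)"
      proof -
        have "exp (- \<theta> * s) \<le> exp (- \<theta>' * s)" using \<theta>' that by (simp add: mult_right_mono)
        then have "\<rho> / (1 - chernoff q v \<theta>) * exp (- \<theta> * s) \<le> \<rho> / (1 - chernoff q v \<theta>) * exp (- \<theta>' * s)"
          using rho \<theta> by (intro mult_left_mono) auto
        also have "\<dots> \<le> c * exp (- \<theta>' * s)"
          unfolding c_def using rho \<theta> D mult_left_mono[of 1 D "\<rho> / (1 - chernoff q v \<theta>)"]
          by (intro mult_right_mono) auto
        finally show ?thesis by simp
      qed
      then show ?thesis
        using intensity_exceed[OF q \<theta> rho, of s] by (meson ennreal_leI order.trans)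
    qed
    show "emeasure (intensity \<rho> q) (HR 0 \<inter> H (int l, int l)) \<le> ennreal (c * exp (- \<theta>' * real l))" for l
      using intensity_cross[OF q \<theta> rho, of l] by (simp add: c_def \<theta>'_def D_def field_simps)
    \<comment> \<open>\<open>v_circ > -1\<close> and \<open>v_bullet > 0\<close> say in particular
      that both thresholds are positive.\<close>
    show "0 < unif_cdf (min pc pb)" by (rule unif_cdf_pos) (use vb vc in auto)
    show "(\<lambda>L. prob {e. \<exists>n. real_of_int (fst (Y e 0 n)) < real n * (3 * v) - real L}) \<longlonglongrightarrow> 0"
    proof (rule tendsto_sandwich[where f="\<lambda>_. 0" and h="\<lambda>L. exp (- c0 * (ln (real L) powr \<gamma>)) / c0"])
      have "prob {e. \<exists>n. real_of_int (fst (Y e 0 n)) < real n * (3 * v) - real L}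
          = M.prob {s \<in> space M. \<exists>n. real_of_int (Xwalk pc pb (m s) (U s) n) < real n * vstar - real L}" for L
        by (subst P_M) (measurable, simp add: Xwalk_eq cf_def v_def)
      then show "\<forall>\<^sub>F L in sequentially. prob {e. \<exists>n. real_of_int (fst (Y e 0 n)) < real n * (3 * v) - real L}
          \<le> exp (- c0 * (ln (real L) powr \<gamma>)) / c0"
        using ballistic by (auto simp: eventually_sequentially intro!: exI[of _ 1])
      have ln: "filterlim (\<lambda>L. ln (real L)) at_top sequentially"
        by (rule filterlim_compose[OF ln_at_top filterlim_real_sequentially])
      then have "filterlim (\<lambda>L. ln (real L) powr \<gamma>) at_top sequentially"
      proof (rule filterlim_at_top_mono)
        have "\<forall>\<^sub>F L in sequentially. 1 \<le> ln (real L)"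
          using ln by (simp add: filterlim_at_top)
        \<comment> \<open>Only divergence of the exponent is wanted, and \<open>\<gamma> > 1\<close>
          gives it by comparison with the logarithm itself.\<close>
        then show "\<forall>\<^sub>F L in sequentially. ln (real L) \<le> ln (real L) powr \<gamma>"
        proof eventually_elim
          case (elim L)
          then show ?case using powr_mono[of 1 \<gamma> "ln (real L)"] gam by simp
        qed
      qed
      then have "filterlim (\<lambda>L. c0 * (ln (real L) powr \<gamma>)) at_top sequentially"
        by (rule filterlim_tendsto_pos_mult_at_top[OF tendsto_const c0])
      then have "(\<lambda>L. exp (- (c0 * (ln (real L) powr \<gamma>)))) \<longlonglongrightarrow> 0"
        by (rule filterlim_compose[OF exp_at_bot filterlim_compose[OF filterlim_uminus_at_bot_at_top]])
      then have "(\<lambda>L. exp (- (c0 * (ln (real L) powr \<gamma>))) / c0) \<longlonglongrightarrow> 0 / c0"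
        by (rule tendsto_divide[OF _ tendsto_const]) (use c0 in simp)
      then show "(\<lambda>L. exp (- c0 * (ln (real L) powr \<gamma>)) / c0) \<longlonglongrightarrow> 0" by simp
    qed auto
  qed (use v_bounds c \<theta>' in auto)

  \<comment> \<open>The times are numbered from 1, so the \<open>n\<close>-th one is read after
    \<open>n - 1\<close> renewals.\<close>
  define \<tau>s :: "nat \<Rightarrow> 'a \<Rightarrow> nat" where "\<tau>s n s = regen_time ((renew ^^ (n - 1)) (cf s))" for n s
  define Z where "Z n s = piece (Xwalk pc pb (m s) (U s)) \<tau>s n s" for n s
  have Z: "Z n s = first_piece ((renew ^^ n) (cf s))" for n s
    unfolding Z_def cf_def by (rule piece_eq) (simp add: \<tau>s_def cf_def)
  have Z_meas [measurable]: "Z n \<in> measurable M (count_space UNIV)" for n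
    unfolding Z[abs_def] by measurable
  have joint: "M.prob {s \<in> space M. \<forall>j\<in>J. Z j s \<in> A j} = (\<Prod>j\<in>J. piece_law j (A j))"
    if J: "finite J" "J \<noteq> {}" for J A
  proof -
    have "Measurable.pred ENV (\<lambda>e. \<forall>j\<in>J. first_piece ((renew ^^ j) e) \<in> A j)"
      using J(1) by measurable
    from P_M[OF this] show ?thesis unfolding Z prob_pieces_finite[OF J] by simp
  qed
  have single: "M.prob {s \<in> space M. Z n s \<in> A} = piece_law n A" for n A
    using joint[of "{n}" "\<lambda>_. A"] by simp
  have "M.indep_vars (\<lambda>_. count_space UNIV) Z UNIV"
    unfolding M.indep_vars_def2
  proof (intro conjI ballI M.indep_setsI)
    fix A :: "nat \<Rightarrow> 'a set" and J assume J: "J \<noteq> {}" "J \<subseteq> UNIV" "finite J"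
      and "\<forall>j\<in>J. A j \<in> {Z j -` B \<inter> space M |B. B \<in> sets (count_space UNIV)}"
    then obtain B where B: "\<And>j. j \<in> J \<Longrightarrow> A j = Z j -` B j \<inter> space M" by (simp, metis)
    have AB: "A j = {s \<in> space M. Z j s \<in> B j}" if "j \<in> J" for j using B[OF that] by auto
    then have "(\<Inter>j\<in>J. A j) = {s \<in> space M. \<forall>j\<in>J. Z j s \<in> B j}" using J by auto
    then show "M.prob (\<Inter>j\<in>J. A j) = (\<Prod>j\<in>J. M.prob (A j))"
      using joint[OF J(3,1), of B] AB by (simp add: single)
  qed (use Z_meas in \<open>auto intro: measurable_sets\<close>)
  moreover have "distr M (count_space UNIV) (Z n)
      = distr (uniform_measure M {s \<in> space M. good pc pb v (m s) (U s) (0, 0)}) (count_space UNIV) (Z 0)"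
    if n: "1 \<le> n" for n
  proof (rule measure_eqI)
    fix A assume "A \<in> sets (distr M (count_space UNIV) (Z n))"
    let ?G = "{s \<in> space M. good pc pb v (m s) (U s) (0, 0)}"
    have G: "?G = {s \<in> space M. good_at (cf s) 0}" by (simp add: good_iff cf_def zero_prod_def)
    have G_sets: "?G \<in> sets M" unfolding G by measurable
    have G_prob: "M.prob ?G = p_good" unfolding G p_good_def by (rule P_M[symmetric]) measurable
    have "first_seg True A = M.prob {s \<in> space M. good_at (cf s) 0 \<and> first_piece (cf s) \<in> A}"
      unfolding first_seg_good by (rule P_M) measurable
    also have "{s \<in> space M. good_at (cf s) 0 \<and> first_piece (cf s) \<in> A} = ?G \<inter> (Z 0 -` A \<inter> space M)"
      unfolding G by (auto simp: Z)
    finally have GA: "M.prob (?G \<inter> (Z 0 -` A \<inter> space M)) = first_seg True A" by simp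
    have ZA: "Z 0 -` A \<inter> space M \<in> sets M" by (rule measurable_sets[OF Z_meas]) simp
    have "emeasure (distr (uniform_measure M ?G) (count_space UNIV) (Z 0)) A
        = emeasure (uniform_measure M ?G) (Z 0 -` A \<inter> space M)"
      by (subst emeasure_distr) (auto simp: measurable_cong_sets[OF sets_uniform_measure refl])
    also have "\<dots> = emeasure M (?G \<inter> (Z 0 -` A \<inter> space M)) / emeasure M ?G"
      by (rule emeasure_uniform_measure[OF G_sets ZA])
    also have "\<dots> = ennreal (first_seg True A / p_good)"
      unfolding M.emeasure_eq_measure GA G_prob
      by (rule divide_ennreal) (use p_good_pos in \<open>auto simp: first_seg_def\<close>)
    also have "\<dots> = ennreal (M.prob {s \<in> space M. Z n s \<in> A})"
      using n unfolding single by (simp add: piece_law_def)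
    also have "{s \<in> space M. Z n s \<in> A} = Z n -` A \<inter> space M" by auto
    also have "ennreal (M.prob \<dots>) = emeasure (distr M (count_space UNIV) (Z n)) A"
      by (subst emeasure_distr) (auto simp: M.emeasure_eq_measure)
    finally show "emeasure (distr M (count_space UNIV) (Z n)) A
      = emeasure (distr (uniform_measure M ?G) (count_space UNIV) (Z 0)) A" by simp
  qed simp
  moreover have "\<tau>s 1 s = tau pc pb v (m s) (U s)" for s
    by (simp add: \<tau>s_def tau_eq cf_def)
  ultimately show ?thesis
    unfolding Z_def[abs_def] v_def by (intro exI[of _ \<tau>s]) blast
qed

end
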